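(* Let $X=\{x_k\}_{k=1}^\infty\subset\mathbb{R}$ be an increasing sequence such that, with $d_k:=x_{k+1}-x_k$, one has $\inf_{k\ge 1}d_k>0$ and $\sup_{k\ge 1}d_k<\infty$, and let $\alpha=\{\alpha_k\}_{k=1}^\infty\subset\mathbb{R}$. Let $L_{X,\alpha}$ be the self-adjoint operator in $L^2(\mathbb{R})$ with $\delta$-interactions of strengths $\alpha_k$ at the points $x_k$. Define the sequence $\gamma=\{\gamma_k\}_{k=1}^\infty$ in $\mathbb{R}\cup\{\infty\}$ by $\gamma_1:=\alpha_1+d_1^{-1}$ and, for $k\ge1$: (i) if $\gamma_k\notin\{0,\infty\}$, then $\gamma_{k+1}:=\alpha_{k+1}+d_{k+1}^{-1}+d_k^{-1}-d_k^{-2}\gamma_k^{-1}$; (ii) if $\gamma_k=0$, then $\gamma_{k+1}:=\infty$ and $\gamma_{k+2}:=\alpha_{k+2}+d_{k+1}^{-1}+d_{k+2}^{-1}$. Then $$\kappa_-(L_{X,\alpha})=\kappa_-(\gamma)+N_\infty(\gamma),$$ where $\kappa_-(\gamma)$ and $N_\infty(\gamma)$ are the numbers of negative and of infinite elements, respectively, of the sequence $\gamma$.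
   Context: $W_2^2(\mathbb{R}\setminus X):=\{f\in L^2(\mathbb{R}): f,f'\in AC_{loc}(\mathbb{R}\setminus X),\ f''\in L^2(\mathbb{R})\}$. The operator $L_{X,\alpha}$ acts in $L^2(\mathbb{R})$ by $f\mapsto -f''$ (on $\mathbb{R}\setminus X$) on the domain $$\{f\in W_2^2(\mathbb{R}\setminus X): f(x_k+)=f(x_k-),\ f'(x_k+)-f'(x_k-)=\alpha_k f(x_k)\ \text{for all }x_k\in X\};$$ it is known to be self-adjoint. For a self-adjoint operator $T$ in a Hilbert space $\mathfrak{H}$ with spectral measure $E_T$, the number of negative squares is $\kappa_-(T):=\dim E_T(-\infty,0)\mathfrak{H}$. All counts take values in $\{0,1,2,\dots\}\cup\{\infty\}$. The symbol $\infty$ as an element of $\gamma$ is a formal value, not counted as negative. *)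

theory Defs
  imports "HOL-Analysis.Analysis" "HOL-Library.Extended_Nat"
begin

section \<open>Counting with values in the extended naturals\<close>

definition ecount :: "'a set \<Rightarrow> enat" where
  "ecount S = (if finite S then enat (card S) else \<infinity>)"


section \<open>Complex inner product spaces\<close>

text \<open>The complex inner product is linear in its first argument; the topology, the norm and
  convergence of series are those of the underlying real inner product space.\<close>

class complex_inner = real_inner +
  fixes scaleC :: "complex \<Rightarrow> 'a \<Rightarrow> 'a" (infixr "*\<^sub>C" 75)
    and cinner :: "'a \<Rightarrow> 'a \<Rightarrow> complex"
  assumes scaleC_add_right: "c *\<^sub>C (u + v) = c *\<^sub>C u + c *\<^sub>C v"
    and scaleC_add_left: "(b + c) *\<^sub>C u = b *\<^sub>C u + c *\<^sub>C u"
    and scaleC_scaleC: "b *\<^sub>C c *\<^sub>C u = (b * c) *\<^sub>C u"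
    and scaleR_scaleC: "r *\<^sub>R u = complex_of_real r *\<^sub>C u"
    and cinner_commute: "cinner u v = cnj (cinner v u)"
    and cinner_add_left: "cinner (u + v) w = cinner u w + cinner v w"
    and cinner_scaleC_left: "cinner (c *\<^sub>C u) v = c * cinner u v"
    and inner_cinner: "inner u v = Re (cinner u v)"

global_interpretation complex_vector:
  vector_space "scaleC :: complex \<Rightarrow> 'a \<Rightarrow> 'a::complex_inner"
  defines cspan = complex_vector.span
    and cdim = complex_vector.dim
proof unfold_locales
  fix u :: 'a
  show "1 *\<^sub>C u = u"
    using scaleR_scaleC[of 1 u] by simp
qed (simp_all add: scaleC_add_right scaleC_add_left scaleC_scaleC)

text \<open>\<^const>\<open>cdim\<close> is only meaningful for finite-dimensional subspaces.\<close>

definition ecdim :: "'a::complex_inner set \<Rightarrow> enat" where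
  "ecdim V = (if \<exists>B. finite B \<and> cspan B = V then enat (cdim V) else \<infinity>)"


section \<open>Spectral measures of unbounded operators\<close>

definition projection_valued_measure :: "(real set \<Rightarrow> 'a::complex_inner \<Rightarrow> 'a) \<Rightarrow> bool" where
  "projection_valued_measure E \<longleftrightarrow>
     (\<forall>A\<in>sets borel.
        Vector_Spaces.linear (*\<^sub>C) (*\<^sub>C) (E A) \<and>
        (\<forall>u. E A (E A u) = E A u) \<and>
        (\<forall>u v. cinner (E A u) v = cinner u (E A v))) \<and>
     E UNIV = id \<and>
     (\<forall>A :: nat \<Rightarrow> real set. range A \<subseteq> sets borel \<longrightarrow> disjoint_family A \<longrightarrow>
        (\<forall>u. (\<lambda>n. E (A n) u) sums E (\<Union>n. A n) u))"

definition diagonal_measure ::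
  "(real set \<Rightarrow> 'a::complex_inner \<Rightarrow> 'a) \<Rightarrow> 'a \<Rightarrow> real measure" where
  "diagonal_measure E u =
     measure_of UNIV (sets borel) (\<lambda>A. ennreal (Re (cinner (E A u) u)))"

text \<open>The integral of the identity with respect to the complex measure
  \<open>A \<mapsto> cinner (E A u) v\<close>, which polarization expresses through the diagonal
  measures.\<close>

definition spectral_form ::
  "(real set \<Rightarrow> 'a::complex_inner \<Rightarrow> 'a) \<Rightarrow> 'a \<Rightarrow> 'a \<Rightarrow> complex" where
  "spectral_form E u v =
     (\<Sum>k<4. \<i> ^ k * complex_of_real (\<integral>t. t \<partial>diagonal_measure E (u + \<i> ^ k *\<^sub>C v))) / 4"

text \<open>An unbounded operator \<open>T\<close> is identified with its graph. The predicate below says that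
  \<open>T\<close> is the integral of the identity with respect to \<open>E\<close>: its domain consists of
  the vectors \<open>u\<close> for which the square of the identity is integrable with respect to the diagonal
  measure at \<open>u\<close>, and \<open>cinner (T u) w\<close> is the integral of the identity with respect to
  \<open>A \<mapsto> cinner (E A u) w\<close>. As the domain is dense, it is enough to test with \<open>w\<close> in the domain,
  where the four integrals in the polarization formula converge. By the spectral theorem, every
  self-adjoint operator in a Hilbert space has exactly one such \<open>E\<close> (on Borel sets).\<close>

definition is_spectral_measure ::
  "(real set \<Rightarrow> 'a::complex_inner \<Rightarrow> 'a) \<Rightarrow> ('a \<times> 'a) set \<Rightarrow> bool" where
  "is_spectral_measure E T \<longleftrightarrow>
     projection_valued_measure E \<and>
     Domain T = {u. integrable (diagonal_measure E u) (\<lambda>t. t\<^sup>2)} \<and>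
     (\<forall>(u, v)\<in>T. \<forall>w\<in>Domain T. cinner v w = spectral_form E u w)"

definition negative_squares :: "(real set \<Rightarrow> 'a::complex_inner \<Rightarrow> 'a) \<Rightarrow> enat" where
  "negative_squares E = ecdim (range (E {..<0}))"


section \<open>The Hilbert space of square-integrable functions on the line\<close>

definition square_integrable :: "(real \<Rightarrow> complex) \<Rightarrow> bool" where
  "square_integrable f \<longleftrightarrow>
     f \<in> borel_measurable lebesgue \<and> integrable lebesgue (\<lambda>t. (cmod (f t))\<^sup>2)"

lemma square_integrable_zero: "square_integrable (\<lambda>t. 0)"
  by (simp add: square_integrable_def)

lemma square_integrable_scale:
  assumes "square_integrable f"
  shows "square_integrable (\<lambda>t. c * f t)"
  using assms by (auto simp: square_integrable_def norm_mult power_mult_distrib)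

lemma integrable_mult_cnj:
  assumes f: "square_integrable f" and g: "square_integrable g"
  shows "integrable lebesgue (\<lambda>t. f t * cnj (g t))"
proof (rule Bochner_Integration.integrable_bound)
  show "integrable lebesgue (\<lambda>t. (cmod (f t))\<^sup>2 + (cmod (g t))\<^sup>2)"
    using f g by (simp add: square_integrable_def)
  have [measurable]: "f \<in> borel_measurable lebesgue" "g \<in> borel_measurable lebesgue"
    using f g by (simp_all add: square_integrable_def)
  have [measurable]: "cnj \<in> borel_measurable borel"
    by (intro borel_measurable_continuous_onI continuous_intros)
  show "(\<lambda>t. f t * cnj (g t)) \<in> borel_measurable lebesgue"
    by measurable
  have "x * y \<le> x\<^sup>2 + y\<^sup>2" if "0 \<le> x" "0 \<le> y" for x y :: real
    using sum_squares_bound[of x y] mult_nonneg_nonneg[OF that] by linarith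
  then show "AE t in lebesgue. norm (f t * cnj (g t)) \<le> norm ((cmod (f t))\<^sup>2 + (cmod (g t))\<^sup>2)"
    by (simp add: norm_mult)
qed

lemma square_integrable_add:
  assumes f: "square_integrable f" and g: "square_integrable g"
  shows "square_integrable (\<lambda>t. f t + g t)"
proof -
  have [measurable]: "f \<in> borel_measurable lebesgue" "g \<in> borel_measurable lebesgue"
    using f g by (simp_all add: square_integrable_def)
  have "integrable lebesgue (\<lambda>t. (cmod (f t + g t))\<^sup>2)"
  proof (rule Bochner_Integration.integrable_bound)
    show "integrable lebesgue (\<lambda>t. 2 * (cmod (f t))\<^sup>2 + 2 * (cmod (g t))\<^sup>2)"
      using f g by (simp add: square_integrable_def)
    show "(\<lambda>t. (cmod (f t + g t))\<^sup>2) \<in> borel_measurable lebesgue"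
      by measurable
    have "(cmod (a + b))\<^sup>2 \<le> 2 * (cmod a)\<^sup>2 + 2 * (cmod b)\<^sup>2" for a b :: complex
    proof -
      have "(cmod (a + b))\<^sup>2 \<le> (cmod a + cmod b)\<^sup>2"
        by (intro power_mono norm_triangle_ineq) simp
      also have "\<dots> \<le> 2 * (cmod a)\<^sup>2 + 2 * (cmod b)\<^sup>2"
        using sum_squares_bound[of "cmod a" "cmod b"] by (simp add: power2_sum)
      finally show ?thesis .
    qed
    then show "AE t in lebesgue. norm ((cmod (f t + g t))\<^sup>2)
        \<le> norm (2 * (cmod (f t))\<^sup>2 + 2 * (cmod (g t))\<^sup>2)"
      by simp
  qed
  then show ?thesis
    by (simp add: square_integrable_def)
qed

definition L2_eq :: "(real \<Rightarrow> complex) \<Rightarrow> (real \<Rightarrow> complex) \<Rightarrow> bool" where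
  "L2_eq f g \<longleftrightarrow>
     square_integrable f \<and> square_integrable g \<and> (AE t in lebesgue. f t = g t)"

lemma part_equivp_L2_eq: "part_equivp L2_eq"
proof (rule part_equivpI)
  show "\<exists>f. L2_eq f f"
    using square_integrable_zero by (auto simp: L2_eq_def)
  show "symp L2_eq"
    by (auto simp: symp_def L2_eq_def elim: AE_mp)
  show "transp L2_eq"
    by (rule transpI) (auto simp: L2_eq_def elim: AE_mp)
qed

quotient_type L2 = "real \<Rightarrow> complex" / partial: L2_eq
  by (rule part_equivp_L2_eq)

lift_definition L2_inner :: "L2 \<Rightarrow> L2 \<Rightarrow> complex" is
  "\<lambda>f g. LINT t|lebesgue. f t * cnj (g t)"
proof -
  fix f f' g g' :: "real \<Rightarrow> complex"
  assume eq: "L2_eq f f'" "L2_eq g g'"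
  show "(LINT t|lebesgue. f t * cnj (g t)) = (LINT t|lebesgue. f' t * cnj (g' t))"
  proof (rule integral_cong_AE)
    show "(\<lambda>t. f t * cnj (g t)) \<in> borel_measurable lebesgue"
      using eq integrable_mult_cnj by (auto simp: L2_eq_def)
    show "(\<lambda>t. f' t * cnj (g' t)) \<in> borel_measurable lebesgue"
      using eq integrable_mult_cnj by (auto simp: L2_eq_def)
    show "AE t in lebesgue. f t * cnj (g t) = f' t * cnj (g' t)"
      using eq by (auto simp: L2_eq_def elim: AE_mp)
  qed
qed

instantiation L2 :: complex_inner
begin

lift_definition zero_L2 :: L2 is "\<lambda>t. 0"
  by (simp add: L2_eq_def square_integrable_zero)

lift_definition plus_L2 :: "L2 \<Rightarrow> L2 \<Rightarrow> L2" is "\<lambda>f g t. f t + g t"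
  by (auto simp: L2_eq_def square_integrable_add elim: AE_mp)

lift_definition scaleC_L2 :: "complex \<Rightarrow> L2 \<Rightarrow> L2" is "\<lambda>c f t. c * f t"
  by (auto simp: L2_eq_def square_integrable_scale elim: AE_mp)

definition uminus_L2 :: "L2 \<Rightarrow> L2" where "- u = scaleC (- 1) (u :: L2)"
definition minus_L2 :: "L2 \<Rightarrow> L2 \<Rightarrow> L2" where "u - v = u + - (v :: L2)"
definition scaleR_L2 :: "real \<Rightarrow> L2 \<Rightarrow> L2" where "r *\<^sub>R u = scaleC (complex_of_real r) (u :: L2)"
definition cinner_L2 :: "L2 \<Rightarrow> L2 \<Rightarrow> complex" where "cinner = L2_inner"
definition inner_L2 :: "L2 \<Rightarrow> L2 \<Rightarrow> real" where "inner u v = Re (cinner u (v :: L2))"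
definition norm_L2 :: "L2 \<Rightarrow> real" where "norm u = sqrt (inner u (u :: L2))"
definition dist_L2 :: "L2 \<Rightarrow> L2 \<Rightarrow> real" where "dist u v = norm (u - v :: L2)"
definition sgn_L2 :: "L2 \<Rightarrow> L2" where "sgn u = inverse (norm u) *\<^sub>R (u :: L2)"
definition uniformity_L2 :: "(L2 \<times> L2) filter" where
  "uniformity = (INF e\<in>{0<..}. principal {(u :: L2, v). dist u v < e})"
definition open_L2 :: "L2 set \<Rightarrow> bool" where
  "open (U :: L2 set) \<longleftrightarrow> (\<forall>u\<in>U. eventually (\<lambda>(u', v). u' = u \<longrightarrow> v \<in> U) uniformity)"

instance
proof
  fix u v w :: L2 and b c :: complex and r s :: real
  show add_assoc: "u + v + w = u + (v + w)"
    by transfer (simp add: L2_eq_def square_integrable_add add.assoc)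
  show add_commute: "u + v = v + u"
    by transfer (simp add: L2_eq_def square_integrable_add add.commute)
  show "0 + u = u"
    by transfer (simp add: L2_eq_def)
  show minus: "- u + u = 0"
    unfolding uminus_L2_def by transfer (simp add: L2_eq_def square_integrable_zero)
  show "u - v = u + - v"
    by (fact minus_L2_def)
  show add_right: "c *\<^sub>C (u + v) = c *\<^sub>C u + c *\<^sub>C v" for c and u v :: L2
    by transfer
      (simp add: L2_eq_def square_integrable_add square_integrable_scale distrib_left)
  show add_left: "(b + c) *\<^sub>C u = b *\<^sub>C u + c *\<^sub>C u" for b c and u :: L2
    by transfer
      (simp add: L2_eq_def square_integrable_add square_integrable_scale distrib_right)
  show scale: "b *\<^sub>C c *\<^sub>C u = (b * c) *\<^sub>C u" for b c and u :: L2
    by transfer (simp add: L2_eq_def square_integrable_scale mult.assoc)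
  show "r *\<^sub>R u = complex_of_real r *\<^sub>C u"
    by (fact scaleR_L2_def)
  show "r *\<^sub>R (u + v) = r *\<^sub>R u + r *\<^sub>R v"
    by (simp add: scaleR_L2_def add_right)
  show "(r + s) *\<^sub>R u = r *\<^sub>R u + s *\<^sub>R u"
    by (simp add: scaleR_L2_def add_left)
  show "r *\<^sub>R s *\<^sub>R u = (r * s) *\<^sub>R u"
    by (simp add: scaleR_L2_def scale)
  show "1 *\<^sub>R u = u"
    unfolding scaleR_L2_def by transfer (simp add: L2_eq_def)
  show cinner_commute: "cinner u v = cnj (cinner v u)" for u v :: L2
    unfolding cinner_L2_def
    by transfer (subst Bochner_Integration.integral_cnj[symmetric], simp add: mult.commute)
  show cinner_add: "cinner (u + v) w = cinner u w + cinner v w" for u v w :: L2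
    unfolding cinner_L2_def
    by transfer (simp add: L2_eq_def distrib_right integrable_mult_cnj)
  show cinner_scale: "cinner (c *\<^sub>C u) v = c * cinner u v" for c and u v :: L2
    unfolding cinner_L2_def by transfer (simp add: mult.assoc)
  show "inner u v = Re (cinner u v)"
    by (fact inner_L2_def)
  show "inner u v = inner v u"
    unfolding inner_L2_def by (subst cinner_commute) simp
  show "inner (u + v) w = inner u w + inner v w"
    by (simp add: inner_L2_def cinner_add)
  show "inner (r *\<^sub>R u) v = r * inner u v"
    by (simp add: inner_L2_def scaleR_L2_def cinner_scale)
  have "0 \<le> Re (cinner u u) \<and> (Re (cinner u u) = 0 \<longleftrightarrow> u = 0)"
    unfolding cinner_L2_def
  proof (transfer, goal_cases)
    case (1 f)
    then have f: "square_integrable f"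
      by (simp add: L2_eq_def)
    have *: "(LINT t|lebesgue. f t * cnj (f t))
        = complex_of_real (LINT t|lebesgue. (cmod (f t))\<^sup>2)"
      by (simp only: complex_norm_square[symmetric] integral_complex_of_real)
    have "(LINT t|lebesgue. (cmod (f t))\<^sup>2) = 0 \<longleftrightarrow> (AE t in lebesgue. (cmod (f t))\<^sup>2 = 0)"
      using f by (intro integral_nonneg_eq_0_iff_AE) (simp_all add: square_integrable_def)
    with f show ?case
      by (simp add: * L2_eq_def square_integrable_zero)
  qed
  then show "0 \<le> inner u u" "inner u u = 0 \<longleftrightarrow> u = 0"
    by (simp_all add: inner_L2_def)
  show "norm u = sqrt (inner u u)"
    by (fact norm_L2_def)
  show "dist u v = norm (u - v)"
    by (fact dist_L2_def)
  show "sgn u = inverse (norm u) *\<^sub>R u"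
    by (fact sgn_L2_def)
  show "uniformity = (INF e\<in>{0<..}. principal {(u :: L2, v). dist u v < e})"
    by (fact uniformity_L2_def)
  show "open U \<longleftrightarrow> (\<forall>u\<in>U. eventually (\<lambda>(u', v). u' = u \<longrightarrow> v \<in> U) uniformity)" for U :: "L2 set"
    by (fact open_L2_def)
qed

end


section \<open>Delta-interactions\<close>

definition absolutely_continuous_interval :: "real \<Rightarrow> real \<Rightarrow> (real \<Rightarrow> complex) \<Rightarrow> bool" where
  "absolutely_continuous_interval a b f \<longleftrightarrow>
     (\<forall>\<epsilon>>0. \<exists>\<delta>>0. \<forall>I :: (real \<times> real) set.
        finite I \<longrightarrow>
        (\<forall>(s, t)\<in>I. a \<le> s \<and> s \<le> t \<and> t \<le> b) \<longrightarrow>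
        disjoint_family_on (\<lambda>(s, t). {s<..<t}) I \<longrightarrow>
        (\<Sum>(s, t)\<in>I. t - s) < \<delta> \<longrightarrow>
        (\<Sum>(s, t)\<in>I. cmod (f t - f s)) < \<epsilon>)"

definition AC_loc :: "real set \<Rightarrow> (real \<Rightarrow> complex) set" where
  "AC_loc S = {f. \<forall>a b. {a..b} \<subseteq> S \<longrightarrow> absolutely_continuous_interval a b f}"

abbreviation derivative :: "(real \<Rightarrow> complex) \<Rightarrow> real \<Rightarrow> complex" where
  "derivative f \<equiv> (\<lambda>t. vector_derivative f (at t))"

text \<open>Where \<open>f\<close> is not differentiable, \<^term>\<open>derivative f\<close> takes a fixed arbitrary value. This is
  harmless for locally absolutely continuous \<open>f\<close>, which is differentiable almost everywhere: if
  moreover \<^term>\<open>derivative f\<close> is continuous on the complement of the closed null set \<open>X\<close>, then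
  \<open>f\<close> is an integral of it and hence differentiable at every point outside \<open>X\<close>.\<close>

definition sobolev22 :: "real set \<Rightarrow> (real \<Rightarrow> complex) set" where
  "sobolev22 X =
     {f. square_integrable f \<and> f \<in> AC_loc (- X) \<and> derivative f \<in> AC_loc (- X) \<and>
         square_integrable (derivative (derivative f))}"

text \<open>Sequences are indexed by \<open>1, 2, 3, \<dots>\<close>; entries at \<open>0\<close> are ignored. The existence of the
  one-sided limits \<open>f(x\<^sub>k\<plusminus>)\<close> and \<open>f'(x\<^sub>k\<plusminus>)\<close>, automatic in the Sobolev space, is part of
  the interface conditions; \<open>f(x\<^sub>k)\<close> is the common limit \<open>v\<close>, as
  elements of the Sobolev space are not constrained at the points of \<open>X\<close> themselves.\<close>

definition interface_conditions ::
  "(nat \<Rightarrow> real) \<Rightarrow> (nat \<Rightarrow> real) \<Rightarrow> (real \<Rightarrow> complex) \<Rightarrow> bool" where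
  "interface_conditions x \<alpha> f \<longleftrightarrow>
     (\<forall>k\<ge>1. \<exists>v p m.
        (f \<longlongrightarrow> v) (at_right (x k)) \<and> (f \<longlongrightarrow> v) (at_left (x k)) \<and>
        (derivative f \<longlongrightarrow> p) (at_right (x k)) \<and> (derivative f \<longlongrightarrow> m) (at_left (x k)) \<and>
        p - m = complex_of_real (\<alpha> k) * v)"

definition delta_operator :: "(nat \<Rightarrow> real) \<Rightarrow> (nat \<Rightarrow> real) \<Rightarrow> (L2 \<times> L2) set" where
  "delta_operator x \<alpha> =
     {(abs_L2 f, abs_L2 (\<lambda>t. - derivative (derivative f) t)) | f.
        f \<in> sobolev22 (x ` {1..}) \<and> interface_conditions x \<alpha> f}"


section \<open>The sequence gamma\<close>

definition gap :: "(nat \<Rightarrow> real) \<Rightarrow> nat \<Rightarrow> real" where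
  "gap x k = x (Suc k) - x k"

text \<open>The formal value infinity is represented by \<^const>\<open>None\<close>. It is only ever preceded by the
  value 0, so the case \<^const>\<open>None\<close> yields the second half of rule (ii).\<close>

fun gamma_seq :: "(nat \<Rightarrow> real) \<Rightarrow> (nat \<Rightarrow> real) \<Rightarrow> nat \<Rightarrow> real option" where
  "gamma_seq x \<alpha> 0 = undefined"
| "gamma_seq x \<alpha> (Suc 0) = Some (\<alpha> 1 + 1 / gap x 1)"
| "gamma_seq x \<alpha> (Suc (Suc n)) =
     (let k = Suc n in
      case gamma_seq x \<alpha> k of
        Some g \<Rightarrow>
          if g = 0 then None
          else Some (\<alpha> (k + 1) + 1 / gap x (k + 1) + 1 / gap x k - 1 / ((gap x k)\<^sup>2 * g))
      | None \<Rightarrow> Some (\<alpha> (k + 1) + 1 / gap x k + 1 / gap x (k + 1)))"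

lemma gamma_seq_rule_i:
  assumes "k \<ge> 1" "gamma_seq x \<alpha> k = Some g" "g \<noteq> 0"
  shows "gamma_seq x \<alpha> (k + 1) =
    Some (\<alpha> (k + 1) + 1 / gap x (k + 1) + 1 / gap x k - 1 / ((gap x k)\<^sup>2 * g))"
  using assms by (cases k) (simp_all add: Let_def)

lemma gamma_seq_rule_ii:
  assumes "k \<ge> 1" "gamma_seq x \<alpha> k = Some 0"
  shows "gamma_seq x \<alpha> (k + 1) = None"
    and "gamma_seq x \<alpha> (k + 2) =
      Some (\<alpha> (k + 2) + 1 / gap x (k + 1) + 1 / gap x (k + 2))"
  using assms by (cases k; simp add: Let_def)+

definition num_negative :: "(nat \<Rightarrow> real option) \<Rightarrow> enat" where
  "num_negative \<gamma> = ecount {k. k \<ge> 1 \<and> (\<exists>g<0. \<gamma> k = Some g)}"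

definition num_infinite :: "(nat \<Rightarrow> real option) \<Rightarrow> enat" where
  "num_infinite \<gamma> = ecount {k. k \<ge> 1 \<and> \<gamma> k = None}"

end

theory Submission
  imports Defs
begin

text \<open>
  For \<open>f\<close> in the domain with nodal values \<open>\<xi> k = f (x k)\<close>, integration by parts and the Cauchy--Schwarz
  inequality bound the form \<open>(L f, f)\<close> from below by the Jacobi form
  \<open>\<Sum> \<alpha> k \<bar>\<xi> k\<bar>\<^sup>2 + \<Sum> \<bar>\<xi> (k+1) - \<xi> k\<bar>\<^sup>2 / gap x k\<close>, and functions which are almost piecewise linear show that the
  bound is sharp. Hence both forms have the same number of negative squares. Symmetric Gaussian elimination of
  the Jacobi form produces the pivots \<open>\<gamma> k\<close>; a vanishing pivot is eliminated together with the next index as a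
  \<open>2 \<times> 2\<close> block, which carries exactly one negative square and accounts for the value \<open>\<infinity>\<close>.

  The domain is described through absolutely continuous functions, but the fundamental theorem of calculus for
  them is not needed: an operator with a spectral measure is symmetric, and symmetry tested against splines
  identifies \<open>- L f\<close> as the weak second derivative of \<open>f\<close>.
\<close>

section \<open>The Jacobi form and its pivots\<close>

text \<open>The strengths \<open>\<alpha> k\<close> are arbitrary, so the operator may be unbounded
  from below. A vector of \<open>range (E {..<0})\<close> then need not lie in the domain, and the
  upper bound is proved on the windows \<open>{- real n..<0}\<close>, where the form is defined and
  strictly negative. For the same reason no boundary term may contain \<open>\<alpha> n\<close>:
  values \<open>f (x n)\<close> tend to 0, but \<open>\<alpha> n\<close> times their squares may
  not. Energies are cut off just to the left of a node. In the lower bound the trial functions must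
  lie in the operator domain, hence satisfy the jump conditions exactly; this costs an energy of
  order 1 / p on top of the Jacobi form. But p must be fixed before the vector is chosen, because
  the equations that put a combination of trial functions into the kernel of \<open>E {..<0}\<close>
  already involve p. So negativity of the Jacobi form on the constrained sequences is made
  quantitative, with a constant independent of the sequence. In the dimension count, positive and
  infinite pivots cost one condition each, and an infinite pivot is paid for by the zero pivot
  before it.\<close>

definition jacobi_form :: "(nat \<Rightarrow> real) \<Rightarrow> (nat \<Rightarrow> real) \<Rightarrow> nat \<Rightarrow> (nat \<Rightarrow> complex) \<Rightarrow> real" where
  "jacobi_form x \<alpha> n \<xi> =
     (\<Sum>k=1..n. \<alpha> k * (cmod (\<xi> k))\<^sup>2) + (\<Sum>k=1..<n. (cmod (\<xi> (Suc k) - \<xi> k))\<^sup>2 / gap x k) +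
     (cmod (\<xi> n))\<^sup>2 / gap x n"

text \<open>The row is only meaningful at an infinite pivot \<open>k\<close>, which forces \<open>k \<ge> 2\<close>. There the term
  \<open>Re (cnj \<xi> * \<eta>) = (\<bar>\<xi> + \<eta>\<bar>\<^sup>2 - \<bar>\<xi> - \<eta>\<bar>\<^sup>2) / 4\<close>, with \<open>\<xi> = \<xi> k\<close> and \<open>\<eta>\<close> the row, represents the \<open>2 \<times> 2\<close> block of
  the indices \<open>k - 1\<close> and \<open>k\<close>.\<close>

definition pivot_row :: "(nat \<Rightarrow> real) \<Rightarrow> (nat \<Rightarrow> real) \<Rightarrow> (nat \<Rightarrow> complex) \<Rightarrow> nat \<Rightarrow> complex" where
  "pivot_row x \<alpha> \<xi> k =
     of_real (\<alpha> k + 1 / gap x (k - 1) + 1 / gap x k) * \<xi> k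
     - of_real (2 / gap x (k - 1)) * \<xi> (k - 1) - of_real (2 / gap x k) * \<xi> (Suc k)"

text \<open>At a zero pivot the factor \<open>g\<close> annihilates the term, whatever the division
  by zero inside yields. The cross term of that index with the next one reappears in the row of the
  infinite pivot that follows.\<close>

definition pivot_term :: "(nat \<Rightarrow> real) \<Rightarrow> (nat \<Rightarrow> real) \<Rightarrow> (nat \<Rightarrow> complex) \<Rightarrow> nat \<Rightarrow> real" where
  "pivot_term x \<alpha> \<xi> k =
     (case gamma_seq x \<alpha> k of
        None \<Rightarrow> Re (cnj (\<xi> k) * pivot_row x \<alpha> \<xi> k)
      | Some g \<Rightarrow> g * (cmod (\<xi> k - \<xi> (Suc k) / of_real (gap x k * g)))\<^sup>2)"

lemma cmod_diff_square: "(cmod (a - b))\<^sup>2 = (cmod a)\<^sup>2 + (cmod b)\<^sup>2 - 2 * Re (a * cnj b)"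
  unfolding cmod_power2 by (simp add: power2_eq_square algebra_simps)

lemma Re_pivot_row:
  "Re (cnj (\<xi> n) * pivot_row x \<alpha> \<xi> n) = (\<alpha> n + 1 / gap x (n - 1) + 1 / gap x n) * (cmod (\<xi> n))\<^sup>2
     - 2 / gap x (n - 1) * Re (\<xi> n * cnj (\<xi> (n - 1))) - 2 / gap x n * Re (\<xi> (Suc n) * cnj (\<xi> n))"
  unfolding pivot_row_def cmod_power2
  by (simp add: power2_eq_square algebra_simps add_divide_distrib)

lemma pivot_term_None:
  "gamma_seq x \<alpha> n = None \<Longrightarrow> pivot_term x \<alpha> \<xi> n =
     (\<alpha> n + 1 / gap x (n - 1) + 1 / gap x n) * (cmod (\<xi> n))\<^sup>2
     - 2 / gap x (n - 1) * Re (\<xi> n * cnj (\<xi> (n - 1))) - 2 / gap x n * Re (\<xi> (Suc n) * cnj (\<xi> n))"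
  unfolding pivot_term_def Re_pivot_row[symmetric] by simp

lemma pivot_term_Some:
  assumes "gamma_seq x \<alpha> n = Some g" "g \<noteq> 0" "gap x n \<noteq> 0"
  shows "pivot_term x \<alpha> \<xi> n =
     g * (cmod (\<xi> n))\<^sup>2 + (cmod (\<xi> (Suc n)))\<^sup>2 / ((gap x n)\<^sup>2 * g) - 2 / gap x n * Re (\<xi> (Suc n) * cnj (\<xi> n))"
proof -
  have "Re (\<xi> n * cnj (\<xi> (Suc n) / of_real (gap x n * g))) = Re (\<xi> (Suc n) * cnj (\<xi> n)) / (gap x n * g)"
    by (simp add: Re_divide_of_real Im_divide_of_real add_divide_distrib mult.commute flip: of_real_mult)
  then have "pivot_term x \<alpha> \<xi> n = g * ((cmod (\<xi> n))\<^sup>2 + (cmod (\<xi> (Suc n)))\<^sup>2 / (gap x n * g)\<^sup>2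
      - 2 * (Re (\<xi> (Suc n) * cnj (\<xi> n)) / (gap x n * g)))"
    using assms unfolding pivot_term_def cmod_diff_square
    by (simp add: norm_divide norm_mult power_divide power_mult_distrib del: times_complex.sel)
  also have "\<dots> = g * (cmod (\<xi> n))\<^sup>2 + (cmod (\<xi> (Suc n)))\<^sup>2 / ((gap x n)\<^sup>2 * g)
      - 2 / gap x n * Re (\<xi> (Suc n) * cnj (\<xi> n))"
    using assms by (simp add: right_diff_distrib distrib_left power2_eq_square del: times_complex.sel)
  finally show ?thesis .
qed

lemma gamma_seq_Suc:
  assumes "k \<ge> 1"
  shows "gamma_seq x \<alpha> (Suc k) = (case gamma_seq x \<alpha> k of
        Some g \<Rightarrow>
          if g = 0 then None
          else Some (\<alpha> (Suc k) + 1 / gap x (Suc k) + 1 / gap x k - 1 / ((gap x k)\<^sup>2 * g))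
      | None \<Rightarrow> Some (\<alpha> (Suc k) + 1 / gap x k + 1 / gap x (Suc k)))"
  using assms by (cases k) (simp_all add: Let_def split: option.split)

lemma jacobi_form_Suc:
  assumes "n \<ge> 1"
  shows "jacobi_form x \<alpha> (Suc n) \<xi> = jacobi_form x \<alpha> n \<xi> + \<alpha> (Suc n) * (cmod (\<xi> (Suc n)))\<^sup>2
    + (cmod (\<xi> (Suc n) - \<xi> n))\<^sup>2 / gap x n + (cmod (\<xi> (Suc n)))\<^sup>2 / gap x (Suc n)
    - (cmod (\<xi> n))\<^sup>2 / gap x n"
  using assms by (simp add: jacobi_form_def)

text \<open>Completing the square in \<open>\<xi> n\<close> turns the last summand of stage n into
  \<open>pivot_term\<close> and leaves the Schur complement as the next pivot; at a zero pivot
  nothing can be completed, and the cross term is carried along for one more step. The boundary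
  summand of \<open>jacobi_form\<close> gives index n the same diagonal entry as in the infinite
  matrix, which is why the residual coefficient is exactly the pivot.\<close>

lemma jacobi_form_pivots:
  assumes "n \<ge> 1" and gap: "\<And>k. k \<ge> 1 \<Longrightarrow> gap x k > 0"
  shows "jacobi_form x \<alpha> n \<xi> = (\<Sum>k=1..<n. pivot_term x \<alpha> \<xi> k) +
    (case gamma_seq x \<alpha> n of Some g \<Rightarrow> g * (cmod (\<xi> n))\<^sup>2
      | None \<Rightarrow> (\<alpha> n + 1 / gap x (n - 1) + 1 / gap x n) * (cmod (\<xi> n))\<^sup>2
          - 2 / gap x (n - 1) * Re (\<xi> n * cnj (\<xi> (n - 1))))"
  using assms(1)
proof (induction n rule: dec_induct)
  case base
  then show ?case by (simp add: jacobi_form_def distrib_right)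
next
  case (step n)
  note n = \<open>1 \<le> n\<close>
  have d: "gap x n \<noteq> 0" using gap[of n] n by simp
  show ?case
  proof (cases "gamma_seq x \<alpha> n")
    case None
    with None n step.IH show ?thesis
      unfolding jacobi_form_Suc[OF n] cmod_diff_square
      by (simp add: gamma_seq_Suc pivot_term_None algebra_simps add_divide_distrib diff_divide_distrib del: times_complex.sel One_nat_def)
  next
    case (Some g)
    show ?thesis
    proof (cases "g = 0")
      case True
      with Some n step.IH show ?thesis
        unfolding jacobi_form_Suc[OF n] cmod_diff_square
        by (simp add: gamma_seq_Suc pivot_term_def algebra_simps add_divide_distrib diff_divide_distrib)
    next
      case False
      with Some n step.IH show ?thesis
        unfolding jacobi_form_Suc[OF n] cmod_diff_square
        by (simp add: gamma_seq_Suc pivot_term_Some[OF Some False d] algebra_simps diff_divide_distrib add_divide_distrib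
            del: times_complex.sel)
    qed
  qed
qed

section \<open>Linear conditions that fix the sign of the form, and their number\<close>

definition negative_pivots :: "(nat \<Rightarrow> real) \<Rightarrow> (nat \<Rightarrow> real) \<Rightarrow> nat set" where
  "negative_pivots x \<alpha> = {k. k \<ge> 1 \<and> (case gamma_seq x \<alpha> k of None \<Rightarrow> True | Some g \<Rightarrow> g < 0)}"

lemma ecount_disjoint_Un:
  assumes "A \<inter> B = {}"
  shows "ecount (A \<union> B) = ecount A + ecount B"
  using assms by (auto simp: ecount_def card_Un_disjoint)

lemma ecount_negative_pivots:
  "num_negative (gamma_seq x \<alpha>) + num_infinite (gamma_seq x \<alpha>) = ecount (negative_pivots x \<alpha>)"
proof -
  have "negative_pivots x \<alpha> = {k. k \<ge> 1 \<and> (\<exists>g<0. gamma_seq x \<alpha> k = Some g)} \<union> {k. k \<ge> 1 \<and> gamma_seq x \<alpha> k = None}"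
    by (auto simp: negative_pivots_def split: option.splits)
  then show ?thesis
    unfolding num_negative_def num_infinite_def by (subst ecount_disjoint_Un[symmetric]) auto
qed

text \<open>Serves the upper bound: its vanishing removes the term of a negative pivot. At an
  infinite pivot \<open>\<xi> k = 0\<close> removes the whole product
  \<open>Re (cnj (\<xi> k) * pivot_row x \<alpha> \<xi> k)\<close>.\<close>

definition pivot_functional :: "(nat \<Rightarrow> real) \<Rightarrow> (nat \<Rightarrow> real) \<Rightarrow> (nat \<Rightarrow> complex) \<Rightarrow> nat \<Rightarrow> complex" where
  "pivot_functional x \<alpha> \<xi> k = (case gamma_seq x \<alpha> k of None \<Rightarrow> \<xi> k
     | Some g \<Rightarrow> \<xi> k - \<xi> (Suc k) / of_real (gap x k * g))"

text \<open>Serves the lower bound: at a positive pivot its vanishing removes the term, and at an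
  infinite one it sets the row equal to \<open>- \<xi> k\<close>, which turns the indefinite product
  into \<open>- (cmod (\<xi> k))\<^sup>2\<close>.\<close>

definition pivot_constraint :: "(nat \<Rightarrow> real) \<Rightarrow> (nat \<Rightarrow> real) \<Rightarrow> (nat \<Rightarrow> complex) \<Rightarrow> nat \<Rightarrow> complex" where
  "pivot_constraint x \<alpha> \<xi> k = (case gamma_seq x \<alpha> k of None \<Rightarrow> \<xi> k + pivot_row x \<alpha> \<xi> k
     | Some g \<Rightarrow> \<xi> k - \<xi> (Suc k) / of_real (gap x k * g))"

lemma pivot_functional_sum:
  "pivot_functional x \<alpha> (\<lambda>j. \<Sum>i\<in>I. c i * \<xi> i j) k = (\<Sum>i\<in>I. c i * pivot_functional x \<alpha> (\<xi> i) k)"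
  by (simp add: pivot_functional_def sum_subtractf sum_divide_distrib right_diff_distrib split: option.split)

lemma pivot_constraint_sum:
  "pivot_constraint x \<alpha> (\<lambda>j. \<Sum>i\<in>I. c i * \<xi> i j) k = (\<Sum>i\<in>I. c i * pivot_constraint x \<alpha> (\<xi> i) k)"
  by (simp add: pivot_constraint_def pivot_row_def sum_subtractf sum.distrib sum_divide_distrib
      sum_distrib_left distrib_left right_diff_distrib mult.left_commute split: option.split)

text \<open>All pivot terms are nonnegative under the conditions. The last summand needs its own
  hypothesis on n: for a finite pivot it involves \<open>\<xi> n\<close> alone, whereas the
  condition at n relates \<open>\<xi> n\<close> to \<open>\<xi> (Suc n)\<close>.\<close>

lemma jacobi_form_nonneg:
  assumes gap: "\<And>k. k \<ge> 1 \<Longrightarrow> gap x k > 0"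
    and zero: "\<And>k. k \<in> negative_pivots x \<alpha> \<Longrightarrow> pivot_functional x \<alpha> \<xi> k = 0"
    and n: "n \<ge> 1" "n \<notin> negative_pivots x \<alpha>"
  shows "0 \<le> jacobi_form x \<alpha> n \<xi>"
proof -
  have "0 \<le> pivot_term x \<alpha> \<xi> k" if "k \<ge> 1" for k
  proof (cases "k \<in> negative_pivots x \<alpha>")
    case True
    then show ?thesis
      using zero[of k] unfolding pivot_term_def pivot_functional_def by (auto split: option.splits)
  next
    case False
    then show ?thesis
      using that unfolding pivot_term_def negative_pivots_def by (auto split: option.splits)
  qed
  then have "0 \<le> (\<Sum>k=1..<n. pivot_term x \<alpha> \<xi> k)"
    by (intro sum_nonneg) auto
  then show ?thesis
    using n by (auto simp: jacobi_form_pivots[OF n(1) gap] negative_pivots_def split: option.splits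
        intro!: add_nonneg_nonneg)
qed

text \<open>Zero pivots are absent because the index of a zero pivot is governed by the constraint
  at the infinite pivot after it.\<close>

definition constrained_pivots :: "(nat \<Rightarrow> real) \<Rightarrow> (nat \<Rightarrow> real) \<Rightarrow> nat \<Rightarrow> nat set" where
  "constrained_pivots x \<alpha> n = {k \<in> {1..n}. case gamma_seq x \<alpha> k of None \<Rightarrow> True | Some g \<Rightarrow> g > 0}"

lemma gamma_seq_None:
  assumes "gamma_seq x \<alpha> k = None" "k \<ge> 1"
  shows "k \<ge> 2" "gamma_seq x \<alpha> (k - 1) = Some 0"
proof -
  show k: "k \<ge> 2"
    using assms by (cases "k = 1") auto
  then obtain m where m: "k = Suc m" "m \<ge> 1" by (cases k) auto
  with assms show "gamma_seq x \<alpha> (k - 1) = Some 0"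
    by (simp add: gamma_seq_Suc split: option.splits if_splits)
qed

text \<open>Infinite pivots are counted in both sets. The map sending k to k - 1 injects them into
  the zero pivots, which belong to neither set, so the double count still fits into
  \<open>{1..n}\<close>.\<close>

lemma card_constrained_pivots:
  "card (constrained_pivots x \<alpha> n) + card (negative_pivots x \<alpha> \<inter> {1..n}) \<le> n"
proof -
  let ?P = "{k \<in> {1..n}. \<exists>g>0. gamma_seq x \<alpha> k = Some g}"
  let ?Z = "{k \<in> {1..n}. gamma_seq x \<alpha> k = Some 0}"
  let ?I = "{k \<in> {1..n}. gamma_seq x \<alpha> k = None}"
  have "card ?I \<le> card ?Z"
  proof (rule card_inj_on_le)
    show "inj_on (\<lambda>k. k - 1) ?I" by (auto simp: inj_on_def)
    show "(\<lambda>k. k - 1) ` ?I \<subseteq> ?Z"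
    proof safe
      fix k assume k: "k \<in> {1..n}" "gamma_seq x \<alpha> k = None"
      then have "k \<ge> 2" "gamma_seq x \<alpha> (k - 1) = Some 0" using gamma_seq_None[of x \<alpha> k] by auto
      with k show "k - 1 \<in> {1..n}" "gamma_seq x \<alpha> (k - 1) = Some 0" by auto
    qed
  qed simp
  moreover have "constrained_pivots x \<alpha> n = ?P \<union> ?I"
    by (auto simp: constrained_pivots_def split: option.splits)
  then have "card (constrained_pivots x \<alpha> n) = card ?P + card ?I"
    by (simp only:) (rule card_Un_disjoint, auto)
  moreover have "card (?P \<union> ?Z \<union> (negative_pivots x \<alpha> \<inter> {1..n})) = card ?P + card ?Z + card (negative_pivots x \<alpha> \<inter> {1..n})"
    by (subst card_Un_disjoint, simp, simp, force simp: negative_pivots_def)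
      (subst card_Un_disjoint, auto)
  moreover have "card (?P \<union> ?Z \<union> (negative_pivots x \<alpha> \<inter> {1..n})) \<le> card {1..n}"
    by (intro card_mono) auto
  ultimately show ?thesis by simp
qed

text \<open>On the constrained sequences minus the form is a sum of nonnegative squares, and the
  entries can be recovered from these squares backwards from n. The hypothesis on n excludes a zero
  pivot in last position, which would leave \<open>\<xi> n\<close> uncontrolled.\<close>

lemma jacobi_form_coercive:
  assumes gap: "\<And>k. k \<ge> 1 \<Longrightarrow> gap x k > 0" and n: "n \<in> negative_pivots x \<alpha>"
  obtains K where "K \<ge> 0"
    "\<And>\<xi> k. (\<forall>j>n. \<xi> j = 0) \<Longrightarrow> (\<forall>j\<in>constrained_pivots x \<alpha> n. pivot_constraint x \<alpha> \<xi> j = 0) \<Longrightarrow>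
       k \<in> {1..n} \<Longrightarrow> (cmod (\<xi> k))\<^sup>2 \<le> K * - jacobi_form x \<alpha> n \<xi>"
proof -
  define W where "W = {\<xi>. (\<forall>j>n. \<xi> j = 0) \<and> (\<forall>j\<in>constrained_pivots x \<alpha> n. pivot_constraint x \<alpha> \<xi> j = 0)}"
  \<comment> \<open>The square root makes the bounds homogeneous of degree one, so that they add up
    by the triangle inequality.\<close>
  define Q where "Q \<xi> = sqrt (- jacobi_form x \<alpha> n \<xi>)" for \<xi>
  have n1: "n \<ge> 1" using n by (simp add: negative_pivots_def)
  have form: "- jacobi_form x \<alpha> n \<xi> = (\<Sum>k=1..n. - pivot_term x \<alpha> \<xi> k)" if "\<xi> \<in> W" for \<xi>
  proof -
    have "\<xi> (Suc n) = 0" using that by (simp add: W_def)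
    then have "(case gamma_seq x \<alpha> n of Some g \<Rightarrow> g * (cmod (\<xi> n))\<^sup>2
      | None \<Rightarrow> (\<alpha> n + 1 / gap x (n - 1) + 1 / gap x n) * (cmod (\<xi> n))\<^sup>2
          - 2 / gap x (n - 1) * Re (\<xi> n * cnj (\<xi> (n - 1)))) = pivot_term x \<alpha> \<xi> n"
      by (cases "gamma_seq x \<alpha> n") (simp add: pivot_term_None del: times_complex.sel, simp add: pivot_term_def)
    then show ?thesis
      using n1 by (simp add: jacobi_form_pivots[OF n1 gap] sum_negf sum.last_plus)
  qed
  have pt: "- pivot_term x \<alpha> \<xi> k = (case gamma_seq x \<alpha> k of None \<Rightarrow> (cmod (\<xi> k))\<^sup>2
      | Some g \<Rightarrow> if g < 0 then - g * (cmod (\<xi> k - \<xi> (Suc k) / of_real (gap x k * g)))\<^sup>2 else 0)"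
    if \<xi>: "\<xi> \<in> W" and k: "k \<in> {1..n}" for \<xi> k
  proof (cases "gamma_seq x \<alpha> k")
    case None
    then have "\<xi> k + pivot_row x \<alpha> \<xi> k = 0"
      using \<xi> k by (auto simp: W_def constrained_pivots_def pivot_constraint_def)
    then have "pivot_row x \<alpha> \<xi> k = - \<xi> k" by (simp add: add_eq_0_iff)
    then show ?thesis
      using None by (simp add: pivot_term_def cmod_power2) (simp add: power2_eq_square)
  next
    case (Some g)
    then have "g > 0 \<Longrightarrow> \<xi> k - \<xi> (Suc k) / of_real (gap x k * g) = 0"
      using \<xi> k by (auto simp: W_def constrained_pivots_def pivot_constraint_def)
    with Some show ?thesis
      by (auto simp: pivot_term_def not_less le_less)
  qed
  have pt_le: "- pivot_term x \<alpha> \<xi> k \<le> - jacobi_form x \<alpha> n \<xi>" if "\<xi> \<in> W" "k \<in> {1..n}" for \<xi> k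
    unfolding form[OF that(1)]
    by (rule member_le_sum[OF that(2)]) (auto simp: pt[OF that(1)] mult_nonpos_nonneg split: option.splits)
  have form_nonneg: "- jacobi_form x \<alpha> n \<xi> \<ge> 0" if "\<xi> \<in> W" for \<xi>
    unfolding form[OF that]
    by (rule sum_nonneg) (auto simp: pt[OF that] mult_nonpos_nonneg split: option.splits)
  \<comment> \<open>Induction downwards from the vanishing entries beyond n. It is a strong
    induction, since a zero pivot reaches two indices ahead.\<close>
  have bound: "\<exists>C\<ge>0. \<forall>\<xi>\<in>W. cmod (\<xi> k) \<le> C * Q \<xi>" if "k \<ge> 1" for k
    using that
  proof (induction "Suc n - k" arbitrary: k rule: less_induct)
    case less
    show ?case
    proof (cases "k > n")
      case True
      then show ?thesis by (intro exI[of _ 0]) (auto simp: W_def)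
    next
      case False
      then have k: "k \<in> {1..n}" using less.prems by simp
      have d: "gap x k > 0" using gap k by simp
      obtain C1 where C1: "C1 \<ge> 0" "\<And>\<xi>. \<xi> \<in> W \<Longrightarrow> cmod (\<xi> (Suc k)) \<le> C1 * Q \<xi>"
        using less.hyps[of "Suc k"] k by (auto simp: Suc_diff_le)
      have Q0: "Q \<xi> \<ge> 0" if "\<xi> \<in> W" for \<xi>
        using form_nonneg[OF that] by (simp add: Q_def)
      show ?thesis
      proof (cases "gamma_seq x \<alpha> k")
        case None
        have "cmod (\<xi> k) \<le> 1 * Q \<xi>" if "\<xi> \<in> W" for \<xi>
          using pt_le[OF that k] pt[OF that k] None by (simp add: Q_def real_le_rsqrt)
        then show ?thesis by (intro exI[of _ 1]) auto
      next
        case (Some g)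
        consider "g > 0" | "g < 0" | "g = 0" by linarith
        then show ?thesis
        proof cases
          case 1
          have "cmod (\<xi> k) \<le> (C1 / (gap x k * g)) * Q \<xi>" if "\<xi> \<in> W" for \<xi>
          proof -
            have "\<xi> k - \<xi> (Suc k) / of_real (gap x k * g) = 0"
              using that k Some 1 by (auto simp: W_def constrained_pivots_def pivot_constraint_def)
            then have "cmod (\<xi> k) = cmod (\<xi> (Suc k)) / (gap x k * g)"
              using 1 d by (simp add: norm_divide norm_mult)
            also have "\<dots> \<le> (C1 * Q \<xi>) / (gap x k * g)"
              using C1(2)[OF that] 1 d by (intro divide_right_mono) auto
            finally show ?thesis by simp
          qed
          then show ?thesis
            using 1 d C1(1) by (intro exI[of _ "C1 / (gap x k * g)"]) auto
        next
          case 2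
          define r where "r = sqrt (- g)"
          have r: "r > 0" "r\<^sup>2 = - g" using 2 by (auto simp: r_def)
          have nonneg: "0 \<le> 1 / r + C1 / (gap x k * \<bar>g\<bar>)"
            using r d C1(1) by (intro add_nonneg_nonneg divide_nonneg_nonneg mult_nonneg_nonneg) simp_all
          have "cmod (\<xi> k) \<le> (1 / r + C1 / (gap x k * \<bar>g\<bar>)) * Q \<xi>" if "\<xi> \<in> W" for \<xi>
          proof -
            let ?l = "\<xi> k - \<xi> (Suc k) / of_real (gap x k * g)"
            have "(r * cmod ?l)\<^sup>2 \<le> - jacobi_form x \<alpha> n \<xi>"
              using pt_le[OF that k] pt[OF that k] Some 2 r by (simp add: power_mult_distrib)
            then have "r * cmod ?l \<le> Q \<xi>"
              unfolding Q_def by (rule real_le_rsqrt)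
            then have "cmod ?l \<le> Q \<xi> / r" using r by (simp add: field_simps)
            moreover have "cmod (\<xi> (Suc k) / of_real (gap x k * g)) \<le> (C1 * Q \<xi>) / (gap x k * \<bar>g\<bar>)"
              using divide_right_mono[OF C1(2)[OF that], of "gap x k * \<bar>g\<bar>"] d
                by (simp add: norm_divide norm_mult del: abs_of_neg)
            moreover have "cmod (\<xi> k) \<le> cmod ?l + cmod (\<xi> (Suc k) / of_real (gap x k * g))"
              by (metis diff_add_cancel norm_triangle_ineq)
            ultimately show ?thesis by (simp add: distrib_right)
          qed
          then show ?thesis
            using nonneg by blast
        next
          \<comment> \<open>A zero pivot carries no square of its own. The constraint at the
            infinite pivot \<open>Suc k\<close> is solved for \<open>\<xi> k\<close>, whose
            coefficient \<open>2 / gap x k\<close> is not zero.\<close>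
          case 3
          then have "k \<noteq> n" using Some n by (auto simp: negative_pivots_def)
          then have k': "Suc k \<in> {1..n}" using k by simp
          obtain C2 where C2: "C2 \<ge> 0" "\<And>\<xi>. \<xi> \<in> W \<Longrightarrow> cmod (\<xi> (Suc (Suc k))) \<le> C2 * Q \<xi>"
          proof -
            have "Suc n - Suc (Suc k) < Suc n - k" using k by auto
            then show ?thesis using less.hyps[of "Suc (Suc k)"] that by auto
          qed
          have None: "gamma_seq x \<alpha> (Suc k) = None"
            using gamma_seq_Suc[of k x \<alpha>] k Some 3 by simp
          define b where "b = \<alpha> (Suc k) + 1 / gap x k + 1 / gap x (Suc k)"
          define e where "e = 2 / gap x (Suc k)"
          have e: "e \<ge> 0" using gap[of "Suc k"] by (simp add: e_def)
          have "cmod (\<xi> k) \<le> (gap x k / 2 * (C1 + \<bar>b\<bar> * C1 + e * C2)) * Q \<xi>" if "\<xi> \<in> W" for \<xi>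
          proof -
            have "\<xi> (Suc k) + pivot_row x \<alpha> \<xi> (Suc k) = 0"
              using that k' None by (auto simp: W_def constrained_pivots_def pivot_constraint_def)
            then have "of_real (2 / gap x k) * \<xi> k = \<xi> (Suc k) + of_real b * \<xi> (Suc k) - of_real e * \<xi> (Suc (Suc k))"
              by (simp add: pivot_row_def b_def e_def algebra_simps add_eq_0_iff)
            then have "cmod (of_real (2 / gap x k) * \<xi> k) = cmod (\<xi> (Suc k) + of_real b * \<xi> (Suc k) - of_real e * \<xi> (Suc (Suc k)))"
              by simp
            also have "\<dots> \<le> cmod (\<xi> (Suc k)) + cmod (of_real b * \<xi> (Suc k)) + cmod (of_real e * \<xi> (Suc (Suc k)))"
              by (intro norm_triangle_le_diff norm_triangle_le add_mono order_refl)
            also have "\<dots> \<le> C1 * Q \<xi> + \<bar>b\<bar> * (C1 * Q \<xi>) + e * (C2 * Q \<xi>)"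
              using C1(2)[OF that] C2(2)[OF that] e
              by (simp add: norm_mult) (intro add_mono mult_left_mono, auto)
            finally have "2 / gap x k * cmod (\<xi> k) \<le> C1 * Q \<xi> + \<bar>b\<bar> * (C1 * Q \<xi>) + e * (C2 * Q \<xi>)"
              using d by (simp add: norm_mult norm_divide)
            then have "gap x k / 2 * (2 / gap x k * cmod (\<xi> k)) \<le> gap x k / 2 * (C1 * Q \<xi> + \<bar>b\<bar> * (C1 * Q \<xi>) + e * (C2 * Q \<xi>))"
              using d by (intro mult_left_mono) auto
            then show ?thesis using d by (simp add: algebra_simps)
          qed
          then show ?thesis
            using d C1(1) C2(1) e by (intro exI[of _ "gap x k / 2 * (C1 + \<bar>b\<bar> * C1 + e * C2)"]) auto
        qed
      qed
    qed
  qed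
  then obtain C where C: "\<And>k. k \<ge> 1 \<Longrightarrow> C k \<ge> 0" "\<And>k \<xi>. k \<ge> 1 \<Longrightarrow> \<xi> \<in> W \<Longrightarrow> cmod (\<xi> k) \<le> C k * Q \<xi>"
    by metis
  define M where "M = (\<Sum>k=1..n. (C k)\<^sup>2)"
  show ?thesis
  proof (rule that)
    show "0 \<le> M" by (simp add: M_def sum_nonneg)
    fix \<xi> k assume *: "\<forall>j>n. \<xi> j = 0" "\<forall>j\<in>constrained_pivots x \<alpha> n. pivot_constraint x \<alpha> \<xi> j = 0"
      and k: "k \<in> {1..n}"
    have \<xi>: "\<xi> \<in> W" using * by (auto simp: W_def)
    have "(cmod (\<xi> k))\<^sup>2 \<le> (C k * Q \<xi>)\<^sup>2"
      using C(2)[of k, OF _ \<xi>] k by (intro power_mono) auto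
    also have "\<dots> = (C k)\<^sup>2 * - jacobi_form x \<alpha> n \<xi>"
      using form_nonneg[OF \<xi>] by (simp add: power_mult_distrib Q_def)
    also have "\<dots> \<le> M * - jacobi_form x \<alpha> n \<xi>"
      using form_nonneg[OF \<xi>] k unfolding M_def
      by (intro mult_right_mono member_le_sum) auto
    finally show "(cmod (\<xi> k))\<^sup>2 \<le> M * - jacobi_form x \<alpha> n \<xi>" .
  qed
qed

text \<open>Gaussian elimination, by induction on the number of equations: the unknown p is
  eliminated by means of equation j, and \<open>c'\<close> restores it. Both halves of the dimension
  count obtain their vector from here.\<close>

lemma homogeneous_system_nontrivial:
  fixes A :: "'j \<Rightarrow> 'i \<Rightarrow> 'a::field"
  assumes "finite I" "finite J" "card J < card I"
  obtains c where "\<exists>i\<in>I. c i \<noteq> 0" "\<And>j. j \<in> J \<Longrightarrow> (\<Sum>i\<in>I. A j i * c i) = 0"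
proof -
  have "\<exists>c. (\<exists>i\<in>I. c i \<noteq> 0) \<and> (\<forall>j\<in>J. (\<Sum>i\<in>I. A j i * c i) = 0)"
    using assms(2,1,3)
  proof (induction J arbitrary: I A rule: finite_induct)
    case empty
    then have "I \<noteq> {}" by auto
    then show ?case by (intro exI[of _ "\<lambda>_. 1"]) auto
  next
    case (insert j J)
    show ?case
    proof (cases "\<forall>i\<in>I. A j i = 0")
      case True
      then show ?thesis
        using insert.IH[of I A] insert.prems insert.hyps by auto
    next
      case False
      then obtain p where p: "p \<in> I" "A j p \<noteq> 0" by blast
      let ?B = "\<lambda>l i. A l i - A l p * A j i / A j p"
      have "card J < card (I - {p})"
        using insert.prems insert.hyps p by simp
      then obtain c where c: "\<exists>i\<in>I - {p}. c i \<noteq> 0" "\<forall>l\<in>J. (\<Sum>i\<in>I - {p}. ?B l i * c i) = 0"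
        using insert.IH[of "I - {p}" ?B] insert.prems by auto
      define c' where "c' = c(p := - (\<Sum>i\<in>I - {p}. A j i * c i) / A j p)"
      have split: "(\<Sum>i\<in>I. A l i * c' i) = A l p * c' p + (\<Sum>i\<in>I - {p}. A l i * c i)" for l
        using insert.prems p by (subst sum.remove[of _ p]) (auto simp: c'_def intro!: sum.cong)
      have "(\<Sum>i\<in>I. A l i * c' i) = (\<Sum>i\<in>I - {p}. ?B l i * c i)" for l
        unfolding split by (simp add: c'_def left_diff_distrib sum_subtractf sum_distrib_left sum_divide_distrib mult.assoc)
      moreover have "(\<Sum>i\<in>I. A j i * c' i) = 0"
        unfolding split using p by (simp add: c'_def)
      moreover have "\<exists>i\<in>I. c' i \<noteq> 0" using c(1) by (auto simp: c'_def)
      ultimately show ?thesis using c(2) by (intro exI[of _ c']) auto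
    qed
  qed
  then show ?thesis using that by blast
qed

section \<open>Complex inner product spaces\<close>

lemma cinner_scaleC_right: "cinner u (c *\<^sub>C v) = cnj c * cinner u (v :: 'a::complex_inner)"
  by (metis cinner_commute cinner_scaleC_left complex_cnj_mult)

lemma cinner_zero_left [simp]: "cinner 0 (v :: 'a::complex_inner) = 0"
  using cinner_scaleC_left[of 0 0 v] by simp

lemma Re_cinner_self: "Re (cinner u u) = (norm (u :: 'a::complex_inner))\<^sup>2"
  by (metis inner_cinner power2_norm_eq_inner)

lemma norm_scaleC: "norm (c *\<^sub>C u) = cmod c * norm (u :: 'a::complex_inner)"
proof -
  have "cinner (c *\<^sub>C u) (c *\<^sub>C u) = of_real ((cmod c)\<^sup>2) * cinner u u"
    unfolding complex_norm_square by (simp add: cinner_scaleC_left cinner_scaleC_right)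
  then have "(norm (c *\<^sub>C u))\<^sup>2 = (cmod c * norm u)\<^sup>2"
    unfolding Re_cinner_self[symmetric] power_mult_distrib
    by (simp del: of_real_power)
  then show ?thesis by (simp add: power2_eq_iff_nonneg)
qed

lemma ecdim_le:
  fixes V :: "'a::complex_inner set"
  assumes "finite B" "cspan B = V" "card B \<le> n"
  shows "ecdim V \<le> enat n"
proof -
  have "cdim V \<le> card B"
    using assms by (intro complex_vector.dim_le_card) auto
  then show ?thesis using assms by (auto simp: ecdim_def)
qed

lemma ecdim_less_basis:
  fixes V :: "'a::complex_inner set"
  assumes "ecdim V < enat n"
  obtains B where "finite B" "cspan B = V" "card B < n"
proof -
  obtain B0 where B0: "finite B0" "cspan B0 = V"
    using assms by (auto simp: ecdim_def split: if_splits)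
  obtain B where B: "B \<subseteq> V" "complex_vector.independent B" "V \<subseteq> cspan B" "card B = cdim V"
    using complex_vector.basis_exists[of V] by blast
  have "finite B"
    using complex_vector.independent_span_bound[OF B0(1) B(2)] B B0 by blast
  moreover have "cspan B = V"
    using B B0 by (metis complex_vector.span_mono complex_vector.span_span subset_antisym)
  moreover have "card B < n" using assms B B0 by (auto simp: ecdim_def split: if_splits)
  ultimately show ?thesis using that by blast
qed

text \<open>A chain of subspaces of bounded dimension becomes stationary, so no topology is needed to see
  that its pointwise limit is one of its members.\<close>

lemma subspace_chain_stationary:
  fixes V :: "nat \<Rightarrow> 'a::complex_inner set"
  assumes sub: "\<And>n. complex_vector.subspace (V n)" and mono: "\<And>m n. m \<le> n \<Longrightarrow> V m \<subseteq> V n"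
    and bound: "\<And>n B. finite B \<Longrightarrow> B \<subseteq> V n \<Longrightarrow> complex_vector.independent B \<Longrightarrow> card B \<le> N"
  obtains m B where "finite B" "cspan B = V m" "card B \<le> N" "\<And>n. V n \<subseteq> V m"
proof -
  define P where "P c \<longleftrightarrow> (\<exists>n B. finite B \<and> B \<subseteq> V n \<and> complex_vector.independent B \<and> card B = c)" for c
  have "P 0" unfolding P_def
    by (intro exI[of _ 0] exI[of _ "{}"]) (auto simp: complex_vector.independent_empty)
  moreover have "\<And>c. P c \<Longrightarrow> c \<le> N" using bound by (auto simp: P_def)
  ultimately obtain c where c: "P c" "\<And>c'. P c' \<Longrightarrow> c' \<le> c"
    by (metis Nat.ex_has_greatest_nat)
  then obtain m B where B: "finite B" "B \<subseteq> V m" "complex_vector.independent B" "card B = c"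
    by (auto simp: P_def)
  have span: "V n \<subseteq> cspan B" for n
  proof
    fix u assume u: "u \<in> V n"
    show "u \<in> cspan B"
    proof (rule ccontr)
      assume nu: "u \<notin> cspan B"
      then have "complex_vector.independent (insert u B)"
        using B by (intro complex_vector.independent_insertI) auto
      moreover have "insert u B \<subseteq> V (max m n)"
        using u B mono[of m "max m n"] mono[of n "max m n"] by auto
      moreover have "u \<notin> B" using nu complex_vector.span_base by blast
      ultimately have "P (Suc c)" using B unfolding P_def
        by (intro exI[of _ "max m n"] exI[of _ "insert u B"]) auto
      then show False using c(2) by fastforce
    qed
  qed
  have "cspan B \<subseteq> V m"
    using B(2) sub by (rule complex_vector.span_minimal)
  with span have "cspan B = V m" by blast
  with B span bound[of B m] show ?thesis by (intro that[of B m]) auto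
qed

section \<open>Spectral measures\<close>

context
  fixes E :: "real set \<Rightarrow> 'a::complex_inner \<Rightarrow> 'a"
  assumes E: "projection_valued_measure E"
begin

lemma
  assumes "A \<in> sets borel"
  shows linear_spectral: "Vector_Spaces.linear (*\<^sub>C) (*\<^sub>C) (E A)"
    and spectral_idem: "E A (E A u) = E A u"
    and spectral_selfadjoint: "cinner (E A u) v = cinner u (E A v)"
  using E assms by (auto simp: projection_valued_measure_def)

lemma spectral_add:
  assumes "A \<in> sets borel"
  shows "E A (u + v) = E A u + E A v" "E A (c *\<^sub>C u) = c *\<^sub>C E A u" "E A 0 = 0"
proof -
  interpret l: Vector_Spaces.linear "(*\<^sub>C)" "(*\<^sub>C)" "E A"
    by (rule linear_spectral[OF assms])
  show "E A (u + v) = E A u + E A v" "E A (c *\<^sub>C u) = c *\<^sub>C E A u" "E A 0 = 0"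
    by (simp_all add: l.add l.scale l.zero)
qed

lemma spectral_sum:
  assumes "A \<in> sets borel"
  shows "E A (\<Sum>i\<in>I. c i *\<^sub>C u i) = (\<Sum>i\<in>I. c i *\<^sub>C E A (u i))"
  by (induction I rule: infinite_finite_induct) (simp_all add: spectral_add[OF assms])

lemma subspace_range_spectral:
  assumes "A \<in> sets borel"
  shows "complex_vector.subspace (range (E A))"
proof (rule complex_vector.subspaceI)
  show "0 \<in> range (E A)"
    using spectral_add(3)[OF assms] by (rule range_eqI[OF sym])
  show "u + v \<in> range (E A)" if uv: "u \<in> range (E A)" "v \<in> range (E A)" for u v
  proof -
    obtain a b where "u = E A a" "v = E A b" using uv by blast
    then show ?thesis using spectral_add(1)[OF assms, of a b] by (auto intro: range_eqI[OF sym])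
  qed
  show "c *\<^sub>C u \<in> range (E A)" if u: "u \<in> range (E A)" for c u
  proof -
    obtain a where "u = E A a" using u by blast
    then show ?thesis using spectral_add(2)[OF assms, of c a] by (auto intro: range_eqI[OF sym])
  qed
qed

lemma Re_cinner_spectral:
  assumes "A \<in> sets borel"
  shows "Re (cinner (E A u) u) = (norm (E A u))\<^sup>2"
  using spectral_selfadjoint[OF assms, of "E A u" u] spectral_idem[OF assms, of u]
  by (simp add: Re_cinner_self)

lemma spectral_sums:
  assumes "range A \<subseteq> sets borel" "disjoint_family A"
  shows "(\<lambda>n. E (A n) u) sums E (\<Union>n. A n) u"
  using E assms by (auto simp: projection_valued_measure_def)

text \<open>Countable additivity for a family of empty sets gives a convergent series with constant
  terms, so the constant is 0.\<close>

lemma spectral_empty: "E {} u = 0"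
proof -
  have "(\<lambda>n. E {} u) sums E (\<Union>n::nat. {}) u"
    by (rule spectral_sums) (auto simp: disjoint_family_on_def)
  then have "summable (\<lambda>n::nat. E {} u)" by (rule sums_summable)
  then show ?thesis by (metis summable_LIMSEQ_zero LIMSEQ_const_iff)
qed

lemma spectral_Un:
  assumes "A \<in> sets borel" "B \<in> sets borel" "A \<inter> B = {}"
  shows "E (A \<union> B) u = E A u + E B u"
proof -
  have "(\<lambda>n. E (binaryset A B n) u) sums E (\<Union>n. binaryset A B n) u"
    using assms by (intro spectral_sums) (auto simp: disjoint_family_on_def binaryset_def)
  moreover have "(\<lambda>n. E (binaryset A B n) u) sums (\<Sum>n<2. E (binaryset A B n) u)"
    by (rule sums_finite) (auto simp: binaryset_def spectral_empty)
  ultimately show ?thesis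
    using sums_unique2 by (fastforce simp: UN_binaryset_eq eval_nat_numeral binaryset_def)
qed

lemma emeasure_diagonal:
  assumes "A \<in> sets borel"
  shows "emeasure (diagonal_measure E u) A = ennreal ((norm (E A u))\<^sup>2)"
proof -
  have "emeasure (diagonal_measure E u) A = ennreal (Re (cinner (E A u) u))"
    unfolding diagonal_measure_def
  proof (rule emeasure_measure_of_sigma)
    show "sigma_algebra UNIV (sets (borel :: real measure))"
      using sets.sigma_algebra_axioms[of "borel :: real measure"] by simp
    show "positive (sets borel) (\<lambda>A. ennreal (Re (cinner (E A u) u)))"
      by (simp add: positive_def spectral_empty)
    show "countably_additive (sets borel) (\<lambda>A. ennreal (Re (cinner (E A u) u)))"
      unfolding countably_additive_def
    proof safe
      fix A :: "nat \<Rightarrow> real set"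
      assume A: "range A \<subseteq> sets borel" "disjoint_family A"
      have "(\<lambda>n. inner (E (A n) u) u) sums inner (E (\<Union>n. A n) u) u"
        using spectral_sums[OF A, of u] by (rule bounded_linear.sums[OF bounded_linear_inner_left])
      then have s: "(\<lambda>n. Re (cinner (E (A n) u) u)) sums Re (cinner (E (\<Union>n. A n) u) u)"
        by (simp add: inner_cinner)
      have "0 \<le> Re (cinner (E (A n) u) u)" for n
        using A Re_cinner_spectral[of "A n" u] by auto
      then have "(\<Sum>n. ennreal (Re (cinner (E (A n) u) u))) = ennreal (\<Sum>n. Re (cinner (E (A n) u) u))"
        using s by (intro suminf_ennreal2) (auto intro: sums_summable)
      then show "(\<Sum>n. ennreal (Re (cinner (E (A n) u) u))) = ennreal (Re (cinner (E (\<Union>n. A n) u) u))"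
        using s by (simp add: sums_iff)
    qed
  qed fact
  then show ?thesis by (simp add: Re_cinner_spectral[OF assms])
qed

lemma sets_diagonal [simp, measurable_cong]: "sets (diagonal_measure E u) = sets borel"
  and space_diagonal [simp]: "space (diagonal_measure E u) = UNIV"
proof -
  have "sigma_sets UNIV (sets (borel :: real measure)) = sets borel"
    using sets.sigma_sets_eq[of "borel :: real measure"] by simp
  then show "sets (diagonal_measure E u) = sets borel"
    unfolding diagonal_measure_def by (simp add: sets_measure_of)
  show "space (diagonal_measure E u) = UNIV"
    unfolding diagonal_measure_def by (simp add: space_measure_of)
qed

lemma diagonal_unit_scale:
  assumes "cmod c = 1"
  shows "diagonal_measure E (c *\<^sub>C u) = diagonal_measure E u"
proof -
  have "Re (cinner (E A (c *\<^sub>C u)) (c *\<^sub>C u)) = Re (cinner (E A u) u)" if "A \<in> sets borel" for A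
    unfolding Re_cinner_spectral[OF that] unfolding spectral_add[OF that] norm_scaleC using assms by simp
  then show ?thesis unfolding diagonal_measure_def
    by (intro measure_of_eq) (auto simp: sets.sigma_sets_eq[of "borel :: real measure", simplified])
qed

text \<open>The measures themselves differ by a constant factor, so the identity also covers
  divergent integrals, which have the default value 0.\<close>

lemma integral_diagonal_scale:
  "(\<integral>t. t \<partial>diagonal_measure E (c *\<^sub>C u)) = (cmod c)\<^sup>2 * (\<integral>t. t \<partial>diagonal_measure E u)"
proof -
  have "diagonal_measure E (c *\<^sub>C u) = density (diagonal_measure E u) (\<lambda>_. ennreal ((cmod c)\<^sup>2))"
  proof (rule measure_eqI)
    fix A assume "A \<in> sets (diagonal_measure E (c *\<^sub>C u))"
    then have A: "A \<in> sets borel" by simp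
    show "emeasure (diagonal_measure E (c *\<^sub>C u)) A = emeasure (density (diagonal_measure E u) (\<lambda>_. ennreal ((cmod c)\<^sup>2))) A"
      using A by (simp add: emeasure_diagonal[OF A] emeasure_density_const spectral_add[OF A] norm_scaleC power_mult_distrib ennreal_mult)
  qed simp
  moreover have "(\<lambda>t. t) \<in> borel_measurable (diagonal_measure E u)"
    by (simp add: measurable_def)
  ultimately show ?thesis by (simp add: integral_density)
qed

text \<open>Multiplicativity of E is not among its axioms. For v in the range of \<open>E A\<close>,
  the vector \<open>E (- A) v = 0\<close> splits along \<open>B - A\<close> and \<open>- B\<close>;
  pairing with v gives a vanishing sum of two squared norms, hence
  \<open>E (B - A) v = 0\<close>.\<close>

lemma range_spectral_mono:
  assumes "A \<in> sets borel" "B \<in> sets borel" "A \<subseteq> B"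
  shows "range (E A) \<subseteq> range (E B)"
proof safe
  fix u
  let ?v = "E A u"
  have v: "E A ?v = ?v" by (simp add: spectral_idem assms)
  have d: "E B ?v = E A ?v + E (B - A) ?v" "?v = E A ?v + E (- A) ?v"
    using spectral_Un[of A "B - A" ?v] spectral_Un[of A "- A" ?v] assms E
    by (auto simp: Un_absorb1 projection_valued_measure_def)
  have "E (- A) ?v = 0" using d v by simp
  moreover have "- A = (B - A) \<union> - B" using assms by blast
  then have "E (- A) ?v = E (B - A) ?v + E (- B) ?v"
    using assms by (simp only:) (intro spectral_Un, auto)
  moreover have "(norm (E (B - A) ?v))\<^sup>2 + (norm (E (- B) ?v))\<^sup>2 = Re (cinner (E (B - A) ?v + E (- B) ?v) ?v)"
    using assms by (simp add: cinner_add_left Re_cinner_spectral)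
  ultimately have "(norm (E (B - A) ?v))\<^sup>2 + (norm (E (- B) ?v))\<^sup>2 = 0" by simp
  then have "E (B - A) ?v = 0" by (simp add: sum_power2_eq_zero_iff)
  then have "E B ?v = ?v" using d v by simp
  then show "?v \<in> range (E B)" by (metis rangeI)
qed

lemma AE_diagonal:
  assumes "A \<in> sets borel" "E A u = u"
  shows "AE t in diagonal_measure E u. t \<in> A"
proof -
  have "E (- A) u = 0"
    using spectral_Un[of A "- A" u] assms E by (simp add: projection_valued_measure_def)
  then have "emeasure (diagonal_measure E u) (- A) = 0"
    using assms by (simp add: emeasure_diagonal)
  then show ?thesis using assms by (intro AE_I[of _ _ "- A"]) auto
qed

lemma finite_diagonal: "finite_measure (diagonal_measure E u)"
  by (rule finite_measureI) (simp add: emeasure_diagonal)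

end

section \<open>Operators that are integrals against a spectral measure\<close>

lemma is_spectral_measureD:
  assumes "is_spectral_measure E T"
  shows "projection_valued_measure E"
    and "u \<in> Domain T \<longleftrightarrow> integrable (diagonal_measure E u) (\<lambda>t. t\<^sup>2)"
    and "(u, v) \<in> T \<Longrightarrow> w \<in> Domain T \<Longrightarrow> cinner v w = spectral_form E u w"
  using assms by (auto simp: is_spectral_measure_def)

text \<open>In the polarization sum at (u, u) the integrals scale by the squared moduli 4, 2, 0, 2
  of 1 plus the powers of the imaginary unit. The two middle contributions cancel and 4 / 4
  remains.\<close>

lemma spectral_form_self:
  assumes "is_spectral_measure E T" "(u, v) \<in> T"
  shows "Re (cinner v u) = (\<integral>t. t \<partial>diagonal_measure E u)"
proof -
  note pvm = is_spectral_measureD(1)[OF assms(1)]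
  let ?I = "\<lambda>u. \<integral>t. t \<partial>diagonal_measure E u"
  have sc: "?I (u + c *\<^sub>C u) = (cmod (1 + c))\<^sup>2 * ?I u" for c
    using integral_diagonal_scale[OF pvm, of "1 + c" u] by (simp add: scaleC_add_left)
  have "cinner v u = spectral_form E u u"
    using assms by (intro is_spectral_measureD(3)[OF assms(1)]) auto
  also have "\<dots> = of_real (?I u)"
    unfolding spectral_form_def sc
    by (simp add: eval_nat_numeral cmod_def algebra_simps power2_eq_square)
  finally show ?thesis by simp
qed

text \<open>Exchanging u and w permutes the four polarization vectors up to unit factors, to which
  the diagonal measures are insensitive; the terms with the imaginary unit and its negative change
  places, which is conjugation.\<close>

lemma spectral_form_commute:
  assumes "projection_valued_measure E"
  shows "spectral_form E u w = cnj (spectral_form E w u)"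
proof -
  let ?I = "\<lambda>u. \<integral>t. t \<partial>diagonal_measure E u"
  have sc: "?I (c *\<^sub>C z) = ?I z" if "cmod c = 1" for c z
    using diagonal_unit_scale[OF assms that] by simp
  have 0: "?I (w + u) = ?I (u + w)" by (simp add: add.commute)
  have "w + \<i> *\<^sub>C u = \<i> *\<^sub>C (u - \<i> *\<^sub>C w)"
    by (simp add: complex_vector.scale_right_diff_distrib scaleC_scaleC)
  then have 1: "?I (w + \<i> *\<^sub>C u) = ?I (u - \<i> *\<^sub>C w)" using sc[of \<i>] by simp
  have "w - u = (- 1) *\<^sub>C (u - w)"
    by (simp add: complex_vector.scale_right_diff_distrib)
  then have 2: "?I (w - u) = ?I (u - w)" using sc[of "- 1" "u - w"] by simp
  have "w - \<i> *\<^sub>C u = (- \<i>) *\<^sub>C (u + \<i> *\<^sub>C w)"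
    unfolding scaleC_add_right scaleC_scaleC by simp
  then have 3: "?I (w - \<i> *\<^sub>C u) = ?I (u + \<i> *\<^sub>C w)" using sc[of "- \<i>" "u + \<i> *\<^sub>C w"] by simp
  have i3: "\<i> * (\<i> * \<i>) = - \<i>" by simp
  show ?thesis
    unfolding spectral_form_def
    by (simp add: eval_nat_numeral i3 0 1 2 3)
qed

text \<open>Symmetry of \<open>delta_operator\<close> is not derived from boundary terms but
  extracted from the existence of E. It is what the splines are tested against later.\<close>

lemma spectral_symmetric:
  assumes "is_spectral_measure E T" "(u, v) \<in> T" "(u', v') \<in> T"
  shows "cinner v u' = cinner u v'"
proof -
  have "cinner v u' = spectral_form E u u'" "cinner v' u = spectral_form E u' u"
    using assms by (auto intro!: is_spectral_measureD(3)[OF assms(1)])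
  then show ?thesis
    using spectral_form_commute[OF is_spectral_measureD(1)[OF assms(1)], of u u'] cinner_commute[of u v'] by simp
qed

lemma spectral_nonneg:
  assumes T: "is_spectral_measure E T" "(u, v) \<in> T" and "E {..<0} u = 0"
  shows "0 \<le> Re (cinner v u)"
proof -
  note pvm = is_spectral_measureD(1)[OF T(1)]
  have "emeasure (diagonal_measure E u) {..<0} = 0"
    using assms by (simp add: emeasure_diagonal[OF pvm])
  then have "AE t in diagonal_measure E u. 0 \<le> t"
    by (intro AE_I[of _ _ "{..<0}"]) (auto simp: sets_diagonal[OF pvm])
  then show ?thesis
    unfolding spectral_form_self[OF T] by (intro integral_nonneg_AE) auto
qed

text \<open>The diagonal measure is finite and lives on a bounded window, so its second moment
  exists. On all of \<open>{..<0}\<close> this may fail.\<close>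

lemma
  assumes T: "is_spectral_measure E T" and u: "u \<in> range (E {- real n..<0})"
  shows bounded_spectral_Domain: "u \<in> Domain T"
    and bounded_spectral_negative: "(u, v) \<in> T \<Longrightarrow> u \<noteq> 0 \<Longrightarrow> Re (cinner v u) < 0"
proof -
  note pvm = is_spectral_measureD(1)[OF T]
  interpret finite_measure "diagonal_measure E u" by (rule finite_diagonal[OF pvm])
  have Eu: "E {- real n..<0} u = u"
    using u spectral_idem[OF pvm, of "{- real n..<0}"] by auto
  have ae: "AE t in diagonal_measure E u. t \<in> {- real n..<0}"
    by (rule AE_diagonal[OF pvm _ Eu]) simp
  have bm: "(\<lambda>t. t) \<in> borel_measurable (diagonal_measure E u)"
    unfolding measurable_def by (auto simp: sets_diagonal[OF pvm] space_diagonal[OF pvm])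
  have "integrable (diagonal_measure E u) (\<lambda>t. t\<^sup>2)"
  proof (rule integrable_const_bound)
    show "AE t in diagonal_measure E u. norm (t\<^sup>2) \<le> (real n)\<^sup>2"
      using ae by eventually_elim (auto intro!: power2_le_iff_abs_le[THEN iffD2])
  qed (use bm in measurable)
  then show "u \<in> Domain T" by (simp add: is_spectral_measureD(2)[OF T])
  have int: "integrable (diagonal_measure E u) (\<lambda>t. - t)"
  proof (rule integrable_const_bound)
    show "AE t in diagonal_measure E u. norm (- t) \<le> real n"
      using ae by eventually_elim auto
  qed (use bm in measurable)
  show "Re (cinner v u) < 0" if uv: "(u, v) \<in> T" and "u \<noteq> 0"
  proof -
    have "E UNIV u = u" using pvm by (simp add: projection_valued_measure_def)
    then have pos: "emeasure (diagonal_measure E u) UNIV \<noteq> 0"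
      using \<open>u \<noteq> 0\<close> by (simp add: emeasure_diagonal[OF pvm])
    have "0 \<le> (\<integral>t. - t \<partial>diagonal_measure E u)"
      using ae by (intro integral_nonneg_AE) (auto elim: eventually_mono)
    \<comment> \<open>Strictness: a vanishing integral would place the measure at 0 as well as on
      the negative half-line, so its total mass, the squared norm of u, would be 0.\<close>
    moreover have "(\<integral>t. - t \<partial>diagonal_measure E u) \<noteq> 0"
    proof
      assume "(\<integral>t. - t \<partial>diagonal_measure E u) = 0"
      then have "AE t in diagonal_measure E u. - t = 0"
        using integral_nonneg_eq_0_iff_AE[OF int] eventually_mono[OF ae, of "\<lambda>t. 0 \<le> - t"] by auto
      with ae have "AE t in diagonal_measure E u. False"
        by eventually_elim auto
      then have "emeasure (diagonal_measure E u) (space (diagonal_measure E u)) = 0"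
        by (simp add: AE_iff_measurable[OF sets.top])
      then show False using pos by (simp add: space_diagonal[OF pvm])
    qed
    ultimately show ?thesis
      unfolding spectral_form_self[OF T uv] by simp
  qed
qed

text \<open>The window projections converge pointwise to \<open>E {..<0}\<close>. Once their ranges
  are stationary, the projections are stationary too, so the limit is already one of them.\<close>

lemma negative_squares_le:
  assumes T: "is_spectral_measure E T"
    and bound: "\<And>n B. finite B \<Longrightarrow> B \<subseteq> range (E {- real n..<0}) \<Longrightarrow> complex_vector.independent B \<Longrightarrow> card B \<le> N"
  shows "negative_squares E \<le> enat N"
proof -
  note pvm = is_spectral_measureD(1)[OF T]
  let ?V = "\<lambda>n::nat. range (E {- real n..<0})"
  obtain m B where B: "finite B" "cspan B = ?V m" "card B \<le> N" "\<And>n. ?V n \<subseteq> ?V m"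
  proof (rule subspace_chain_stationary[of ?V N])
    show "complex_vector.subspace (?V n)" for n by (rule subspace_range_spectral[OF pvm]) simp
    show "?V k \<subseteq> ?V n" if "k \<le> n" for k n
      using that by (intro range_spectral_mono[OF pvm]) auto
  qed (use bound in auto)
  have "range (E {..<0}) = ?V m"
  proof
    show "?V m \<subseteq> range (E {..<0})" by (intro range_spectral_mono[OF pvm]) auto
    show "range (E {..<0}) \<subseteq> ?V m"
    proof safe
      fix u
      \<comment> \<open>Slices of length one; they turn the growing windows into a disjoint family,
        to which countable additivity applies.\<close>
      define A where "A n = {- real (Suc n)..<- real n}" for n
      have UN: "(\<Union>n<k. A n) = {- real k..<0}" for k
        by (induction k) (auto simp: A_def lessThan_Suc)
      have "disjoint_family A"
        unfolding disjoint_family_on_def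
      proof (intro ballI impI)
        have "A i \<inter> A j = {}" if "i < j" for i j using that by (auto simp: A_def)
        then show "A i \<inter> A j = {}" if "i \<noteq> j" for i j using that by (metis Int_commute linorder_neqE_nat)
      qed
      moreover have "range A \<subseteq> sets borel" by (auto simp: A_def)
      ultimately have "(\<lambda>n. E (A n) u) sums E (\<Union>n. A n) u"
        by (intro spectral_sums[OF pvm])
      moreover have "(\<Union>n. A n) = {..<0}"
      proof (intro equalityI subsetI)
        fix t :: real assume "t \<in> {..<0}"
        moreover obtain k :: nat where "- t \<le> real k" using real_arch_simple by blast
        ultimately have "t \<in> (\<Union>n<k. A n)" unfolding UN by auto
        then show "t \<in> (\<Union>n. A n)" by auto
      qed (auto simp: A_def)
      moreover have part: "(\<Sum>n<k. E (A n) u) = E {- real k..<0} u" for k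
      proof (induction k)
        case (Suc k)
        have "E ({- real k..<0} \<union> A k) u = E {- real k..<0} u + E (A k) u"
          by (intro spectral_Un[OF pvm]) (auto simp: A_def)
        moreover have "{- real k..<0} \<union> A k = {- real (Suc k)..<0}" by (auto simp: A_def)
        ultimately show ?case using Suc by simp
      qed (simp add: spectral_empty[OF pvm])
      ultimately have "(\<lambda>k. E {- real k..<0} u) \<longlonglongrightarrow> E {..<0} u"
        by (simp add: sums_def)
      moreover have "E {- real k..<0} u = E {- real m..<0} u" if "k \<ge> m" for k
      proof -
        have eq: "E {- real m..<0} (E {- real k..<0} u) = E {- real k..<0} u"
        proof -
          have "E {- real k..<0} u \<in> range (E {- real m..<0})" using B(4)[of k] by auto
          then show ?thesis using spectral_idem[OF pvm, of "{- real m..<0}"] by force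
        qed
        have "{- real k..<0} = {- real m..<0} \<union> {- real k..<- real m}" using that by auto
        then have s: "E {- real k..<0} u = E {- real m..<0} u + E {- real k..<- real m} u"
          by (simp only:) (intro spectral_Un[OF pvm], auto)
        \<comment> \<open>The increment beyond window m is fixed by the projections of two disjoint
          sets, so its diagonal measure has no mass and it vanishes.\<close>
        let ?w = "E {- real k..<- real m} u"
        have "E {- real m..<0} ?w = ?w"
          using eq unfolding s by (simp add: spectral_add[OF pvm] spectral_idem[OF pvm])
        then have "AE t in diagonal_measure E ?w. t \<in> {- real m..<0}"
          by (intro AE_diagonal[OF pvm]) auto
        moreover have "AE t in diagonal_measure E ?w. t \<in> {- real k..<- real m}"
          by (intro AE_diagonal[OF pvm]) (auto simp: spectral_idem[OF pvm])
        ultimately have "AE t in diagonal_measure E ?w. False"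
          by eventually_elim auto
        then have "emeasure (diagonal_measure E ?w) UNIV = 0"
          using AE_iff_measurable[of UNIV "diagonal_measure E ?w" "\<lambda>_. False"]
          by (simp add: space_diagonal[OF pvm] sets_diagonal[OF pvm])
        then have "E UNIV ?w = 0" by (simp add: emeasure_diagonal[OF pvm])
        then have "?w = 0" using pvm by (simp add: projection_valued_measure_def)
        then show ?thesis using s by simp
      qed
      then have "(\<lambda>k. E {- real k..<0} u) \<longlonglongrightarrow> E {- real m..<0} u"
        by (intro tendsto_eventually eventually_sequentiallyI[of m])
      ultimately have "E {..<0} u = E {- real m..<0} u" by (rule LIMSEQ_unique)
      then show "E {..<0} u \<in> ?V m" by simp
    qed
  qed
  then show ?thesis
    unfolding negative_squares_def using B by (intro ecdim_le) auto
qed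

section \<open>Primitives and integration by parts\<close>

text \<open>The signed integral from 0 to t: for t other than 0 one of the two intervals is empty,
  and at 0 both integrals vanish.\<close>

definition primitive :: "(real \<Rightarrow> complex) \<Rightarrow> real \<Rightarrow> complex" where
  "primitive g t = integral {0..t} g - integral {t..0} g"

lemma primitive_diff:
  assumes g: "\<And>a b. g integrable_on {a..b}" and "s \<le> t"
  shows "primitive g t - primitive g s = integral {s..t} g"
proof -
  have c: "integral {b..c} g = integral {a..c} g - integral {a..b} g" if "a \<le> b" "b \<le> c" for a b c
    unfolding eq_diff_eq add.commute[of "integral {b..c} g"]
    using that g by (intro Henstock_Kurzweil_Integration.integral_combine) auto
  have z: "integral {a..b} g = 0" if "b \<le> a" for a b :: real
    using that by (cases "a = b") auto
  consider "0 \<le> s" | "s \<le> 0" "0 \<le> t" | "t \<le> 0" using assms(2) by linarith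
  then show ?thesis
  proof cases
    case 1
    then show ?thesis using c[of 0 s t] z[of 0 s] z[of 0 t] assms(2) by (auto simp: primitive_def)
  next
    case 2
    then show ?thesis using c[of s 0 t] z[of s 0] z[of 0 t] by (auto simp: primitive_def)
  next
    case 3
    then show ?thesis using c[of s t 0] z[of s 0] z[of t 0] assms(2) by (auto simp: primitive_def)
  qed
qed

lemma continuous_primitive:
  assumes g: "\<And>a b. g integrable_on {a..b}"
  shows "continuous_on UNIV (primitive g)"
proof -
  have "isCont (primitive g) t" for t
  proof -
    have "continuous_on {t - 1..t + 1} (\<lambda>s. primitive g (t - 1) + integral {t - 1..s} g)"
      using g by (intro continuous_intros indefinite_integral_continuous_1)
    then have "continuous_on {t - 1..t + 1} (primitive g)"
      by (rule continuous_on_eq) (auto simp: primitive_diff[OF g, symmetric])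
    then show ?thesis by (rule continuous_on_interior) auto
  qed
  then show ?thesis by (simp add: continuous_at_imp_continuous_on)
qed

lemma primitive_has_vector_derivative:
  assumes g: "continuous_on UNIV g"
  shows "(primitive g has_vector_derivative g t) (at t)"
proof -
  have i: "g integrable_on {a..b}" for a b
    by (rule integrable_continuous_real) (rule continuous_on_subset[OF g], simp)
  have "((\<lambda>s. primitive g (t - 1) + integral {t - 1..s} g) has_vector_derivative 0 + g t) (at t within {t - 1..t + 1})"
    by (intro has_vector_derivative_add has_vector_derivative_const integral_has_vector_derivative
        continuous_on_subset[OF g]) auto
  then have "(primitive g has_vector_derivative g t) (at t within {t - 1..t + 1})"
    by (intro has_vector_derivative_transform[of t "{t - 1..t + 1}" "primitive g"])
      (auto simp: primitive_diff[OF i, symmetric])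
  then show ?thesis by (simp add: at_within_Icc_at)
qed

lemma absolutely_integrable_mult_continuous:
  fixes g h :: "real \<Rightarrow> complex"
  assumes "g absolutely_integrable_on {a..b}" "continuous_on {a..b} h"
  shows "(\<lambda>t. g t * h t) absolutely_integrable_on {a..b}"
    and "(\<lambda>t. h t * g t) absolutely_integrable_on {a..b}"
proof -
  show "(\<lambda>t. h t * g t) absolutely_integrable_on {a..b}"
  proof (rule absolutely_integrable_bounded_measurable_product[of "(*)" h "{a..b}" g])
    show "bilinear ((*) :: complex \<Rightarrow> _)"
      by (simp add: bilinear_conv_bounded_bilinear bounded_bilinear_mult)
    show "h \<in> borel_measurable (lebesgue_on {a..b})"
      using assms(2) by (rule continuous_imp_measurable_on_sets_lebesgue) simp
    show "bounded (h ` {a..b})"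
      using assms(2) by (intro compact_imp_bounded compact_continuous_image) auto
  qed (use assms in auto)
  then show "(\<lambda>t. g t * h t) absolutely_integrable_on {a..b}"
    by (simp add: mult.commute)
qed

text \<open>The defect of the product rule has derivative zero everywhere, although the first factor is only
  an indefinite integral: on \<open>[s, t]\<close> the defect is bounded by \<open>t - s\<close> times the increment of a
  continuous function.\<close>

lemma integral_by_parts_indefinite:
  fixes g h h' G :: "real \<Rightarrow> complex"
  assumes ab: "a \<le> b" and g: "g absolutely_integrable_on {a..b}"
    and G: "\<And>s t. a \<le> s \<Longrightarrow> s \<le> t \<Longrightarrow> t \<le> b \<Longrightarrow> G t - G s = integral {s..t} g"
    and h: "\<And>t. t \<in> {a..b} \<Longrightarrow> (h has_vector_derivative h' t) (at t within {a..b})"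
    and h': "continuous_on {a..b} h'"
  shows "integral {a..b} (\<lambda>t. g t * h t) = G b * h b - G a * h a - integral {a..b} (\<lambda>t. G t * h' t)"
proof -
  have g_int: "g integrable_on {s..t}" "(\<lambda>t. norm (g t)) integrable_on {s..t}" if "a \<le> s" "t \<le> b" for s t
  proof -
    have "g absolutely_integrable_on {s..t}"
      using that by (intro set_integrable_subset[OF g]) auto
    then show "g integrable_on {s..t}" "(\<lambda>t. norm (g t)) integrable_on {s..t}"
      by (auto simp: absolutely_integrable_on_def)
  qed
  have hc: "continuous_on {a..b} h"
    using has_derivative_continuous[OF h[unfolded has_vector_derivative_def]] by (auto simp: continuous_on_eq_continuous_within)
  have "continuous_on {a..b} (\<lambda>t. G a + integral {a..t} g)"
    using g_int by (intro continuous_intros indefinite_integral_continuous_1) auto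
  then have Gc: "continuous_on {a..b} G"
  proof (rule continuous_on_eq)
    show "G a + integral {a..t} g = G t" if "t \<in> {a..b}" for t
      using G[of a t] that by (simp flip: G)
  qed
  have int: "(\<lambda>t. g t * k t) integrable_on {s..t}" if "continuous_on {a..b} k" "a \<le> s" "t \<le> b" for k s t
    using set_integrable_subset[OF absolutely_integrable_mult_continuous(1)[OF g that(1)], of "{s..t}"] that(2,3)
    by (auto simp: absolutely_integrable_on_def)
  have intc: "k integrable_on {s..t}" if "continuous_on {a..b} k" "a \<le> s" "t \<le> b" for k :: "real \<Rightarrow> complex" and s t
    using that by (intro integrable_continuous_real continuous_on_subset[OF that(1)]) auto
  have "bounded (h' ` {a..b})"
    using h' by (intro compact_imp_bounded compact_continuous_image) auto
  then obtain C where C: "C > 0" "\<And>t. t \<in> {a..b} \<Longrightarrow> norm (h' t) \<le> C"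
    by (auto simp: bounded_pos)
  \<comment> \<open>The primitive of \<open>norm (g t)\<close> dominates the increments of G and
    supplies the continuous modulus in the estimate.\<close>
  define A where "A t = integral {a..t} (\<lambda>t. norm (g t))" for t
  define D where "D t = integral {a..t} (\<lambda>t. g t * h t) - G t * h t + integral {a..t} (\<lambda>t. G t * h' t)" for t
  have Ac: "continuous_on {a..b} A"
    unfolding A_def using g_int by (intro indefinite_integral_continuous_1) auto
  have est: "norm (D t - D s) \<le> 2 * C * (t - s) * (A t - A s)" if st: "a \<le> s" "s \<le> t" "t \<le> b" for s t
  proof -
    have A: "A t - A s = integral {s..t} (\<lambda>t. norm (g t))"
      unfolding A_def using st g_int
      by (subst Henstock_Kurzweil_Integration.integral_combine[symmetric, of a s t]) auto
    have h_diff: "h v - h w = integral {w..v} h'" if "a \<le> w" "w \<le> v" "v \<le> b" for v w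
    proof -
      have "(h' has_integral (h v - h w)) {w..v}"
        using that by (intro fundamental_theorem_of_calculus)
          (auto intro: has_vector_derivative_within_subset[OF h])
      then show ?thesis by (simp add: integral_unique)
    qed
    have h_est: "norm (h \<tau> - h t) \<le> C * (t - s)" if "\<tau> \<in> {s..t}" for \<tau>
    proof -
      have "norm (integral {\<tau>..t} h') \<le> C * (t - \<tau>)"
        using that st C by (intro integral_bound continuous_on_subset[OF h']) auto
      also have "\<dots> \<le> C * (t - s)" using that C by (intro mult_left_mono) auto
      finally show ?thesis using h_diff[of \<tau> t] that st by (simp add: norm_minus_commute[of "h \<tau>" "h t"])
    qed
    have G_est: "norm (G \<tau> - G s) \<le> A t - A s" if "\<tau> \<in> {s..t}" for \<tau>
    proof -
      have "norm (G \<tau> - G s) \<le> integral {s..\<tau>} (\<lambda>t. norm (g t))"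
        using that st G[of s \<tau>] g_int by (auto intro!: integral_norm_bound_integral)
      also have "\<dots> \<le> A t - A s"
        unfolding A using that st g_int by (intro integral_subset_le) auto
      finally show ?thesis .
    qed
    have Gh': "continuous_on {a..b} (\<lambda>\<tau>. G \<tau> * h' \<tau>)" and Gsh': "continuous_on {a..b} (\<lambda>\<tau>. G s * h' \<tau>)"
      by (rule continuous_on_mult[OF Gc h'], rule continuous_on_mult[OF continuous_on_const h'])
    have i1: "integral {s..t} (\<lambda>\<tau>. g \<tau> * (h \<tau> - h t)) = integral {s..t} (\<lambda>\<tau>. g \<tau> * h \<tau>) - (G t - G s) * h t"
      unfolding right_diff_distrib G[OF st]
      by (subst Henstock_Kurzweil_Integration.integral_diff[OF int[OF hc st(1,3)] int[OF continuous_on_const st(1,3)]]) simp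
    have i2: "integral {s..t} (\<lambda>\<tau>. (G \<tau> - G s) * h' \<tau>) = integral {s..t} (\<lambda>\<tau>. G \<tau> * h' \<tau>) - G s * (h t - h s)"
      unfolding left_diff_distrib h_diff[OF st]
      by (subst Henstock_Kurzweil_Integration.integral_diff[OF intc[OF Gh' st(1,3)] intc[OF Gsh' st(1,3)]]) simp
    have c1: "integral {a..t} (\<lambda>\<tau>. g \<tau> * h \<tau>) = integral {a..s} (\<lambda>\<tau>. g \<tau> * h \<tau>) + integral {s..t} (\<lambda>\<tau>. g \<tau> * h \<tau>)"
      using Henstock_Kurzweil_Integration.integral_combine[OF st(1,2) int[OF hc order_refl st(3)]] by simp
    have c2: "integral {a..t} (\<lambda>\<tau>. G \<tau> * h' \<tau>) = integral {a..s} (\<lambda>\<tau>. G \<tau> * h' \<tau>) + integral {s..t} (\<lambda>\<tau>. G \<tau> * h' \<tau>)"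
      using Henstock_Kurzweil_Integration.integral_combine[OF st(1,2) intc[OF Gh' order_refl st(3)]] by simp
    have D_diff: "D t - D s = integral {s..t} (\<lambda>\<tau>. g \<tau> * (h \<tau> - h t)) + integral {s..t} (\<lambda>\<tau>. (G \<tau> - G s) * h' \<tau>)"
      unfolding i1 i2 D_def c1 c2 by (simp add: left_diff_distrib right_diff_distrib)
    moreover have "norm (integral {s..t} (\<lambda>\<tau>. g \<tau> * (h \<tau> - h t))) \<le> integral {s..t} (\<lambda>\<tau>. C * (t - s) * norm (g \<tau>))"
    proof (rule integral_norm_bound_integral)
      show "(\<lambda>\<tau>. g \<tau> * (h \<tau> - h t)) integrable_on {s..t}"
        by (rule int[OF continuous_on_diff[OF hc continuous_on_const] st(1,3)])
      show "(\<lambda>\<tau>. C * (t - s) * norm (g \<tau>)) integrable_on {s..t}"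
        using g_int(2)[OF st(1,3)] by (rule integrable_on_mult_right)
      show "norm (g \<tau> * (h \<tau> - h t)) \<le> C * (t - s) * norm (g \<tau>)" if "\<tau> \<in> {s..t}" for \<tau>
        using mult_right_mono[OF h_est[OF that], of "norm (g \<tau>)"] by (simp add: norm_mult mult.commute)
    qed
    moreover have "norm (integral {s..t} (\<lambda>\<tau>. (G \<tau> - G s) * h' \<tau>)) \<le> ((A t - A s) * C) * (t - s)"
    proof (rule integral_bound[OF st(2)])
      have "continuous_on {a..b} (\<lambda>\<tau>. (G \<tau> - G s) * h' \<tau>)"
        by (rule continuous_on_mult[OF continuous_on_diff[OF Gc continuous_on_const] h'])
      then show "continuous_on {s..t} (\<lambda>\<tau>. (G \<tau> - G s) * h' \<tau>)"
        using st by (rule_tac continuous_on_subset) auto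
      show "norm ((G \<tau> - G s) * h' \<tau>) \<le> (A t - A s) * C" if "\<tau> \<in> {s..t}" for \<tau>
      proof -
        have "norm (G \<tau> - G s) * norm (h' \<tau>) \<le> (A t - A s) * C"
          using G_est[OF that] C(2)[of \<tau>] that st order_trans[OF norm_ge_zero G_est[OF that]]
          by (intro mult_mono) auto
        then show ?thesis by (simp add: norm_mult)
      qed
    qed
    moreover have "integral {s..t} (\<lambda>\<tau>. C * (t - s) * norm (g \<tau>)) = C * (t - s) * (A t - A s)"
      unfolding A by simp
    moreover have "C * (t - s) * (A t - A s) + ((A t - A s) * C) * (t - s) = 2 * C * (t - s) * (A t - A s)"
      by (simp add: algebra_simps)
    ultimately show ?thesis
      unfolding D_diff by (intro norm_triangle_le) linarith
  qed
  have "(D has_vector_derivative 0) (at t within {a..b})" if t: "t \<in> {a..b}" for t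
  proof -
    have "((\<lambda>s. 2 * C * norm (A s - A t)) \<longlongrightarrow> 2 * C * norm (A t - A t)) (at t within {a..b})"
      using Ac t by (intro tendsto_intros) (auto simp: continuous_on_def)
    moreover have "eventually (\<lambda>s. norm ((1 / norm (s - t)) *\<^sub>R (D s - (D t + (s - t) *\<^sub>R 0))) \<le> 2 * C * norm (A s - A t)) (at t within {a..b})"
      unfolding eventually_at_filter
    proof (rule always_eventually, safe)
      fix s assume s: "s \<noteq> t" "s \<in> {a..b}"
      have "norm (D s - D t) \<le> 2 * C * \<bar>s - t\<bar> * norm (A s - A t)"
      proof (cases "s \<le> t")
        case True
        have "norm (D t - D s) \<le> 2 * C * (t - s) * (A t - A s)" using est[of s t] s t True by auto
        also have "\<dots> \<le> 2 * C * (t - s) * norm (A s - A t)" using True C by (intro mult_left_mono) auto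
        finally show ?thesis using True by (simp add: norm_minus_commute)
      next
        case False
        have "norm (D s - D t) \<le> 2 * C * (s - t) * (A s - A t)" using est[of t s] s t False by auto
        also have "\<dots> \<le> 2 * C * (s - t) * norm (A s - A t)" using False C by (intro mult_left_mono) auto
        finally show ?thesis using False by simp
      qed
      then show "norm ((1 / norm (s - t)) *\<^sub>R (D s - (D t + (s - t) *\<^sub>R 0))) \<le> 2 * C * norm (A s - A t)"
        using s by (simp add: pos_divide_le_eq mult_ac)
    qed
    moreover have "2 * C * norm (A t - A t) = 0" by simp
    ultimately have "((\<lambda>s. (1 / norm (s - t)) *\<^sub>R (D s - (D t + (s - t) *\<^sub>R 0))) \<longlongrightarrow> 0) (at t within {a..b})"
      by (simp only:) (rule Lim_null_comparison)
    then show ?thesis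
      unfolding has_vector_derivative_def has_derivative_within by (simp add: bounded_linear_zero)
  qed
  then have "\<exists>c. \<forall>t\<in>{a..b}. D t = c"
    using has_vector_derivative_zero_constant[OF convex_real_interval(5), of a b D] by metis
  then obtain c where c: "\<And>t. t \<in> {a..b} \<Longrightarrow> D t = c" by blast
  have "D a = - (G a * h a)" by (simp add: D_def)
  moreover have "D b = integral {a..b} (\<lambda>t. g t * h t) - G b * h b + integral {a..b} (\<lambda>t. G t * h' t)"
    by (simp add: D_def)
  moreover have "D a = D b" using c[of a] c[of b] ab by simp
  ultimately show ?thesis by algebra
qed

section \<open>Square-integrable functions and absolute continuity\<close>

lemma square_integrable_absolutely_integrable:
  assumes "square_integrable g"
  shows "g absolutely_integrable_on {a..b}"
  unfolding set_integrable_def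
proof (rule Bochner_Integration.integrable_bound)
  have [measurable]: "g \<in> borel_measurable lebesgue" using assms by (simp add: square_integrable_def)
  show "(\<lambda>t. indicat_real {a..b} t *\<^sub>R g t) \<in> borel_measurable lebesgue"
    by (intro borel_measurable_scaleR borel_measurable_indicator) auto
  show "integrable lebesgue (\<lambda>t. indicat_real {a..b} t + (cmod (g t))\<^sup>2)"
    using assms by (intro Bochner_Integration.integrable_add integrable_real_indicator)
      (auto simp: square_integrable_def emeasure_lborel_Icc_eq)
  have "cmod z \<le> 1 + (cmod z)\<^sup>2" for z
    using sum_squares_bound[of 1 "cmod z"] norm_ge_zero[of z] by (simp del: norm_ge_zero)
  then show "AE t in lebesgue. norm (indicat_real {a..b} t *\<^sub>R g t) \<le> norm (indicat_real {a..b} t + (cmod (g t))\<^sup>2)"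
    by (auto simp: indicator_def)
qed

lemma square_integrable_integrable_on:
  assumes "square_integrable g"
  shows "g integrable_on {s..t}" "(\<lambda>t. cmod (g t)) integrable_on {s..t}"
  using square_integrable_absolutely_integrable[OF assms] by (auto simp: absolutely_integrable_on_def)

lemma continuous_primitive_square_integrable:
  assumes "square_integrable g"
  shows "continuous_on UNIV (primitive g)" and "continuous_on UNIV (primitive (primitive g))"
proof -
  show c: "continuous_on UNIV (primitive g)"
    by (rule continuous_primitive) (rule square_integrable_integrable_on[OF assms])
  show "continuous_on UNIV (primitive (primitive g))"
    by (intro continuous_primitive integrable_continuous_real continuous_on_subset[OF c]) simp
qed

lemma lebesgue_integral_eq_integral_on:
  fixes f :: "real \<Rightarrow> complex"
  assumes "integrable lebesgue f" "\<And>t. t \<notin> S \<Longrightarrow> f t = 0"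
  shows "(LINT t|lebesgue. f t) = integral S f"
proof -
  have "(LINT t|lebesgue. f t) = integral UNIV f"
    using assms(1) by (simp add: integral_lebesgue)
  also have "\<dots> = integral UNIV (\<lambda>t. if t \<in> S then f t else 0)"
    using assms(2) by (intro arg_cong[of _ _ "integral UNIV"]) auto
  also have "\<dots> = integral S f" by (rule integral_restrict_UNIV)
  finally show ?thesis .
qed

lemma square_integrable_continuous_bounded_support:
  assumes "continuous_on UNIV f" "\<And>t. t \<notin> {a..b} \<Longrightarrow> f t = 0"
  shows "square_integrable f"
  unfolding square_integrable_def
proof
  show m: "f \<in> borel_measurable lebesgue"
    using assms(1) by (intro measurable_completion) (simp add: borel_measurable_continuous_onI)
  have "(\<lambda>t. (cmod (f t))\<^sup>2) absolutely_integrable_on {a..b}"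
    by (intro absolutely_integrable_continuous_real continuous_intros continuous_on_subset[OF assms(1)]) simp
  moreover have "(\<lambda>t. indicat_real {a..b} t *\<^sub>R (cmod (f t))\<^sup>2) = (\<lambda>t. (cmod (f t))\<^sup>2)"
    using assms(2) by (auto simp: indicator_def fun_eq_iff)
  ultimately show "integrable lebesgue (\<lambda>t. (cmod (f t))\<^sup>2)"
    by (simp add: set_integrable_def)
qed

lemma square_integrable_bounded_support:
  assumes "f \<in> borel_measurable lebesgue" "\<And>t. t \<notin> {a..b} \<Longrightarrow> f t = 0" "\<And>t. cmod (f t) \<le> C"
  shows "square_integrable f"
  unfolding square_integrable_def
proof
  show "f \<in> borel_measurable lebesgue" by fact
  have [measurable]: "f \<in> borel_measurable lebesgue" by fact
  show "integrable lebesgue (\<lambda>t. (cmod (f t))\<^sup>2)"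
  proof (rule Bochner_Integration.integrable_bound)
    show "integrable lebesgue (\<lambda>t. C\<^sup>2 * indicat_real {a..b} t)"
      by (intro integrable_mult_right integrable_real_indicator) (auto simp: emeasure_lborel_Icc_eq)
    show "(\<lambda>t. (cmod (f t))\<^sup>2) \<in> borel_measurable lebesgue" by measurable
    show "AE t in lebesgue. norm ((cmod (f t))\<^sup>2) \<le> norm (C\<^sup>2 * indicat_real {a..b} t)"
      using assms(2) by (auto simp: indicator_def intro!: power_mono[OF assms(3)])
  qed
qed

text \<open>Elements of the Sobolev space are arbitrary on X, and second derivatives of splines have
  default values at the knots. Neither affects the class in L2.\<close>

lemma L2_eq_countable_difference:
  assumes "square_integrable f" "countable S" "\<And>t. t \<notin> S \<Longrightarrow> f t = g t"
  shows "L2_eq f g"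
proof -
  have fm: "f \<in> borel_measurable lebesgue" using assms(1) by (simp add: square_integrable_def)
  have gm: "g \<in> borel_measurable lebesgue"
    by (rule measurable_discrete_difference[OF fm assms(2) _ _ assms(3)]) auto
  have "S \<in> null_sets lebesgue"
    using assms(2) by (intro null_sets_completionI countable_imp_null_set_lborel)
  then have ae: "AE t in lebesgue. f t = g t"
    using assms(3) by (intro AE_I'[of S]) auto
  have "integrable lebesgue (\<lambda>t. (cmod (f t))\<^sup>2)" using assms(1) by (simp add: square_integrable_def)
  then have "integrable lebesgue (\<lambda>t. (cmod (g t))\<^sup>2)"
  proof (rule integrable_cong_AE_imp)
    show "(\<lambda>t. (cmod (g t))\<^sup>2) \<in> borel_measurable lebesgue" using gm by measurable
    show "AE t in lebesgue. (cmod (f t))\<^sup>2 = (cmod (g t))\<^sup>2" using ae by eventually_elim simp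
  qed
  with assms(1) gm ae show ?thesis by (simp add: L2_eq_def square_integrable_def)
qed

lemma cinner_abs_L2:
  assumes "square_integrable f" "square_integrable g"
  shows "cinner (abs_L2 f) (abs_L2 g) = (LINT t|lebesgue. f t * cnj (g t))"
  unfolding cinner_L2_def using assms by (intro L2_inner.abs_eq) (auto simp: L2_eq_def)

lemma abs_L2_eq_iff:
  assumes "square_integrable f" "square_integrable g"
  shows "abs_L2 f = abs_L2 g \<longleftrightarrow> (AE t in lebesgue. f t = g t)"
  using Quotient3_rel[OF Quotient3_L2, of f g] assms by (auto simp: L2_eq_def)

lemma abs_L2_sum:
  assumes "finite I" "\<And>i. i \<in> I \<Longrightarrow> square_integrable (f i)"
  shows "square_integrable (\<lambda>t. \<Sum>i\<in>I. c i * f i t)"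
    and "abs_L2 (\<lambda>t. \<Sum>i\<in>I. c i * f i t) = (\<Sum>i\<in>I. c i *\<^sub>C abs_L2 (f i))"
proof -
  have "square_integrable (\<lambda>t. \<Sum>i\<in>I. c i * f i t) \<and>
    abs_L2 (\<lambda>t. \<Sum>i\<in>I. c i * f i t) = (\<Sum>i\<in>I. c i *\<^sub>C abs_L2 (f i))"
    using assms
  proof (induction I rule: finite_induct)
    case empty
    then show ?case by (simp add: square_integrable_zero zero_L2.abs_eq)
  next
    case (insert j I)
    have 1: "square_integrable (\<lambda>t. c j * f j t)"
      using insert.prems by (intro square_integrable_scale) auto
    have 2: "abs_L2 (\<lambda>t. c j * f j t) = c j *\<^sub>C abs_L2 (f j)"
      using insert.prems by (subst scaleC_L2.abs_eq) (auto simp: L2_eq_def)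
    have IH: "square_integrable (\<lambda>t. \<Sum>i\<in>I. c i * f i t)"
       "abs_L2 (\<lambda>t. \<Sum>i\<in>I. c i * f i t) = (\<Sum>i\<in>I. c i *\<^sub>C abs_L2 (f i))"
      using insert by auto
    show ?case
      using insert.hyps square_integrable_add[OF 1 IH(1)] 1 IH
      by (simp add: 2[symmetric] IH(2)[symmetric] plus_L2.abs_eq L2_eq_def)
  qed
  then show "square_integrable (\<lambda>t. \<Sum>i\<in>I. c i * f i t)"
    "abs_L2 (\<lambda>t. \<Sum>i\<in>I. c i * f i t) = (\<Sum>i\<in>I. c i *\<^sub>C abs_L2 (f i))" by auto
qed

text \<open>An open null set is empty. Values at the nodes become well defined for classes in L2
  that have a continuous representative.\<close>

lemma continuous_AE_eq:
  fixes f g :: "real \<Rightarrow> complex"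
  assumes "continuous_on UNIV f" "continuous_on UNIV g" "AE t in lebesgue. f t = g t"
  shows "f = g"
proof -
  have o: "open {t. f t \<noteq> g t}"
    using assms(1,2) by (intro open_Collect_neq)
  then have "{t. f t \<noteq> g t} \<in> sets lebesgue" by auto
  then have "{t. f t \<noteq> g t} \<in> null_sets lebesgue"
    using assms(3) by (subst AE_iff_null_sets) auto
  then have "{t. f t \<noteq> g t} = {}"
    using open_not_negligible[OF o] by (auto simp: negligible_iff_null_sets)
  then show ?thesis by auto
qed

lemma lipschitz_absolutely_continuous:
  assumes L: "\<And>s t. a \<le> s \<Longrightarrow> s \<le> t \<Longrightarrow> t \<le> b \<Longrightarrow> cmod (f t - f s) \<le> L * (t - s)"
  shows "absolutely_continuous_interval a b f"
  unfolding absolutely_continuous_interval_def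
proof (intro allI impI)
  fix \<epsilon> :: real assume e: "\<epsilon> > 0"
  \<comment> \<open>The maximum with 1 keeps the divisor of \<open>\<epsilon> / M\<close> positive
    even if L is not.\<close>
  define M where "M = max L 1"
  have M: "M > 0" "L \<le> M" by (auto simp: M_def)
  show "\<exists>\<delta>>0. \<forall>I. finite I \<longrightarrow> (\<forall>(s, t)\<in>I. a \<le> s \<and> s \<le> t \<and> t \<le> b) \<longrightarrow>
      disjoint_family_on (\<lambda>(s, t). {s<..<t}) I \<longrightarrow> (\<Sum>(s, t)\<in>I. t - s) < \<delta> \<longrightarrow>
      (\<Sum>(s, t)\<in>I. cmod (f t - f s)) < \<epsilon>"
  proof (intro exI[of _ "\<epsilon> / M"] conjI allI impI)
    show "0 < \<epsilon> / M" using e M by simp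
    fix I :: "(real \<times> real) set"
    assume I: "\<forall>(s, t)\<in>I. a \<le> s \<and> s \<le> t \<and> t \<le> b" "(\<Sum>(s, t)\<in>I. t - s) < \<epsilon> / M"
    have "(\<Sum>(s, t)\<in>I. cmod (f t - f s)) \<le> (\<Sum>(s, t)\<in>I. M * (t - s))"
    proof (rule sum_mono)
      fix p assume "p \<in> I"
      then have "a \<le> fst p \<and> fst p \<le> snd p \<and> snd p \<le> b" using I(1) by auto
      then have "cmod (f (snd p) - f (fst p)) \<le> M * (snd p - fst p)"
        using L[of "fst p" "snd p"] mult_right_mono[OF M(2), of "snd p - fst p"] by linarith
      then show "(case p of (s, t) \<Rightarrow> cmod (f t - f s)) \<le> (case p of (s, t) \<Rightarrow> M * (t - s))"
        by (simp add: case_prod_beta)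
    qed
    also have "\<dots> = M * (\<Sum>(s, t)\<in>I. t - s)" by (simp add: sum_distrib_left case_prod_beta)
    also have "\<dots> < \<epsilon>" using I(2) M by (simp add: field_simps)
    finally show "(\<Sum>(s, t)\<in>I. cmod (f t - f s)) < \<epsilon>" .
  qed
qed

text \<open>Families consisting of a single interval suffice.\<close>

lemma absolutely_continuous_imp_continuous:
  assumes "absolutely_continuous_interval a b f"
  shows "continuous_on {a..b} f"
  unfolding continuous_on_iff
proof (intro ballI allI impI)
  fix t \<epsilon> :: real assume t: "t \<in> {a..b}" and e: "\<epsilon> > 0"
  then obtain \<delta> where d: "\<delta> > 0" "\<And>I. finite I \<Longrightarrow> \<forall>(s, t)\<in>I. a \<le> s \<and> s \<le> t \<and> t \<le> b \<Longrightarrow>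
      disjoint_family_on (\<lambda>(s, t). {s<..<t}) I \<Longrightarrow> (\<Sum>(s, t)\<in>I. t - s) < \<delta> \<Longrightarrow>
      (\<Sum>(s, t)\<in>I. cmod (f t - f s)) < \<epsilon>"
    using assms unfolding absolutely_continuous_interval_def by meson
  have *: "cmod (f v - f u) < \<epsilon>" if "a \<le> u" "u \<le> v" "v \<le> b" "v - u < \<delta>" for u v
    using d(2)[of "{(u, v)}"] that by (simp add: disjoint_family_on_def)
  show "\<exists>d>0. \<forall>s\<in>{a..b}. dist s t < d \<longrightarrow> dist (f s) (f t) < \<epsilon>"
  proof (intro exI[of _ \<delta>] conjI ballI impI)
    fix s assume s: "s \<in> {a..b}" "dist s t < \<delta>"
    show "dist (f s) (f t) < \<epsilon>"
    proof (cases "s \<le> t")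
      case True
      then show ?thesis using *[of s t] s t by (simp add: dist_norm norm_minus_commute)
    next
      case False
      then show ?thesis using *[of t s] s t by (simp add: dist_norm)
    qed
  qed (use d in auto)
qed

section \<open>Interaction points with gaps bounded from below\<close>

lemma absolutely_continuous_of_derivative:
  assumes f: "\<And>t. t \<in> {a..b} \<Longrightarrow> (f has_vector_derivative f' t) (at t)" and f': "continuous_on {a..b} f'"
  shows "absolutely_continuous_interval a b f"
proof -
  have "bounded (f' ` {a..b})"
    using f' by (intro compact_imp_bounded compact_continuous_image) auto
  then obtain L where L: "\<And>t. t \<in> {a..b} \<Longrightarrow> norm (f' t) \<le> L"
    by (meson bounded_iff imageI)
  show ?thesis
  proof (rule lipschitz_absolutely_continuous)
    fix s t assume st: "a \<le> s" "s \<le> t" "t \<le> b"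
    have "(f' has_integral (f t - f s)) {s..t}"
      using st f by (intro fundamental_theorem_of_calculus)
        (auto intro: has_vector_derivative_at_within)
    then have "f t - f s = integral {s..t} f'" by (simp add: integral_unique)
    also have "norm \<dots> \<le> L * (t - s)"
      using st L by (intro integral_bound continuous_on_subset[OF f']) auto
    finally show "cmod (f t - f s) \<le> L * (t - s)" .
  qed
qed

locale separated_points =
  fixes x :: "nat \<Rightarrow> real" and d :: real
  assumes d_pos: "0 < d" and gap_ge: "\<And>k. k \<ge> 1 \<Longrightarrow> d \<le> gap x k"
begin

abbreviation X where "X \<equiv> x ` {1..}"

text \<open>The only unbounded piece is the half-line to the left of X; as the points tend to
  infinity, there is none on the right. Index 0 therefore never needs a gap.\<close>

definition piece :: "nat \<Rightarrow> real set" where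
  "piece k = (if k = 0 then {..x 1} else {x k..x (Suc k)})"

definition open_piece :: "nat \<Rightarrow> real set" where
  "open_piece k = (if k = 0 then {..<x 1} else {x k<..<x (Suc k)})"

lemma gap_pos: "k \<ge> 1 \<Longrightarrow> 0 < gap x k"
  using gap_ge[of k] d_pos by linarith

lemma x_separated:
  assumes "1 \<le> i" "i < j"
  shows "x i + d \<le> x j"
proof -
  have "Suc i \<le> j" using assms by simp
  then show ?thesis
  proof (induction j rule: dec_induct)
    case base
    then show ?case using gap_ge[of i] assms by (simp add: gap_def)
  next
    case (step n)
    then show ?case using gap_ge[of n] d_pos assms by (simp add: gap_def)
  qed
qed

lemma x_mono: "1 \<le> i \<Longrightarrow> i \<le> j \<Longrightarrow> x i \<le> x j"
  using x_separated[of i j] d_pos by (cases "i = j") auto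

lemma x_less_iff: "1 \<le> i \<Longrightarrow> 1 \<le> j \<Longrightarrow> x i < x j \<longleftrightarrow> i < j"
  using x_separated[of i j] x_mono[of j i] d_pos by (cases "i < j") auto

lemma x_lower: "x 1 + real n * d \<le> x (Suc n)"
proof (induction n)
  case (Suc n)
  then show ?case using gap_ge[of "Suc n"] by (simp add: gap_def algebra_simps)
qed simp

lemma filterlim_x: "filterlim x at_top sequentially"
proof -
  have "filterlim (\<lambda>n. x 1 + d * real n) at_top sequentially"
    by (intro filterlim_tendsto_add_at_top[OF tendsto_const] filterlim_tendsto_pos_mult_at_top[OF tendsto_const]
        d_pos filterlim_real_sequentially)
  then have "filterlim (\<lambda>n. x (Suc n)) at_top sequentially"
    by (rule filterlim_at_top_mono) (use x_lower in \<open>simp add: mult.commute\<close>)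
  then show ?thesis by (simp add: filterlim_sequentially_Suc)
qed

lemma ex_open_piece:
  assumes "t \<notin> X"
  shows "\<exists>k. t \<in> open_piece k"
proof (cases "t < x 1")
  case True
  then show ?thesis by (intro exI[of _ 0]) (simp add: open_piece_def)
next
  case False
  have "eventually (\<lambda>n. t < x n) sequentially"
    using filterlim_x by (simp add: filterlim_at_top_dense)
  then obtain N where N: "\<And>n. n \<ge> N \<Longrightarrow> t < x n" by (auto simp: eventually_sequentially)
  define m where "m = (LEAST n. t < x (Suc n))"
  have m: "t < x (Suc m)" unfolding m_def by (rule LeastI[of _ N]) (use N in auto)
  have "m \<noteq> 0" using False m by (cases m) auto
  then have "\<not> t < x m"
    using not_less_Least[of "m - 1" "\<lambda>n. t < x (Suc n)"] unfolding m_def[symmetric] by simp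
  moreover have "t \<noteq> x m" using assms \<open>m \<noteq> 0\<close> by auto
  ultimately show ?thesis
    using m \<open>m \<noteq> 0\<close> by (intro exI[of _ m]) (simp add: open_piece_def)
qed

lemma open_open_piece: "open (open_piece k)"
  by (simp add: open_piece_def)

lemma open_piece_subset: "open_piece k \<subseteq> piece k"
  by (auto simp: open_piece_def piece_def)

lemma closure_open_piece: "closure (open_piece k) = piece k"
  using gap_pos[of k] by (auto simp: open_piece_def piece_def gap_def)

lemma open_piece_Int_X: "open_piece k \<inter> X = {}"
proof -
  have "x j \<notin> open_piece k" if "j \<ge> 1" for j
  proof (cases "k = 0")
    case True
    then show ?thesis using x_mono[of 1 j] that by (auto simp: open_piece_def)
  next
    case False
    then have "x k < x j \<longleftrightarrow> k < j" "x j < x (Suc k) \<longleftrightarrow> j < Suc k"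
      using that x_less_iff[of k j] x_less_iff[of j "Suc k"] by auto
    then show ?thesis using False by (auto simp: open_piece_def)
  qed
  then show ?thesis by auto
qed

lemma open_piece_interval: "s \<in> open_piece k \<Longrightarrow> t \<in> open_piece k \<Longrightarrow> {s..t} \<subseteq> open_piece k"
  by (auto simp: open_piece_def split: if_splits)

lemma piece_interval: "s \<in> piece k \<Longrightarrow> t \<in> piece k \<Longrightarrow> {s..t} \<subseteq> piece k"
  by (auto simp: piece_def split: if_splits)

lemma eventually_open_piece:
  assumes "k \<ge> 1"
  shows "eventually (\<lambda>t. t \<in> open_piece k) (at_right (x k))"
    and "eventually (\<lambda>t. t \<in> open_piece (k - 1)) (at_left (x k))"
proof -
  show "eventually (\<lambda>t. t \<in> open_piece k) (at_right (x k))"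
    using eventually_at_right_real[of "x k" "x (Suc k)"] gap_pos[OF assms] assms
    by (simp add: open_piece_def gap_def)
  show "eventually (\<lambda>t. t \<in> open_piece (k - 1)) (at_left (x k))"
  proof (cases "k = 1")
    case True
    then show ?thesis by (auto simp: open_piece_def eventually_at_filter)
  next
    case False
    then show ?thesis
      using eventually_at_left_real[of "x (k - 1)" "x k"] gap_pos[of "k - 1"] assms
      by (simp add: open_piece_def gap_def)
  qed
qed

lemma x_in_piece: "k \<ge> 1 \<Longrightarrow> x k \<in> piece k" "k \<ge> 1 \<Longrightarrow> x k \<in> piece (k - 1)" "x (Suc k) \<in> piece k"
  using gap_pos[of k] x_mono[of "k - 1" k] by (auto simp: piece_def gap_def)

subsection \<open>Spline test functions\<close>

text \<open>Splines of degree two with the knots \<open>a j\<close>; vanishing moments up to order two make them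
  compactly supported. Testing a symmetric operator against them gives the weak form of \<open>T u = v\<close>.\<close>

lemma spline_test_function:
  fixes a c :: "'j \<Rightarrow> real"
  assumes J: "finite J" and a: "\<And>j. j \<in> J \<Longrightarrow> a j \<in> {lo..hi}" and X: "{lo..hi} \<inter> X = {}"
    and m0: "(\<Sum>j\<in>J. c j) = 0" and m1: "(\<Sum>j\<in>J. c j * a j) = 0" and m2: "(\<Sum>j\<in>J. c j * (a j)\<^sup>2) = 0"
  obtains h h1 h2 :: "real \<Rightarrow> complex" where
    "\<And>t. h2 t = (\<Sum>j\<in>J. of_real (c j) * (if a j < t then 1 else 0))"
    "square_integrable h" "square_integrable h2"
    "\<And>t. cnj (h t) = h t" "\<And>t. cnj (h2 t) = h2 t"
    "(abs_L2 h, abs_L2 (\<lambda>t. - h2 t)) \<in> delta_operator x \<alpha>"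
    "\<And>t. t \<notin> {lo..hi} \<Longrightarrow> h t = 0" "\<And>t. t \<notin> {lo..hi} \<Longrightarrow> h2 t = 0"
    "\<And>t. (h has_vector_derivative h1 t) (at t)" "continuous_on UNIV h1"
    "\<And>s t. s \<le> t \<Longrightarrow> (h2 has_integral (h1 t - h1 s)) {s..t}"
    "h lo = 0" "h hi = 0" "h1 lo = 0" "h1 hi = 0"
proof -
  \<comment> \<open>A combination of truncated powers; \<open>h1\<close> is its derivative
    everywhere, and \<open>h2\<close> that of \<open>h1\<close> away from the knots.\<close>
  define h where "h t = complex_of_real (\<Sum>j\<in>J. c j * ((max 0 (t - a j))\<^sup>2 / 2))" for t
  define h1 where "h1 t = complex_of_real (\<Sum>j\<in>J. c j * max 0 (t - a j))" for t
  define h2 where "h2 t = complex_of_real (\<Sum>j\<in>J. c j * (if a j < t then 1 else 0))" for t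
  have left: "h t = 0" "h1 t = 0" "h2 t = 0" if "t \<le> lo" for t
    using that a unfolding h_def h1_def h2_def of_real_eq_0_iff
    by (intro sum.neutral; fastforce)+
  \<comment> \<open>To the right of all knots h and \<open>h1\<close> are polynomials in t whose
    coefficients are multiples of the three vanishing moments.\<close>
  have right: "h t = 0" "h1 t = 0" if "t \<ge> hi" for t
  proof -
    have mx: "max 0 (t - a j) = t - a j" if "j \<in> J" for j using a[OF that] \<open>t \<ge> hi\<close> by auto
    have "(\<Sum>j\<in>J. c j * max 0 (t - a j)) = (\<Sum>j\<in>J. t * c j - c j * a j)"
      by (intro sum.cong) (auto simp: mx algebra_simps)
    also have "\<dots> = 0" unfolding sum_subtractf sum_distrib_left[symmetric] m0 m1 by simp
    finally show "h1 t = 0" by (simp only: h1_def of_real_0)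
    have "(\<Sum>j\<in>J. c j * ((max 0 (t - a j))\<^sup>2 / 2)) = (\<Sum>j\<in>J. t\<^sup>2 / 2 * c j - t * (c j * a j) + 1 / 2 * (c j * (a j)\<^sup>2))"
      by (intro sum.cong) (auto simp: mx field_simps power2_eq_square)
    also have "\<dots> = 0"
      unfolding sum_subtractf sum.distrib sum_distrib_left[symmetric] m0 m1 m2 by simp
    finally show "h t = 0" by (simp only: h_def of_real_0)
  qed
  have right2: "h2 t = 0" if "t > hi" for t
  proof -
    have "(\<Sum>j\<in>J. c j * (if a j < t then 1 else 0)) = (\<Sum>j\<in>J. c j)"
      using a that by (intro sum.cong) fastforce+
    then show ?thesis by (simp only: h2_def m0 of_real_0)
  qed
  have out: "h t = 0" "h2 t = 0" if "t \<notin> {lo..hi}" for t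
    using that left[of t] right[of t] right2[of t] by (auto simp: not_le)
  have out1: "h1 t = 0" if "t \<notin> {lo..hi}" for t
    using that left[of t] right[of t] by (auto simp: not_le)
  have ends: "h lo = 0" "h hi = 0" "h1 lo = 0" "h1 hi = 0"
    using left[of lo] right[of hi] by auto
  have sq: "((\<lambda>t. (max 0 t)\<^sup>2 / 2) has_real_derivative max 0 t) (at t)" for t :: real
  proof -
    consider "t < 0" | "t = 0" | "t > 0" by linarith
    then show ?thesis
    proof cases
      case 1
      have "((\<lambda>t::real. 0) has_real_derivative 0) (at t)" by simp
      then have "((\<lambda>t::real. (max 0 t)\<^sup>2 / 2) has_real_derivative 0) (at t)"
        by (rule has_field_derivative_transform_within_open[of _ _ _ "{..<0}"]) (use 1 in auto)
      then show ?thesis using 1 by simp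
    next
      case 2
      have "((\<lambda>h. (max 0 h)\<^sup>2 / 2 / h) \<longlongrightarrow> 0) (at (0::real))"
      proof (rule Lim_null_comparison)
        show "\<forall>\<^sub>F h in at (0::real). norm ((max 0 h)\<^sup>2 / 2 / h) \<le> \<bar>h\<bar>"
          by (intro always_eventually allI) (auto simp: max_def power2_eq_square)
        show "((\<lambda>h. \<bar>h\<bar>) \<longlongrightarrow> 0) (at (0::real))" by (intro tendsto_eq_intros) auto
      qed
      then show ?thesis unfolding 2 DERIV_def by simp
    next
      case 3
      have "((\<lambda>t::real. t\<^sup>2 / 2) has_real_derivative t) (at t)"
        by (auto intro!: derivative_eq_intros)
      then have "((\<lambda>t::real. (max 0 t)\<^sup>2 / 2) has_real_derivative t) (at t)"
        by (rule has_field_derivative_transform_within_open[of _ _ _ "{0<..}"]) (use 3 in auto)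
      then show ?thesis using 3 by simp
    qed
  qed
  have mx: "((\<lambda>t. max 0 t) has_real_derivative (if 0 < t then 1 else 0)) (at t)" if "t \<noteq> 0" for t :: real
  proof (cases "t < 0")
    case True
    have "((\<lambda>t::real. 0) has_real_derivative 0) (at t)" by simp
    then have "((\<lambda>t::real. max 0 t) has_real_derivative 0) (at t)"
      by (rule has_field_derivative_transform_within_open[of _ _ _ "{..<0}"]) (use True in auto)
    then show ?thesis using True by simp
  next
    case False
    have "((\<lambda>t::real. t) has_real_derivative 1) (at t)" by simp
    then have "((\<lambda>t::real. max 0 t) has_real_derivative 1) (at t)"
      by (rule has_field_derivative_transform_within_open[of _ _ _ "{0<..}"]) (use False that in auto)
    then show ?thesis using False that by simp
  qed
  have shift: "((\<lambda>t. t - a j) has_real_derivative 1) (at t)" for j t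
    by (auto intro!: derivative_eq_intros)
  have d: "((\<lambda>t. (max 0 (t - a j))\<^sup>2 / 2) has_real_derivative max 0 (t - a j)) (at t)" for j t
    using DERIV_chain2[OF sq shift] by simp
  have dm: "((\<lambda>t. max 0 (t - a j)) has_real_derivative (if a j < t then 1 else 0)) (at t)" if "t \<noteq> a j" for j t
    using DERIV_chain2[OF mx[of "t - a j"] shift] that by simp
  have dh: "(h has_vector_derivative h1 t) (at t)" for t
    unfolding h_def[abs_def] h1_def
    by (intro has_vector_derivative_of_real DERIV_sum DERIV_cmult d)
  have dh1: "(h1 has_vector_derivative h2 t) (at t)" if "t \<notin> a ` J" for t
    unfolding h1_def[abs_def] h2_def using that
    by (intro has_vector_derivative_of_real DERIV_sum DERIV_cmult dm) auto
  have h1c: "continuous_on UNIV h1"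
    unfolding h1_def[abs_def] by (intro continuous_intros)
  have hc: "continuous_on UNIV h"
    unfolding h_def[abs_def] by (intro continuous_intros) auto
  have sq_h: "square_integrable h"
    by (rule square_integrable_continuous_bounded_support[OF hc out(1)])
  have int_h2: "(h2 has_integral (h1 t - h1 s)) {s..t}" if "s \<le> t" for s t
    by (rule fundamental_theorem_of_calculus_strong[of "a ` J"])
      (use J dh1 that in \<open>auto intro: has_vector_derivative_at_within continuous_on_subset[OF h1c]\<close>)
  have h2m: "h2 \<in> borel_measurable lebesgue"
  proof -
    have "h2 \<in> borel_measurable lborel" unfolding h2_def[abs_def] by measurable
    then show ?thesis by (rule measurable_completion)
  qed
  have h2: "square_integrable h2"
  proof (rule square_integrable_bounded_support[OF h2m out(2)])
    show "cmod (h2 t) \<le> (\<Sum>j\<in>J. \<bar>c j\<bar>)" for t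
      unfolding h2_def norm_of_real by (rule order_trans[OF sum_abs]) (auto intro!: sum_mono)
  qed
  have der: "derivative h = h1"
    using dh by (auto intro!: vector_derivative_at)
  have der2: "derivative (derivative h) t = h2 t" if "t \<notin> a ` J" for t
    unfolding der using dh1[OF that] by (rule vector_derivative_at)
  have eq: "L2_eq h2 (derivative (derivative h))"
    using der2 J by (intro L2_eq_countable_difference[OF h2, of "a ` J"]) (auto intro: countable_finite)
  have "h \<in> sobolev22 X"
    unfolding sobolev22_def
  proof (intro CollectI conjI)
    show "square_integrable h" by (rule sq_h)
    show "h \<in> AC_loc (- X)"
      unfolding AC_loc_def
      by (auto intro!: absolutely_continuous_of_derivative dh continuous_on_subset[OF h1c])
    \<comment> \<open>At the knots \<open>h1\<close> has no derivative, so absolute continuity comes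
      from a Lipschitz bound.\<close>
    have "cmod (h1 t - h1 s) \<le> (\<Sum>j\<in>J. \<bar>c j\<bar>) * (t - s)" if "s \<le> t" for s t
    proof -
      have "h1 t - h1 s = of_real (\<Sum>j\<in>J. c j * (max 0 (t - a j) - max 0 (s - a j)))"
        by (simp add: h1_def right_diff_distrib sum_subtractf)
      then have "cmod (h1 t - h1 s) \<le> (\<Sum>j\<in>J. \<bar>c j * (max 0 (t - a j) - max 0 (s - a j))\<bar>)"
        by (simp only: norm_of_real sum_abs)
      also have "\<dots> \<le> (\<Sum>j\<in>J. \<bar>c j\<bar> * (t - s))"
        unfolding abs_mult using that by (intro sum_mono mult_left_mono) auto
      finally show ?thesis by (simp add: sum_distrib_right)
    qed
    then show "derivative h \<in> AC_loc (- X)"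
      unfolding der AC_loc_def by (auto intro!: lipschitz_absolutely_continuous)
    show "square_integrable (derivative (derivative h))"
      using eq by (simp add: L2_eq_def)
  qed
  \<comment> \<open>The support avoids X and is closed, so h vanishes near every node and all
    one-sided limits are 0, whatever the strengths are.\<close>
  moreover have "interface_conditions x \<alpha> h"
    unfolding interface_conditions_def
  proof (intro allI impI exI[of _ 0] conjI)
    fix k :: nat assume "k \<ge> 1"
    then have "x k \<in> - {lo..hi}" using X by auto
    then have "eventually (\<lambda>t. t \<in> - {lo..hi}) (at (x k))"
      by (intro eventually_at_in_open') auto
    then have ev: "eventually (\<lambda>t. h t = 0) (at (x k))" "eventually (\<lambda>t. derivative h t = 0) (at (x k))"
      by (auto elim!: eventually_mono simp: fun_cong[OF der] out out1)
    show "(h \<longlongrightarrow> 0) (at_right (x k))" "(h \<longlongrightarrow> 0) (at_left (x k))"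
      "(derivative h \<longlongrightarrow> 0) (at_right (x k))" "(derivative h \<longlongrightarrow> 0) (at_left (x k))"
      using ev by (auto intro!: tendsto_eventually simp: eventually_at_split)
  qed simp
  ultimately have "(abs_L2 h, abs_L2 (\<lambda>t. - derivative (derivative h) t)) \<in> delta_operator x \<alpha>"
    by (auto simp: delta_operator_def)
  moreover have "abs_L2 (\<lambda>t. - derivative (derivative h) t) = abs_L2 (\<lambda>t. - h2 t)"
  proof -
    have "L2_eq (\<lambda>t. - h2 t) (\<lambda>t. - derivative (derivative h) t)"
      using square_integrable_scale[OF h2, of "- 1"] der2 J
      by (intro L2_eq_countable_difference[of _ "a ` J"]) (auto intro: countable_finite)
    then show ?thesis by (simp add: L2_eq_def abs_L2_eq_iff AE_symmetric)
  qed
  ultimately have graph: "(abs_L2 h, abs_L2 (\<lambda>t. - h2 t)) \<in> delta_operator x \<alpha>" by simp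
  have h2_eq: "h2 t = (\<Sum>j\<in>J. of_real (c j) * (if a j < t then 1 else 0))" for t
    unfolding h2_def of_real_sum by (intro sum.cong) auto
  show thesis
    by (rule that[OF h2_eq sq_h h2 _ _ graph out dh h1c int_h2 ends]) (assumption | simp only: h_def h2_def complex_cnj_complex_of_real)+
qed

text \<open>Symmetry says that g tested with h equals f tested with \<open>- h2\<close>. With Q a
  second primitive of g, two integrations by parts make \<open>f + Q\<close> orthogonal to
  \<open>h2\<close>. As \<open>h2\<close> is a step function, this is a linear relation between the
  values of a primitive of \<open>f + Q\<close> at the knots; the zeroth moment cancels the value at
  \<open>hi\<close>.\<close>

lemma weak_second_derivative:
  fixes a c :: "'j \<Rightarrow> real"
  assumes sym: "\<And>h k. (h, k) \<in> delta_operator x \<alpha> \<Longrightarrow> cinner (abs_L2 g) h = cinner (abs_L2 f) k"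
    and f: "square_integrable f" "continuous_on UNIV f" and g: "square_integrable g"
    and J: "finite J" and a: "\<And>j. j \<in> J \<Longrightarrow> a j \<in> {lo..hi}" and X: "{lo..hi} \<inter> X = {}" and le: "lo \<le> hi"
    and m0: "(\<Sum>j\<in>J. c j) = 0" and m1: "(\<Sum>j\<in>J. c j * a j) = 0" and m2: "(\<Sum>j\<in>J. c j * (a j)\<^sup>2) = 0"
  shows "(\<Sum>j\<in>J. of_real (c j) * primitive (\<lambda>t. f t + primitive (primitive g) t) (a j)) = 0"
proof -
  obtain h h1 h2 :: "real \<Rightarrow> complex" where
    h2_eq: "\<And>t. h2 t = (\<Sum>j\<in>J. of_real (c j) * (if a j < t then 1 else 0))"
    and sq: "square_integrable h" "square_integrable h2"
    and re: "\<And>t. cnj (h t) = h t" "\<And>t. cnj (h2 t) = h2 t"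
    and graph: "(abs_L2 h, abs_L2 (\<lambda>t. - h2 t)) \<in> delta_operator x \<alpha>"
    and out: "\<And>t. t \<notin> {lo..hi} \<Longrightarrow> h t = 0" "\<And>t. t \<notin> {lo..hi} \<Longrightarrow> h2 t = 0"
    and dh: "\<And>t. (h has_vector_derivative h1 t) (at t)" and h1c: "continuous_on UNIV h1"
    and int_h2: "\<And>s t. s \<le> t \<Longrightarrow> (h2 has_integral (h1 t - h1 s)) {s..t}"
    and ends: "h lo = 0" "h hi = 0" "h1 lo = 0" "h1 hi = 0"
    by (rule spline_test_function[OF J a X m0 m1 m2, where \<alpha> = \<alpha>]; (assumption | rule that))
  define P Q where "P = primitive g" and "Q = primitive P"
  define w where "w t = f t + Q t" for t
  have g_ai: "g absolutely_integrable_on {s..t}" and h2_ai: "h2 absolutely_integrable_on {s..t}" for s t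
    using square_integrable_absolutely_integrable g sq by auto
  note gi = square_integrable_integrable_on(1)[OF g]
  have Pc: "continuous_on UNIV P" and Qc: "continuous_on UNIV Q"
    unfolding Q_def P_def by (rule continuous_primitive_square_integrable[OF g])+
  have wc: "continuous_on UNIV w"
    unfolding w_def[abs_def] using f(2) Qc by (intro continuous_intros)
  then have wi: "w integrable_on {s..t}" for s t
    by (intro integrable_continuous_real continuous_on_subset[OF wc]) simp
  have sq': "square_integrable (\<lambda>t. - h2 t)" using square_integrable_scale[OF sq(2), of "- 1"] by simp
  have "(LINT t|lebesgue. g t * cnj (h t)) = (LINT t|lebesgue. f t * cnj (- h2 t))"
    using sym[OF graph] by (simp only: cinner_abs_L2[OF g sq(1)] cinner_abs_L2[OF f(1) sq'])
  also have "(LINT t|lebesgue. g t * cnj (h t)) = integral {lo..hi} (\<lambda>t. g t * cnj (h t))"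
    by (rule lebesgue_integral_eq_integral_on[OF integrable_mult_cnj[OF g sq(1)]]) (use out in auto)
  also have "(LINT t|lebesgue. f t * cnj (- h2 t)) = integral {lo..hi} (\<lambda>t. f t * cnj (- h2 t))"
    by (rule lebesgue_integral_eq_integral_on[OF integrable_mult_cnj[OF f(1) sq']]) (use out in auto)
  finally have 1: "integral {lo..hi} (\<lambda>t. g t * h t) = - integral {lo..hi} (\<lambda>t. f t * h2 t)"
    by (simp add: re)
  have 2: "integral {lo..hi} (\<lambda>t. g t * h t) = - integral {lo..hi} (\<lambda>t. P t * h1 t)"
  proof -
    have "integral {lo..hi} (\<lambda>t. g t * h t) = P hi * h hi - P lo * h lo - integral {lo..hi} (\<lambda>t. P t * h1 t)"
    proof (rule integral_by_parts_indefinite[OF le g_ai])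
      show "P t - P s = integral {s..t} g" if "s \<le> t" for s t
        unfolding P_def by (rule primitive_diff[OF gi that])
      show "(h has_vector_derivative h1 t) (at t within {lo..hi})" for t
        by (rule has_vector_derivative_at_within[OF dh])
      show "continuous_on {lo..hi} h1" using h1c by (rule continuous_on_subset) simp
    qed
    then show ?thesis using ends by simp
  qed
  have 3: "integral {lo..hi} (\<lambda>t. h2 t * Q t) = - integral {lo..hi} (\<lambda>t. P t * h1 t)"
  proof -
    have "integral {lo..hi} (\<lambda>t. h2 t * Q t) = h1 hi * Q hi - h1 lo * Q lo - integral {lo..hi} (\<lambda>t. h1 t * P t)"
    proof (rule integral_by_parts_indefinite[OF le h2_ai])
      show "h1 t - h1 s = integral {s..t} h2" if "s \<le> t" for s t
        using int_h2[OF that] by (simp add: integral_unique)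
      show "(Q has_vector_derivative P t) (at t within {lo..hi})" for t
        unfolding Q_def by (rule has_vector_derivative_at_within[OF primitive_has_vector_derivative[OF Pc]])
      show "continuous_on {lo..hi} P" using Pc by (rule continuous_on_subset) simp
    qed
    moreover have "(\<lambda>t. h1 t * P t) = (\<lambda>t. P t * h1 t)" by (simp add: fun_eq_iff mult.commute)
    ultimately show ?thesis using ends by simp
  qed
  have ii: "(\<lambda>t. h2 t * k t) integrable_on {lo..hi}" if "continuous_on UNIV k" for k
    using absolutely_integrable_mult_continuous(1)[OF h2_ai continuous_on_subset[OF that subset_UNIV]]
    by (rule set_lebesgue_integral_eq_integral(1))
  have "integral {lo..hi} (\<lambda>t. h2 t * w t) = integral {lo..hi} (\<lambda>t. h2 t * f t) + integral {lo..hi} (\<lambda>t. h2 t * Q t)"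
    unfolding w_def distrib_left using ii[OF f(2)] ii[OF Qc]
    by (rule Henstock_Kurzweil_Integration.integral_add)
  also have "(\<lambda>t. h2 t * f t) = (\<lambda>t. f t * h2 t)" by (simp add: fun_eq_iff mult.commute)
  also have "integral {lo..hi} (\<lambda>t. f t * h2 t) + integral {lo..hi} (\<lambda>t. h2 t * Q t) = 0"
    unfolding 3 using trans[OF 1[symmetric] 2] by simp
  finally have 4: "integral {lo..hi} (\<lambda>t. h2 t * w t) = 0" .
  have hj: "((\<lambda>t. (if a j < t then 1 else 0) * w t) has_integral (primitive w hi - primitive w (a j))) {lo..hi}"
    if "j \<in> J" for j
  proof -
    have aj: "lo \<le> a j" "a j \<le> hi" using a[OF that] by auto
    have "((\<lambda>t. (if a j < t then 1 else 0) * w t) has_integral 0) {lo..a j}"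
      by (rule has_integral_eq[OF _ has_integral_0]) auto
    moreover have "((\<lambda>t. (if a j < t then 1 else 0) * w t) has_integral (primitive w hi - primitive w (a j))) {a j..hi}"
      unfolding primitive_diff[OF wi aj(2)]
      by (rule has_integral_spike_finite[of "{a j}", OF _ _ integrable_integral[OF wi]]) auto
    ultimately have "((\<lambda>t. (if a j < t then 1 else 0) * w t) has_integral (0 + (primitive w hi - primitive w (a j)))) {lo..hi}"
      by (rule has_integral_combine[OF aj])
    then show ?thesis by simp
  qed
  have "((\<lambda>t. \<Sum>j\<in>J. of_real (c j) * ((if a j < t then 1 else 0) * w t)) has_integral
      (\<Sum>j\<in>J. of_real (c j) * (primitive w hi - primitive w (a j)))) {lo..hi}"
    using J hj by (intro has_integral_sum has_integral_mult_right) auto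
  moreover have "(\<lambda>t. \<Sum>j\<in>J. of_real (c j) * ((if a j < t then 1 else 0) * w t)) = (\<lambda>t. h2 t * w t)"
    unfolding h2_eq sum_distrib_right mult.assoc ..
  ultimately have "(\<Sum>j\<in>J. of_real (c j) * (primitive w hi - primitive w (a j))) = 0"
    unfolding 4[symmetric] by (simp only: integral_unique)
  moreover have "(\<Sum>j\<in>J. of_real (c j) * (primitive w hi - primitive w (a j)))
      = of_real (\<Sum>j\<in>J. c j) * primitive w hi - (\<Sum>j\<in>J. of_real (c j) * primitive w (a j))"
    unfolding right_diff_distrib sum_subtractf of_real_sum sum_distrib_right ..
  ultimately have "(\<Sum>j\<in>J. of_real (c j) * primitive w (a j)) = 0"
    unfolding m0 by simp
  then show ?thesis
    unfolding w_def[abs_def] Q_def P_def .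
qed

text \<open>Four-point splines show that a primitive agrees with its quadratic Lagrange interpolant, so no
  limit of test functions is needed.\<close>

lemma affine_on_open_piece:
  assumes sym: "\<And>h k. (h, k) \<in> delta_operator x \<alpha> \<Longrightarrow> cinner (abs_L2 g) h = cinner (abs_L2 f) k"
    and f: "square_integrable f" "continuous_on UNIV f" and g: "square_integrable g"
  obtains A B where "\<And>t. t \<in> open_piece k \<Longrightarrow> f t + primitive (primitive g) t = A + of_real t * B"
proof -
  define w where "w t = f t + primitive (primitive g) t" for t
  define W where "W = primitive w"
  have wc: "continuous_on UNIV w"
    unfolding w_def[abs_def] using f(2) continuous_primitive_square_integrable[OF g] by (intro continuous_intros)
  have "open_piece k \<noteq> {}"
    using closure_open_piece[of k] x_in_piece(3)[of k] by auto
  then obtain s where s: "s \<in> open_piece k" by blast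
  then obtain \<eta> where \<eta>: "\<eta> > 0" "cball s \<eta> \<subseteq> open_piece k"
    using open_open_piece open_contains_cball by blast
  define W0 Wp Wm where "W0 = W s" and "Wp = W (s + \<eta>)" and "Wm = W (s - \<eta>)"
  define p q where "p = (Wp - Wm) / 2" and "q = (Wp + Wm - 2 * W0) / 2"
  have W: "W t = W0 + of_real ((t - s) / \<eta>) * p + of_real (((t - s) / \<eta>)\<^sup>2) * q"
    if t: "t \<in> open_piece k" for t
  proof -
    define \<tau> where "\<tau> = (t - s) / \<eta>"
    have ts: "t = s + \<tau> * \<eta>" using \<eta> by (simp add: \<tau>_def)
    define a where "a j = (if j = 0 then s - \<eta> else if j = 1 then s else if j = 2 then s + \<eta> else t)" for j :: nat
    \<comment> \<open>Minus the Lagrange polynomials of the nodes -1, 0, 1 at \<tau>, and 1 for the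
      fourth knot. Interpolation reproduces quadratics, which is the vanishing of the three moments.
      Since knots are indexed, t may coincide with one of the other three.\<close>
    define c where "c j = (if j = 0 then - (\<tau> * (\<tau> - 1) / 2) else if j = 1 then \<tau>\<^sup>2 - 1
      else if j = 2 then - (\<tau> * (\<tau> + 1) / 2) else 1)" for j :: nat
    let ?lo = "min t (s - \<eta>)" and ?hi = "max t (s + \<eta>)"
    have J: "(\<Sum>j<4. F j) = F 0 + F 1 + F 2 + F 3" for F :: "nat \<Rightarrow> 'b::comm_monoid_add"
      by (simp add: eval_nat_numeral add.assoc)
    have "?lo \<in> open_piece k" "?hi \<in> open_piece k"
      using t \<eta> by (auto simp: min_def max_def cball_def dist_real_def)
    then have sub: "{?lo..?hi} \<inter> X = {}"
      using open_piece_interval[of ?lo k ?hi] open_piece_Int_X[of k] by blast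
    have "(\<Sum>j<4. of_real (c j) * primitive (\<lambda>t. f t + primitive (primitive g) t) (a j)) = (0 :: complex)"
    proof (rule weak_second_derivative[OF sym f g _ _ sub])
      show "a j \<in> {?lo..?hi}" for j using \<eta> by (auto simp: a_def)
      show "(\<Sum>j<4. c j) = 0" "(\<Sum>j<4. c j * a j) = 0" "(\<Sum>j<4. c j * (a j)\<^sup>2) = 0"
        unfolding J by (simp_all add: a_def c_def ts power2_eq_square field_simps)
    qed (use \<eta> in auto)
    then have "of_real (c 0) * Wm + of_real (c 1) * W0 + of_real (c 2) * Wp + W t = 0"
      unfolding J by (simp add: a_def c_def W_def w_def[abs_def] W0_def Wp_def Wm_def)
    then have "W t = - (of_real (c 0) * Wm) - of_real (c 1) * W0 - of_real (c 2) * Wp"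
      by (simp add: eq_neg_iff_add_eq_0 algebra_simps)
    then show ?thesis
      unfolding \<tau>_def[symmetric] by (simp add: c_def p_def q_def power2_eq_square field_simps)
  qed
  \<comment> \<open>Since W is quadratic on the piece, its derivative w is affine there.\<close>
  have deriv: "w t = of_real (1 / \<eta>) * p + of_real (2 * (t - s) / \<eta>\<^sup>2) * q"
    if t: "t \<in> open_piece k" for t
  proof -
    let ?p = "\<lambda>t. W0 + of_real ((t - s) / \<eta>) * p + of_real (((t - s) / \<eta>)\<^sup>2) * q"
    have "((\<lambda>t. complex_of_real ((t - s) / \<eta>)) has_vector_derivative of_real (1 / \<eta>)) (at t)"
      by (intro has_vector_derivative_of_real)
        (auto intro!: derivative_eq_intros simp: less_imp_neq[OF \<eta>(1), symmetric])
    moreover have "((\<lambda>t. complex_of_real (((t - s) / \<eta>)\<^sup>2)) has_vector_derivative of_real (2 * (t - s) / \<eta>\<^sup>2)) (at t)"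
      using \<eta>(1) by (intro has_vector_derivative_of_real)
        (auto intro!: derivative_eq_intros simp: power2_eq_square field_simps less_imp_neq[OF \<eta>(1), symmetric])
    ultimately have "(?p has_vector_derivative (0 + of_real (1 / \<eta>) * p + of_real (2 * (t - s) / \<eta>\<^sup>2) * q)) (at t)"
      by (intro has_vector_derivative_add has_vector_derivative_mult_left has_vector_derivative_const)
    then have "(W has_vector_derivative (0 + of_real (1 / \<eta>) * p + of_real (2 * (t - s) / \<eta>\<^sup>2) * q)) (at t)"
      by (rule has_vector_derivative_transform_within_open[OF _ open_open_piece t]) (simp add: W)
    moreover have "(W has_vector_derivative w t) (at t)"
      unfolding W_def by (rule primitive_has_vector_derivative[OF wc])
    ultimately show ?thesis
      using vector_derivative_unique_at by fastforce
  qed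
  show thesis
  proof (rule that)
    fix t assume "t \<in> open_piece k"
    then have "w t = of_real (1 / \<eta>) * p + of_real (2 * (t - s) / \<eta>\<^sup>2) * q"
      by (rule deriv)
    also have "\<dots> = (of_real (1 / \<eta>) * p - of_real (2 * s / \<eta>\<^sup>2) * q)
        + of_real t * (of_real (2 / \<eta>\<^sup>2) * q)"
    proof -
      have e: "2 * (t - s) / \<eta>\<^sup>2 = t * (2 / \<eta>\<^sup>2) - 2 * s / \<eta>\<^sup>2"
        by (simp add: diff_divide_distrib right_diff_distrib)
      show ?thesis unfolding e of_real_diff of_real_mult left_diff_distrib mult.assoc by simp
    qed
    finally show "f t + primitive (primitive g) t = (of_real (1 / \<eta>) * p - of_real (2 * s / \<eta>\<^sup>2) * q)
        + of_real t * (of_real (2 / \<eta>\<^sup>2) * q)"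
      by (simp add: w_def)
  qed
qed

end

text \<open>The usable form of a domain element: f is the continuous representative, and its
  derivative, which jumps on X, is replaced by one continuous function \<open>D k\<close> per piece.
  The relation between \<open>D k\<close> and g is kept in integrated form, so g need not be
  continuous.\<close>

locale regular_function = separated_points +
  fixes \<alpha> :: "nat \<Rightarrow> real" and f g :: "real \<Rightarrow> complex" and D :: "nat \<Rightarrow> real \<Rightarrow> complex"
  assumes f_sq: "square_integrable f" and g_sq: "square_integrable g" and f_cont: "continuous_on UNIV f"
    and f_deriv: "\<And>k t. t \<in> piece k \<Longrightarrow> (f has_vector_derivative D k t) (at t within piece k)"
    and D_cont: "\<And>k. continuous_on UNIV (D k)"
    and D_diff: "\<And>k s t. s \<le> t \<Longrightarrow> D k t - D k s = - integral {s..t} g"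
    and D_jump: "\<And>k. k \<ge> 1 \<Longrightarrow> D k (x k) - D (k - 1) (x k) = of_real (\<alpha> k) * f (x k)"

context separated_points
begin

text \<open>On every piece f is an affine function minus the second primitive of g. This yields
  derivatives up to the nodes, and the limits in the interface conditions become values of
  \<open>D k\<close> and \<open>D (k - 1)\<close>.\<close>

lemma delta_operator_structure:
  assumes sym: "\<And>u' v'. (u', v') \<in> delta_operator x \<alpha> \<Longrightarrow> cinner v u' = cinner u v'"
    and uv: "(u, v) \<in> delta_operator x \<alpha>"
  obtains f g D where "u = abs_L2 f" "v = abs_L2 g" "regular_function x d \<alpha> f g D"
proof -
  obtain f0 where f0: "u = abs_L2 f0" "v = abs_L2 (\<lambda>t. - derivative (derivative f0) t)"
    "f0 \<in> sobolev22 X" "interface_conditions x \<alpha> f0"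
    using uv by (auto simp: delta_operator_def)
  define g where "g t = - derivative (derivative f0) t" for t
  have sq: "square_integrable f0" "square_integrable g" and AC: "f0 \<in> AC_loc (- X)"
    using f0(3) square_integrable_scale[of "derivative (derivative f0)" "- 1"]
    by (auto simp: sobolev22_def g_def[abs_def])
  obtain V p m where V: "\<And>k. k \<ge> 1 \<Longrightarrow> (f0 \<longlongrightarrow> V k) (at_right (x k))" "\<And>k. k \<ge> 1 \<Longrightarrow> (f0 \<longlongrightarrow> V k) (at_left (x k))"
    and pm: "\<And>k. k \<ge> 1 \<Longrightarrow> (derivative f0 \<longlongrightarrow> p k) (at_right (x k))"
      "\<And>k. k \<ge> 1 \<Longrightarrow> (derivative f0 \<longlongrightarrow> m k) (at_left (x k))"
      "\<And>k. k \<ge> 1 \<Longrightarrow> p k - m k = of_real (\<alpha> k) * V k"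
  proof -
    have "\<forall>k. \<exists>w. k \<ge> 1 \<longrightarrow> (f0 \<longlongrightarrow> fst w) (at_right (x k)) \<and> (f0 \<longlongrightarrow> fst w) (at_left (x k)) \<and>
        (derivative f0 \<longlongrightarrow> fst (snd w)) (at_right (x k)) \<and> (derivative f0 \<longlongrightarrow> snd (snd w)) (at_left (x k)) \<and>
        fst (snd w) - snd (snd w) = of_real (\<alpha> k) * fst w"
      using f0(4) unfolding interface_conditions_def by (metis fst_conv snd_conv)
    then obtain w where "\<And>k. k \<ge> 1 \<Longrightarrow> (f0 \<longlongrightarrow> fst (w k)) (at_right (x k)) \<and> (f0 \<longlongrightarrow> fst (w k)) (at_left (x k)) \<and>
        (derivative f0 \<longlongrightarrow> fst (snd (w k))) (at_right (x k)) \<and> (derivative f0 \<longlongrightarrow> snd (snd (w k))) (at_left (x k)) \<and>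
        fst (snd (w k)) - snd (snd (w k)) = of_real (\<alpha> k) * fst (w k)"
      by metis
    then show thesis
      by (intro that[of "\<lambda>k. fst (w k)" "\<lambda>k. fst (snd (w k))" "\<lambda>k. snd (snd (w k))"]) auto
  qed
  \<comment> \<open>The values of \<open>f0\<close> on X are arbitrary; they are replaced by the
    common one-sided limits, which makes f continuous.\<close>
  define f where "f t = (if t \<in> X then Lim (at_right t) f0 else f0 t)" for t
  have f_x: "f (x k) = V k" if "k \<ge> 1" for k
    using V(1)[OF that] that by (auto simp: f_def tendsto_Lim)
  have f_open: "f t = f0 t" if "t \<in> open_piece k" for t k
    using that open_piece_Int_X[of k] by (auto simp: f_def)
  have f0c: "continuous_on (open_piece k) f0" for k
  proof (rule continuous_at_imp_continuous_on, rule ballI)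
    fix t assume t: "t \<in> open_piece k"
    then obtain e where e: "e > 0" "cball t e \<subseteq> open_piece k"
      using open_open_piece open_contains_cball by blast
    have eq: "cball t e = {t - e..t + e}" by (auto simp: cball_def dist_real_def)
    then have "{t - e..t + e} \<subseteq> - X" using e open_piece_Int_X[of k] by blast
    then have "continuous_on {t - e..t + e} f0"
      using AC by (intro absolutely_continuous_imp_continuous) (auto simp: AC_loc_def)
    then show "isCont f0 t" by (rule continuous_on_interior) (use e in auto)
  qed
  have fc: "continuous_on UNIV f"
  proof (rule continuous_at_imp_continuous_on, rule ballI)
    fix t
    show "isCont f t"
    proof (cases "t \<in> X")
      case False
      then obtain k where k: "t \<in> open_piece k" using ex_open_piece by blast
      have "continuous_on (open_piece k) f"
        by (rule continuous_on_eq[OF f0c]) (simp add: f_open)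
      then show ?thesis using k open_open_piece continuous_on_eq_continuous_at by blast
    next
      case True
      then obtain k where k: "k \<ge> 1" "t = x k" by auto
      have "(f \<longlongrightarrow> V k) (at_right (x k))"
        by (rule Lim_transform_eventually[OF V(1)[OF k(1)]])
          (use eventually_open_piece(1)[OF k(1)] in \<open>auto elim!: eventually_mono simp: f_open\<close>)
      moreover have "(f \<longlongrightarrow> V k) (at_left (x k))"
        by (rule Lim_transform_eventually[OF V(2)[OF k(1)]])
          (use eventually_open_piece(2)[OF k(1)] in \<open>auto elim!: eventually_mono simp: f_open\<close>)
      ultimately show ?thesis
        unfolding isCont_def k(2) f_x[OF k(1)] by (rule filterlim_split_at_real[rotated])
    qed
  qed
  have eq: "L2_eq f0 f"
    by (rule L2_eq_countable_difference[OF sq(1), of X]) (auto simp: f_def)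
  then have sqf: "square_integrable f" and u: "u = abs_L2 f"
    using f0(1) by (auto simp: L2_eq_def abs_L2_eq_iff)
  have v: "v = abs_L2 g" using f0(2) by (simp add: g_def[abs_def])
  note gi = square_integrable_integrable_on(1)[OF sq(2)]
  note Pc = continuous_primitive_square_integrable(1)[OF sq(2)] and Qc = continuous_primitive_square_integrable(2)[OF sq(2)]
  have "\<exists>A B. \<forall>t\<in>open_piece k. f t + primitive (primitive g) t = A + of_real t * B" for k
    using affine_on_open_piece[OF sym[unfolded u v] sqf fc sq(2), where k = k] by metis
  then obtain A B where AB: "\<And>k t. t \<in> open_piece k \<Longrightarrow> f t + primitive (primitive g) t = A k + of_real t * B k"
    by metis
  define D where "D k t = B k - primitive g t" for k t
  \<comment> \<open>Both sides are continuous, so the identity extends from the open piece to its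
    closure, in particular to the nodes.\<close>
  have piece_eq: "f t = A k + of_real t * B k - primitive (primitive g) t" if "t \<in> piece k" for k t
  proof -
    have "closed {t. f t = A k + of_real t * B k - primitive (primitive g) t}"
      using fc Qc by (intro closed_Collect_eq continuous_intros)
    moreover have "open_piece k \<subseteq> {t. f t = A k + of_real t * B k - primitive (primitive g) t}"
      using AB by (auto simp: eq_diff_eq)
    ultimately have "closure (open_piece k) \<subseteq> {t. f t = A k + of_real t * B k - primitive (primitive g) t}"
      by (rule closure_minimal[rotated])
    then show ?thesis using that closure_open_piece[of k] by blast
  qed
  have deriv: "((\<lambda>t. A k + of_real t * B k - primitive (primitive g) t) has_vector_derivative D k t) (at t within S)" for k t S
  proof -
    have "((\<lambda>t. A k + of_real t * B k - primitive (primitive g) t) has_vector_derivative (0 + 1 * B k - primitive g t)) (at t within S)"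
      by (intro has_vector_derivative_add has_vector_derivative_diff has_vector_derivative_const
          has_vector_derivative_mult_left has_vector_derivative_at_within[OF primitive_has_vector_derivative[OF Pc]])
        (auto intro!: derivative_eq_intros simp: has_vector_derivative_def scaleR_conv_of_real)
    then show ?thesis by (simp add: D_def)
  qed
  have fD: "(f has_vector_derivative D k t) (at t within piece k)" if "t \<in> piece k" for k t
    by (rule has_vector_derivative_transform[OF that piece_eq deriv])
  have Dc: "continuous_on UNIV (D k)" for k
    unfolding D_def[abs_def] using Pc by (intro continuous_intros)
  have D_diff: "D k t - D k s = - integral {s..t} g" if "s \<le> t" for k s t
    using primitive_diff[OF gi that] by (simp add: D_def algebra_simps)
  have der0: "derivative f0 t = D k t" if "t \<in> open_piece k" for k t
  proof -
    have "(f0 has_vector_derivative D k t) (at t)"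
      by (rule has_vector_derivative_transform_within_open[OF deriv open_open_piece that])
        (use f_open piece_eq open_piece_subset in \<open>metis subsetD\<close>)
    then show ?thesis by (rule vector_derivative_at)
  qed
  have jump: "D k (x k) - D (k - 1) (x k) = of_real (\<alpha> k) * f (x k)" if k: "k \<ge> 1" for k
  proof -
    have lim: "(D j \<longlongrightarrow> D j (x k)) (at (x k) within S)" for j S
      using Dc[of j] by (auto simp: continuous_on_def intro: tendsto_within_subset)
    have "(D k \<longlongrightarrow> p k) (at_right (x k))"
      by (rule Lim_transform_eventually[OF pm(1)[OF k]])
        (use eventually_open_piece(1)[OF k] in \<open>auto elim!: eventually_mono simp: der0\<close>)
    then have "p k = D k (x k)"
      by (rule tendsto_unique[OF trivial_limit_at_right_real _ lim])
    moreover have "(D (k - 1) \<longlongrightarrow> m k) (at_left (x k))"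
      by (rule Lim_transform_eventually[OF pm(2)[OF k]])
        (use eventually_open_piece(2)[OF k] in \<open>auto elim!: eventually_mono simp: der0\<close>)
    then have "m k = D (k - 1) (x k)"
      by (rule tendsto_unique[OF trivial_limit_at_left_real _ lim])
    ultimately show ?thesis using pm(3)[OF k] f_x[OF k] by simp
  qed
  show thesis
    by (rule that[OF u v]) (unfold_locales; fact sqf sq(2) fc fD Dc D_diff jump)
qed

end

section \<open>The energy inequality\<close>

text \<open>The squared norm over a window that moves off to infinity vanishes by dominated
  convergence. The inequality z \<le> \<eta> + z^2 / \<eta> passes from squares to first powers,
  since the length of the window stays fixed.\<close>

lemma square_integrable_tail:
  assumes k: "square_integrable k" and s: "filterlim s at_top sequentially \<or> filterlim s at_bot sequentially"
    and d: "d > 0"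
  shows "(\<lambda>n. integral {s n - d..s n} (\<lambda>t. cmod (k t))) \<longlonglongrightarrow> 0"
proof -
  have [measurable]: "k \<in> borel_measurable lebesgue" and int: "integrable lebesgue (\<lambda>t. (cmod (k t))\<^sup>2)"
    using k by (auto simp: square_integrable_def)
  define I where "I n = (LINT t|lebesgue. indicator {s n - d..s n} t *\<^sub>R (cmod (k t))\<^sup>2)" for n
  have meas: "(\<lambda>t. indicat_real {s n - d..s n} t *\<^sub>R (cmod (k t))\<^sup>2) \<in> borel_measurable lebesgue" for n
    by (intro borel_measurable_scaleR borel_measurable_indicator) auto
  have "I \<longlonglongrightarrow> (LINT t|(lebesgue :: real measure). 0::real)"
    unfolding I_def[abs_def]
  proof (rule integral_dominated_convergence[where w = "\<lambda>t. (cmod (k t))\<^sup>2"])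
    show "AE t in lebesgue. (\<lambda>n. indicat_real {s n - d..s n} t *\<^sub>R (cmod (k t))\<^sup>2) \<longlonglongrightarrow> 0"
    proof (rule AE_I2)
      fix t
      have "eventually (\<lambda>n. t \<notin> {s n - d..s n}) sequentially"
        using s
      proof
        assume "filterlim s at_top sequentially"
        then have "eventually (\<lambda>n. t + d < s n) sequentially" by (simp add: filterlim_at_top_dense)
        then show ?thesis by eventually_elim auto
      next
        assume "filterlim s at_bot sequentially"
        then have "eventually (\<lambda>n. s n < t) sequentially" by (simp add: filterlim_at_bot_dense)
        then show ?thesis by eventually_elim auto
      qed
      then show "(\<lambda>n. indicat_real {s n - d..s n} t *\<^sub>R (cmod (k t))\<^sup>2) \<longlonglongrightarrow> 0"
        by (intro tendsto_eventually) (auto elim!: eventually_mono)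
    qed
    show "AE t in lebesgue. norm (indicat_real {s n - d..s n} t *\<^sub>R (cmod (k t))\<^sup>2) \<le> (cmod (k t))\<^sup>2" for n
      by (intro AE_I2) (auto simp: indicator_def)
  qed (use int meas in auto)
  then have I0: "I \<longlonglongrightarrow> 0" by simp
  have ai: "k absolutely_integrable_on {a..b}" for a b
    by (rule square_integrable_absolutely_integrable[OF k])
  have set_int: "set_integrable lebesgue {s n - d..s n} (\<lambda>t. (cmod (k t))\<^sup>2)" for n
    unfolding set_integrable_def
    by (rule Bochner_Integration.integrable_bound[OF int meas]) (auto simp: indicator_def)
  have I_eq: "I n = integral {s n - d..s n} (\<lambda>t. (cmod (k t))\<^sup>2)" for n
    using set_lebesgue_integral_eq_integral(2)[OF set_int[of n]] by (simp add: I_def set_lebesgue_integral_def)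
  have bound: "integral {s n - d..s n} (\<lambda>t. cmod (k t)) \<le> \<eta> * d + I n / \<eta>" if "\<eta> > 0" for \<eta> n
  proof -
    have "z \<le> \<eta> + z\<^sup>2 / \<eta>" if "0 \<le> z" for z
    proof (cases "z \<le> \<eta>")
      case True
      have "0 \<le> z\<^sup>2 / \<eta>" using \<open>\<eta> > 0\<close> by simp
      with True show ?thesis by linarith
    next
      case False
      then have "\<eta> * z \<le> z * z" using that by (intro mult_right_mono) auto
      then have "z \<le> z\<^sup>2 / \<eta>" using \<open>\<eta> > 0\<close> by (simp add: pos_le_divide_eq power2_eq_square mult.commute)
      then show ?thesis using \<open>\<eta> > 0\<close> by linarith
    qed
    then have "integral {s n - d..s n} (\<lambda>t. cmod (k t)) \<le> integral {s n - d..s n} (\<lambda>t. \<eta> + (cmod (k t))\<^sup>2 / \<eta>)"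
      using ai set_lebesgue_integral_eq_integral(1)[OF set_int[of n]]
      by (intro integral_le integrable_add integrable_on_divide) (auto simp: absolutely_integrable_on_def)
    also have "\<dots> = \<eta> * d + I n / \<eta>"
      using set_lebesgue_integral_eq_integral(1)[OF set_int[of n]] d
      by (subst Henstock_Kurzweil_Integration.integral_add) (auto simp: I_eq integrable_on_divide)
    finally show ?thesis .
  qed
  show ?thesis
  proof (rule LIMSEQ_I)
    fix e :: real assume e: "e > 0"
    \<comment> \<open>With this choice the constant part \<open>\<eta> * d\<close> is half of the
      tolerance.\<close>
    define \<eta> where "\<eta> = e / (2 * d)"
    have \<eta>: "\<eta> > 0" using e d by (simp add: \<eta>_def)
    then have "(\<lambda>n. I n / \<eta>) \<longlonglongrightarrow> 0 / \<eta>" using I0 by (intro tendsto_divide tendsto_const) auto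
    then have "eventually (\<lambda>n. I n / \<eta> < e / 2) sequentially"
      using e by (intro order_tendstoD(2)) auto
    then have "eventually (\<lambda>n. norm (integral {s n - d..s n} (\<lambda>t. cmod (k t)) - 0) < e) sequentially"
    proof eventually_elim
      case (elim n)
      have "0 \<le> integral {s n - d..s n} (\<lambda>t. cmod (k t))"
        using ai by (intro integral_nonneg) (auto simp: absolutely_integrable_on_def)
      moreover have "\<eta> * d = e / 2" using d by (simp add: \<eta>_def)
      then have "integral {s n - d..s n} (\<lambda>t. cmod (k t)) < e" using bound[OF \<eta>, of n] elim by linarith
      ultimately show ?case by simp
    qed
    then show "\<exists>no. \<forall>n\<ge>no. norm (integral {s n - d..s n} (\<lambda>t. cmod (k t)) - 0) < e"
      by (simp add: eventually_sequentially)
  qed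
qed

lemma ex_small_value:
  fixes k :: "real \<Rightarrow> complex"
  assumes "a < b" "continuous_on {a..b} k"
  obtains \<tau> where "\<tau> \<in> {a..b}" "cmod (k \<tau>) * (b - a) \<le> integral {a..b} (\<lambda>t. cmod (k t))"
proof -
  have c: "continuous_on {a..b} (\<lambda>t. cmod (k t))" using assms(2) by (intro continuous_intros)
  then obtain \<tau> where \<tau>: "\<tau> \<in> {a..b}" "\<And>t. t \<in> {a..b} \<Longrightarrow> cmod (k \<tau>) \<le> cmod (k t)"
    using continuous_attains_inf[of "{a..b}" "\<lambda>t. cmod (k t)"] assms(1) by auto
  have "integral {a..b} (\<lambda>t. cmod (k \<tau>)) \<le> integral {a..b} (\<lambda>t. cmod (k t))"
    using \<tau> by (intro integral_le integrable_continuous_real c) auto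
  then show ?thesis using that[OF \<tau>(1)] assms(1) by (simp add: mult.commute)
qed

context regular_function
begin

lemma g_ai: "g absolutely_integrable_on {s..t}"
  by (rule square_integrable_absolutely_integrable[OF g_sq])

lemmas g_int = square_integrable_integrable_on[OF g_sq]

lemma f_diff:
  assumes "s \<in> piece k" "t \<in> piece k" "s \<le> t"
  shows "(D k has_integral (f t - f s)) {s..t}"
proof (rule fundamental_theorem_of_calculus[OF assms(3)])
  fix \<tau> assume "\<tau> \<in> {s..t}"
  then show "(f has_vector_derivative D k \<tau>) (at \<tau> within {s..t})"
    using piece_interval[OF assms(1,2)] has_vector_derivative_within_subset[OF f_deriv] by blast
qed

lemma energy_interval:
  assumes st: "s \<in> piece k" "t \<in> piece k" "s \<le> t"
  shows "Re (D k s * cnj (f s)) - Re (D k t * cnj (f t)) + (cmod (f t - f s))\<^sup>2 / (t - s)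
    \<le> Re (integral {s..t} (\<lambda>\<tau>. g \<tau> * cnj (f \<tau>)))"
proof -
  have Dc: "continuous_on {s..t} (D k)" using D_cont by (rule continuous_on_subset) simp
  have "integral {s..t} (\<lambda>\<tau>. g \<tau> * cnj (f \<tau>)) = - D k t * cnj (f t) - - D k s * cnj (f s)
      - integral {s..t} (\<lambda>\<tau>. - D k \<tau> * cnj (D k \<tau>))"
  proof (rule integral_by_parts_indefinite[OF st(3) g_ai])
    show "- D k b - - D k a = integral {a..b} g" if "a \<le> b" for a b
      using D_diff[OF that, of k] by (simp add: algebra_simps)
    show "((\<lambda>\<tau>. cnj (f \<tau>)) has_vector_derivative cnj (D k \<tau>)) (at \<tau> within {s..t})" if "\<tau> \<in> {s..t}" for \<tau>
      using that piece_interval[OF st(1,2)] has_vector_derivative_within_subset[OF f_deriv]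
      by (intro has_vector_derivative_cnj) blast
    show "continuous_on {s..t} (\<lambda>\<tau>. cnj (D k \<tau>))" using Dc by (intro continuous_intros)
  qed
  also have "integral {s..t} (\<lambda>\<tau>. - D k \<tau> * cnj (D k \<tau>)) = - integral {s..t} (\<lambda>\<tau>. complex_of_real ((cmod (D k \<tau>))\<^sup>2))"
    unfolding complex_norm_square mult_minus_left integral_neg ..
  also have "integral {s..t} (\<lambda>\<tau>. complex_of_real ((cmod (D k \<tau>))\<^sup>2)) = of_real (integral {s..t} (\<lambda>\<tau>. (cmod (D k \<tau>))\<^sup>2))"
    using Dc by (intro integral_linear[OF _ bounded_linear_of_real, unfolded o_def] integrable_continuous_real continuous_intros)
  finally have eq: "Re (integral {s..t} (\<lambda>\<tau>. g \<tau> * cnj (f \<tau>))) = Re (D k s * cnj (f s)) - Re (D k t * cnj (f t))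
      + integral {s..t} (\<lambda>\<tau>. (cmod (D k \<tau>))\<^sup>2)"
    by simp
  have "(cmod (f t - f s))\<^sup>2 / (t - s) \<le> integral {s..t} (\<lambda>\<tau>. (cmod (D k \<tau>))\<^sup>2)"
  \<comment> \<open>For s = t the quotient on the left is a division by zero, hence 0.\<close>
  proof (cases "s = t")
    case False
    then have pos: "t - s > 0" using st by simp
    \<comment> \<open>The mean slope. Integrating the inequality 2 Re(cnj c * D) - (cmod c)^2 \<le>
      (cmod D)^2 gives the Cauchy-Schwarz bound.\<close>
    define c where "c = (f t - f s) / of_real (t - s)"
    have ft: "f t - f s = of_real (t - s) * c" using pos by (simp add: c_def)
    have Di: "(D k has_integral (f t - f s)) {s..t}" by (rule f_diff[OF st])
    have "((\<lambda>\<tau>. Re (cnj c * D k \<tau>)) has_integral Re (cnj c * (f t - f s))) {s..t}"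
      by (intro has_integral_Re has_integral_mult_right Di)
    then have i: "((\<lambda>\<tau>. 2 * Re (cnj c * D k \<tau>) - (cmod c)\<^sup>2) has_integral
        (2 * Re (cnj c * (f t - f s)) - (t - s) * (cmod c)\<^sup>2)) {s..t}"
      using has_integral_const_real[of "(cmod c)\<^sup>2" s t] pos
      by (intro has_integral_diff has_integral_mult_right) auto
    have "2 * Re (cnj c * (f t - f s)) - (t - s) * (cmod c)\<^sup>2 \<le> integral {s..t} (\<lambda>\<tau>. (cmod (D k \<tau>))\<^sup>2)"
    proof (rule has_integral_le[OF i])
      show "((\<lambda>\<tau>. (cmod (D k \<tau>))\<^sup>2) has_integral integral {s..t} (\<lambda>\<tau>. (cmod (D k \<tau>))\<^sup>2)) {s..t}"
        using Dc by (intro integrable_integral integrable_continuous_real continuous_intros)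
      show "2 * Re (cnj c * D k \<tau>) - (cmod c)\<^sup>2 \<le> (cmod (D k \<tau>))\<^sup>2" for \<tau>
        using cmod_diff_square[of "D k \<tau>" c] zero_le_power2[of "cmod (D k \<tau> - c)"] by (simp add: mult.commute)
    qed
    moreover have "Re (cnj c * (f t - f s)) = (t - s) * (cmod c)\<^sup>2"
    proof -
      have "cnj c * (f t - f s) = of_real (t - s) * (c * cnj c)" unfolding ft by (simp only: mult_ac)
      also have "\<dots> = of_real ((t - s) * (cmod c)\<^sup>2)" by (simp only: complex_norm_square[symmetric] of_real_mult)
      finally show ?thesis by (simp only: Re_complex_of_real)
    qed
    moreover have "(cmod (f t - f s))\<^sup>2 / (t - s) = (t - s) * (cmod c)\<^sup>2"
      unfolding ft using pos by (simp add: norm_mult power_mult_distrib power2_eq_square del: of_real_diff)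
    ultimately show ?thesis by simp
  qed simp
  then show ?thesis unfolding eq by simp
qed

lemma gf_int: "(\<lambda>t. g t * cnj (f t)) integrable_on {a..b}"
  using absolutely_integrable_mult_continuous(1)[OF g_ai, of a b "\<lambda>t. cnj (f t)"] continuous_on_subset[OF f_cont subset_UNIV]
  by (intro set_lebesgue_integral_eq_integral(1)) (auto intro: continuous_on_cnj)

text \<open>The right boundary term carries the derivative from the left of \<open>x n\<close>, so
  the jump at \<open>x n\<close>, and with it \<open>\<alpha> n\<close>, enters only in the step to
  the next node. The gradient energy on the half-line before \<open>x 1\<close> is dropped as
  nonnegative.\<close>

lemma energy_sum:
  assumes y: "y \<le> x 1" and n: "n \<ge> 1"
  shows "Re (D 0 y * cnj (f y)) - Re (D (n - 1) (x n) * cnj (f (x n)))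
      + (\<Sum>k=1..<n. \<alpha> k * (cmod (f (x k)))\<^sup>2 + (cmod (f (x (Suc k)) - f (x k)))\<^sup>2 / gap x k)
    \<le> Re (integral {y..x n} (\<lambda>t. g t * cnj (f t)))"
  using n
proof (induction n rule: dec_induct)
  case base
  have "y \<in> piece 0" "x 1 \<in> piece 0" using y by (auto simp: piece_def)
  then have "Re (D 0 y * cnj (f y)) - Re (D 0 (x 1) * cnj (f (x 1))) + (cmod (f (x 1) - f y))\<^sup>2 / (x 1 - y)
    \<le> Re (integral {y..x 1} (\<lambda>\<tau>. g \<tau> * cnj (f \<tau>)))"
    using y by (rule energy_interval)
  moreover have "0 \<le> (cmod (f (x 1) - f y))\<^sup>2 / (x 1 - y)" using y by simp
  ultimately show ?case
    by (simp only: diff_self_eq_0 atLeastLessThan_empty[OF order_refl] sum.empty add_0_right)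
next
  case (step n)
  have le: "y \<le> x n" "x n \<le> x (Suc n)"
    using y step.hyps x_mono[of 1 n] x_mono[of n "Suc n"] by auto
  have "integral {y..x (Suc n)} (\<lambda>t. g t * cnj (f t)) =
      integral {y..x n} (\<lambda>t. g t * cnj (f t)) + integral {x n..x (Suc n)} (\<lambda>t. g t * cnj (f t))"
    using Henstock_Kurzweil_Integration.integral_combine[OF le gf_int] by simp
  moreover have "Re (D n (x n) * cnj (f (x n))) = Re (D (n - 1) (x n) * cnj (f (x n))) + \<alpha> n * (cmod (f (x n)))\<^sup>2"
  proof -
    have "D n (x n) * cnj (f (x n)) = D (n - 1) (x n) * cnj (f (x n)) + of_real (\<alpha> n) * (f (x n) * cnj (f (x n)))"
      using D_jump[of n] step.hyps by (simp add: algebra_simps)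
    then show ?thesis by (simp only: complex_norm_square[symmetric] of_real_mult[symmetric] plus_complex.sel Re_complex_of_real)
  qed
  moreover have "x n \<in> piece n" "x (Suc n) \<in> piece n" using x_in_piece step.hyps by auto
  ultimately show ?case
    using step energy_interval[of "x n" n "x (Suc n)"] le by (simp add: gap_def)
qed

text \<open>An interpolation inequality on an interval of length d: \<open>D k\<close> varies by at
  most the integral of g, and f is small somewhere in the first and in the last third. The
  difference of these two values then bounds the slope, and the slope bounds the endpoint
  value.\<close>

lemma endpoint_bound:
  assumes s: "s \<in> piece k" "s - d \<in> piece k"
  defines "K \<equiv> integral {s - d..s} (\<lambda>t. cmod (f t)) + integral {s - d..s} (\<lambda>t. cmod (g t))"
  shows "cmod (D k s) \<le> (18 / d\<^sup>2 + 1) * K" and "cmod (f s) \<le> (9 / d + d) * K"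
proof -
  have fi: "(\<lambda>t. cmod (f t)) integrable_on {a..b}" for a b
    by (intro integrable_continuous_real continuous_intros continuous_on_subset[OF f_cont]) simp
  have nn: "0 \<le> integral {a..b} (\<lambda>t. cmod (f t))" "0 \<le> integral {a..b} (\<lambda>t. cmod (g t))" for a b
    using fi g_int by (auto intro!: integral_nonneg)
  have K0: "0 \<le> K" using nn by (simp add: K_def)
  have sub: "integral {a..b} (\<lambda>t. cmod (f t)) \<le> K" "integral {a..b} (\<lambda>t. cmod (g t)) \<le> K"
    if "s - d \<le> a" "b \<le> s" for a b
  proof -
    have "integral {a..b} (\<lambda>t. cmod (f t)) \<le> integral {s - d..s} (\<lambda>t. cmod (f t))"
      "integral {a..b} (\<lambda>t. cmod (g t)) \<le> integral {s - d..s} (\<lambda>t. cmod (g t))"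
      using that fi g_int by (auto intro!: integral_subset_le)
    then show "integral {a..b} (\<lambda>t. cmod (f t)) \<le> K" "integral {a..b} (\<lambda>t. cmod (g t)) \<le> K"
      using nn[of "s - d" s] by (auto simp: K_def)
  qed
  have fc: "continuous_on {a..b} f" for a b using f_cont by (rule continuous_on_subset) simp
  \<comment> \<open>The minimum over a third of the interval is at most the mean, hence the bound
    \<open>3 / d * K\<close>. Taking the outer thirds keeps the two points at least d / 3 apart,
    which produces the factor 18 = 6 * 3.\<close>
  obtain t1 where t1: "t1 \<in> {s - d..s - 2 * d / 3}"
    "cmod (f t1) * (s - 2 * d / 3 - (s - d)) \<le> integral {s - d..s - 2 * d / 3} (\<lambda>t. cmod (f t))"
    using ex_small_value[of "s - d" "s - 2 * d / 3" f] d_pos fc by auto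
  obtain t2 where t2: "t2 \<in> {s - d / 3..s}"
    "cmod (f t2) * (s - (s - d / 3)) \<le> integral {s - d / 3..s} (\<lambda>t. cmod (f t))"
    using ex_small_value[of "s - d / 3" s f] d_pos fc by auto
  have "cmod (f t1) * (d / 3) \<le> K" "cmod (f t2) * (d / 3) \<le> K"
    using t1(2) t2(2) sub(1)[of "s - d" "s - 2 * d / 3"] sub(1)[of "s - d / 3" s] d_pos
    by (auto simp: algebra_simps)
  then have f12: "cmod (f t1) \<le> 3 / d * K" "cmod (f t2) \<le> 3 / d * K"
    using d_pos by (simp_all add: field_simps)
  have Dd: "cmod (D k \<tau> - D k s) \<le> K" if "\<tau> \<in> {s - d..s}" for \<tau>
  proof -
    have "cmod (D k \<tau> - D k s) = cmod (integral {\<tau>..s} g)"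
      using D_diff[of \<tau> s k] that by (simp add: norm_minus_commute[of "D k \<tau>"])
    also have "\<dots> \<le> integral {\<tau>..s} (\<lambda>t. cmod (g t))"
      using g_int by (intro integral_norm_bound_integral) auto
    finally show ?thesis using sub(2)[of \<tau> s] that by simp
  qed
  have piece: "t \<in> piece k" if "t \<in> {s - d..s}" for t
    using piece_interval[OF s(2,1)] that by blast
  have est: "cmod (f b - f a - of_real (b - a) * D k s) \<le> K * (b - a)" if "s - d \<le> a" "a \<le> b" "b \<le> s" for a b
  proof -
    have "(D k has_integral (f b - f a)) {a..b}"
      using that piece by (intro f_diff) auto
    moreover have "((\<lambda>\<tau>. D k s) has_integral (of_real (b - a) * D k s)) {a..b}"
      using has_integral_const_real[of "D k s" a b] that by (simp add: scaleR_conv_of_real)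
    ultimately have i: "((\<lambda>\<tau>. D k \<tau> - D k s) has_integral (f b - f a - of_real (b - a) * D k s)) {a..b}"
      by (rule has_integral_diff)
    have "norm (f b - f a - of_real (b - a) * D k s) \<le> K * measure lborel (cbox a b)"
    proof (rule has_integral_bound[OF K0])
      show "((\<lambda>\<tau>. D k \<tau> - D k s) has_integral (f b - f a - of_real (b - a) * D k s)) (cbox a b)"
        using i by simp
    qed (use Dd that in auto)
    then show ?thesis using that by simp
  qed
  have len: "d / 3 \<le> t2 - t1" using t1(1) t2(1) d_pos by auto
  then have "0 < t2 - t1" using d_pos by simp
  have "cmod (of_real (t2 - t1) * D k s) \<le> cmod (f t2 - f t1) + cmod (f t2 - f t1 - of_real (t2 - t1) * D k s)"
    using norm_triangle_ineq4[of "f t2 - f t1" "f t2 - f t1 - of_real (t2 - t1) * D k s"] by simp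
  also have "\<dots> \<le> (3 / d * K + 3 / d * K) + K * (t2 - t1)"
    using est[of t1 t2] t1(1) t2(1) d_pos len f12 norm_triangle_ineq4[of "f t2" "f t1"] by (intro add_mono) auto
  finally have "(t2 - t1) * cmod (D k s) \<le> 6 / d * K + K * (t2 - t1)"
    using \<open>0 < t2 - t1\<close> by (simp add: norm_mult del: of_real_diff)
  then have "(t2 - t1) * (cmod (D k s) - K) \<le> 6 / d * K" by (simp add: algebra_simps)
  moreover have "d / 3 * (cmod (D k s) - K) \<le> (t2 - t1) * (cmod (D k s) - K)" if "cmod (D k s) - K \<ge> 0"
    using len that by (rule mult_right_mono)
  ultimately have "cmod (D k s) - K \<ge> 0 \<Longrightarrow> d / 3 * (cmod (D k s) - K) \<le> 6 / d * K" by linarith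
  then have dK: "cmod (D k s) - K \<ge> 0 \<Longrightarrow> d / 3 * (cmod (D k s) - K) \<le> 6 / d * K" .
  have "cmod (D k s) - K \<le> 18 / d\<^sup>2 * K"
  proof (cases "cmod (D k s) - K \<ge> 0")
    case True
    then have "d / 3 * (cmod (D k s) - K) \<le> 6 / d * K" by (rule dK)
    then show ?thesis using d_pos by (simp add: field_simps power2_eq_square)
  next
    case False
    moreover have "0 \<le> 18 / d\<^sup>2 * K" using K0 by simp
    ultimately show ?thesis by linarith
  qed
  then show Ds: "cmod (D k s) \<le> (18 / d\<^sup>2 + 1) * K" by (simp add: distrib_right)
  have "cmod (f s) \<le> cmod (f t2) + (cmod (of_real (s - t2) * D k s) + cmod (f s - f t2 - of_real (s - t2) * D k s))"
    using norm_triangle_ineq[of "f t2" "of_real (s - t2) * D k s + (f s - f t2 - of_real (s - t2) * D k s)"]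
      norm_triangle_ineq[of "of_real (s - t2) * D k s" "f s - f t2 - of_real (s - t2) * D k s"]
    by simp
  also have "\<dots> \<le> 3 / d * K + ((s - t2) * ((18 / d\<^sup>2 + 1) * K) + K * (s - t2))"
    using f12 est[of t2 s] t2(1) d_pos Ds
    by (intro add_mono) (auto simp: norm_mult intro!: mult_mono simp del: of_real_diff)
  also have "\<dots> \<le> 3 / d * K + (d / 3 * ((18 / d\<^sup>2 + 1) * K) + K * (d / 3))"
    using t2(1) d_pos K0 by (intro add_mono mult_right_mono mult_left_mono mult_nonneg_nonneg) auto
  also have "\<dots> = (9 / d + 2 * d / 3) * K" using d_pos by (simp add: field_simps power2_eq_square)
  also have "\<dots> \<le> (9 / d + d) * K" using d_pos K0 by (intro mult_right_mono) auto
  finally show "cmod (f s) \<le> (9 / d + d) * K" .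
qed

text \<open>A window of length d to the left of the endpoint must fit into a single piece; the lower
  bound on the gaps provides this.\<close>

lemma endpoint_tendsto:
  assumes s: "\<And>n. s n \<in> piece (k n)" "\<And>n. s n - d \<in> piece (k n)"
    and lim: "filterlim s at_top sequentially \<or> filterlim s at_bot sequentially"
  shows "(\<lambda>n. f (s n)) \<longlonglongrightarrow> 0" and "(\<lambda>n. D (k n) (s n)) \<longlonglongrightarrow> 0"
proof -
  define K where "K n = integral {s n - d..s n} (\<lambda>t. cmod (f t)) + integral {s n - d..s n} (\<lambda>t. cmod (g t))" for n
  have "K \<longlonglongrightarrow> 0 + 0"
    unfolding K_def by (intro tendsto_add square_integrable_tail f_sq g_sq lim d_pos)
  then have K: "(\<lambda>n. C * K n) \<longlonglongrightarrow> 0" for C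
    using tendsto_mult[OF tendsto_const[of C], of K 0] by simp
  show "(\<lambda>n. f (s n)) \<longlonglongrightarrow> 0"
    by (rule Lim_null_comparison[OF _ K[of "9 / d + d"]])
      (use endpoint_bound(2)[OF s] in \<open>simp add: K_def\<close>)
  show "(\<lambda>n. D (k n) (s n)) \<longlonglongrightarrow> 0"
    by (rule Lim_null_comparison[OF _ K[of "18 / d\<^sup>2 + 1"]])
      (use endpoint_bound(1)[OF s] in \<open>simp add: K_def\<close>)
qed

lemma energy_nonneg:
  assumes J: "eventually (\<lambda>n. 0 \<le> jacobi_form x \<alpha> n (\<lambda>k. f (x k))) sequentially"
  shows "0 \<le> Re (LINT t|lebesgue. g t * cnj (f t))"
proof -
  define y where "y n = x 1 - real n" for n
  \<comment> \<open>All boundary contributions; the last one pays for the boundary summand of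
    \<open>jacobi_form\<close>, with the gap replaced by its lower bound d.\<close>
  define R where "R n = Re (D 0 (y n) * cnj (f (y n))) - Re (D n (x (Suc n)) * cnj (f (x (Suc n)))) - (cmod (f (x n)))\<^sup>2 / d" for n
  have xS: "filterlim (\<lambda>n. x (Suc n)) at_top sequentially"
    using filterlim_x by (simp add: filterlim_sequentially_Suc)
  have ybot: "filterlim y at_bot sequentially"
    unfolding y_def[abs_def] filterlim_uminus_at_bot
    by (simp add: filterlim_tendsto_add_at_top[OF tendsto_const filterlim_real_sequentially, of "- x 1", simplified])
  have int: "integrable lebesgue (\<lambda>t. g t * cnj (f t))"
    by (rule integrable_mult_cnj[OF g_sq f_sq])
  have "(\<lambda>n. LINT t|lebesgue. indicat_real {y n..x (Suc n)} t *\<^sub>R (g t * cnj (f t))) \<longlonglongrightarrow> (LINT t|lebesgue. g t * cnj (f t))"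
  proof (rule integral_dominated_convergence[where w = "\<lambda>t. cmod (g t * cnj (f t))"])
    show "(\<lambda>t. indicat_real {y n..x (Suc n)} t *\<^sub>R (g t * cnj (f t))) \<in> borel_measurable lebesgue" for n
      using int by (intro borel_measurable_scaleR borel_measurable_indicator) auto
    show "AE t in lebesgue. (\<lambda>n. indicat_real {y n..x (Suc n)} t *\<^sub>R (g t * cnj (f t))) \<longlonglongrightarrow> g t * cnj (f t)"
    proof (rule AE_I2)
      fix t
      have "eventually (\<lambda>n. t < x (Suc n)) sequentially" "eventually (\<lambda>n. y n < t) sequentially"
        using xS ybot by (auto simp: filterlim_at_top_dense filterlim_at_bot_dense)
      then have "eventually (\<lambda>n. indicat_real {y n..x (Suc n)} t *\<^sub>R (g t * cnj (f t)) = g t * cnj (f t)) sequentially"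
        by eventually_elim auto
      then show "(\<lambda>n. indicat_real {y n..x (Suc n)} t *\<^sub>R (g t * cnj (f t))) \<longlonglongrightarrow> g t * cnj (f t)"
        by (rule tendsto_eventually)
    qed
    show "AE t in lebesgue. norm (indicat_real {y n..x (Suc n)} t *\<^sub>R (g t * cnj (f t))) \<le> cmod (g t * cnj (f t))" for n
      by (intro AE_I2) (auto simp: indicator_def)
  qed (use int in auto)
  moreover have "(LINT t|lebesgue. indicat_real {y n..x (Suc n)} t *\<^sub>R (g t * cnj (f t))) = integral {y n..x (Suc n)} (\<lambda>t. g t * cnj (f t))" for n
  proof -
    have "set_integrable lebesgue {y n..x (Suc n)} (\<lambda>t. g t * cnj (f t))"
      using absolutely_integrable_mult_continuous(1)[OF g_ai, of _ _ "\<lambda>t. cnj (f t)"] continuous_on_subset[OF f_cont subset_UNIV]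
      by (auto intro: continuous_on_cnj)
    then show ?thesis
      using set_lebesgue_integral_eq_integral(2) by (fastforce simp: set_lebesgue_integral_def)
  qed
  ultimately have lim: "(\<lambda>n. Re (integral {y n..x (Suc n)} (\<lambda>t. g t * cnj (f t)))) \<longlonglongrightarrow> Re (LINT t|lebesgue. g t * cnj (f t))"
    by (intro tendsto_Re) simp
  have right: "(\<lambda>n. f (x (Suc (Suc n)))) \<longlonglongrightarrow> 0" "(\<lambda>n. D (Suc n) (x (Suc (Suc n)))) \<longlonglongrightarrow> 0"
  proof -
    have "x (Suc (Suc n)) \<in> piece (Suc n)" "x (Suc (Suc n)) - d \<in> piece (Suc n)" for n
      using gap_ge[of "Suc n"] d_pos by (auto simp: piece_def gap_def)
    moreover have "filterlim (\<lambda>n. x (Suc (Suc n))) at_top sequentially"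
      using xS filterlim_sequentially_Suc[of "\<lambda>n. x (Suc n)"] by simp
    ultimately show "(\<lambda>n. f (x (Suc (Suc n)))) \<longlonglongrightarrow> 0" "(\<lambda>n. D (Suc n) (x (Suc (Suc n)))) \<longlonglongrightarrow> 0"
      using endpoint_tendsto[of "\<lambda>n. x (Suc (Suc n))" Suc] by auto
  qed
  have left: "(\<lambda>n. f (y n)) \<longlonglongrightarrow> 0" "(\<lambda>n. D 0 (y n)) \<longlonglongrightarrow> 0"
  proof -
    have "y n \<in> piece 0" "y n - d \<in> piece 0" for n
      using d_pos by (auto simp: piece_def y_def)
    then show "(\<lambda>n. f (y n)) \<longlonglongrightarrow> 0" "(\<lambda>n. D 0 (y n)) \<longlonglongrightarrow> 0"
      using endpoint_tendsto[of y "\<lambda>n. 0"] ybot by auto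
  qed
  have fx: "(\<lambda>n. f (x n)) \<longlonglongrightarrow> 0" "(\<lambda>n. f (x (Suc n))) \<longlonglongrightarrow> 0" "(\<lambda>n. D n (x (Suc n))) \<longlonglongrightarrow> 0"
  proof -
    show a: "(\<lambda>n. f (x (Suc n))) \<longlonglongrightarrow> 0" by (rule LIMSEQ_imp_Suc) (rule right(1))
    show "(\<lambda>n. f (x n)) \<longlonglongrightarrow> 0" by (rule LIMSEQ_imp_Suc) (rule a)
    show "(\<lambda>n. D n (x (Suc n))) \<longlonglongrightarrow> 0" by (rule LIMSEQ_imp_Suc) (rule right(2))
  qed
  have "R \<longlonglongrightarrow> Re (0 * cnj 0) - Re (0 * cnj 0) - (cmod 0)\<^sup>2 / d"
    unfolding R_def[abs_def] using d_pos left fx by (intro tendsto_intros) auto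
  then have R: "R \<longlonglongrightarrow> 0" by simp
  have ev: "eventually (\<lambda>n. R n \<le> Re (integral {y n..x (Suc n)} (\<lambda>t. g t * cnj (f t)))) sequentially"
    using J eventually_ge_at_top[of 1]
  proof eventually_elim
    case (elim n)
    \<comment> \<open>The energy up to \<open>x (Suc n)\<close> contains the full difference
      quotient of the last gap, while \<open>jacobi_form\<close> has the square of the value at
      \<open>x n\<close> there. The former is dropped as nonnegative, the latter is absorbed in
      R.\<close>
    have "(\<Sum>k=1..<Suc n. \<alpha> k * (cmod (f (x k)))\<^sup>2 + (cmod (f (x (Suc k)) - f (x k)))\<^sup>2 / gap x k)
        = jacobi_form x \<alpha> n (\<lambda>k. f (x k)) - (cmod (f (x n)))\<^sup>2 / gap x n + (cmod (f (x (Suc n)) - f (x n)))\<^sup>2 / gap x n"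
      using elim(2) unfolding jacobi_form_def sum.distrib
      by (simp add: atLeastLessThanSuc_atLeastAtMost[symmetric])
    moreover have "(cmod (f (x n)))\<^sup>2 / gap x n \<le> (cmod (f (x n)))\<^sup>2 / d"
      using gap_ge[of n] elim d_pos by (intro divide_left_mono) auto
    moreover have "0 \<le> (cmod (f (x (Suc n)) - f (x n)))\<^sup>2 / gap x n"
      using gap_pos[of n] elim by simp
    moreover have "y n \<le> x 1" by (simp add: y_def)
    ultimately show ?case
      using energy_sum[of "y n" "Suc n"] elim(1) by (simp add: R_def)
  qed
  show ?thesis
    by (rule tendsto_le[OF sequentially_bot lim R ev])
qed

end

section \<open>Trial functions\<close>

text \<open>Multiples of \<open>bump p d\<close> correct the slopes of a piecewise linear function without changing its values
  at the nodes, at a cost in energy that tends to \<open>0\<close> as \<open>p\<close> grows.\<close>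

definition bump :: "nat \<Rightarrow> real \<Rightarrow> real \<Rightarrow> real" where
  "bump p d t = t * (1 - t / d) ^ Suc (Suc p)"

text \<open>This and \<open>bump2\<close> are the first two derivatives of \<open>bump\<close>,
  expanded in powers of \<open>1 - t / d\<close>.\<close>

definition bump1 :: "nat \<Rightarrow> real \<Rightarrow> real \<Rightarrow> real" where
  "bump1 p d t = (real p + 3) * (1 - t / d) ^ Suc (Suc p) - (real p + 2) * (1 - t / d) ^ Suc p"

definition bump2 :: "nat \<Rightarrow> real \<Rightarrow> real \<Rightarrow> real" where
  "bump2 p d t = - (((real p + 3) * (real p + 2) * (1 - t / d) ^ Suc p - (real p + 2) * (real p + 1) * (1 - t / d) ^ p) / d)"

lemma power_affine_deriv:
  fixes d t :: real
  shows "((\<lambda>t. (1 - t / d) ^ Suc n) has_real_derivative - (real (Suc n) * (1 - t / d) ^ n / d)) (at t)"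
proof -
  have "((\<lambda>t. 1 - t / d) has_real_derivative (0 - 1 / d)) (at t)"
    by (intro DERIV_diff DERIV_const DERIV_cdivide DERIV_ident)
  from DERIV_power_Suc[OF this, of n] show ?thesis by simp
qed

lemma bump_deriv:
  assumes "d \<noteq> 0"
  shows "(bump p d has_real_derivative bump1 p d t) (at t)"
    and "(bump1 p d has_real_derivative bump2 p d t) (at t)"
proof -
  define r where "r = 1 - t / d"
  have td: "t / d = 1 - r" by (simp add: r_def)
  have "1 * r ^ Suc (Suc p) + - (real (Suc (Suc p)) * r ^ Suc p / d) * t = r ^ Suc (Suc p) - real (Suc (Suc p)) * r ^ Suc p * (t / d)"
    by simp
  also have "\<dots> = bump1 p d t"
    unfolding td bump1_def r_def[symmetric] by (simp add: algebra_simps)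
  finally have eq: "1 * r ^ Suc (Suc p) + - (real (Suc (Suc p)) * r ^ Suc p / d) * t = bump1 p d t" .
  show "(bump p d has_real_derivative bump1 p d t) (at t)"
    unfolding bump_def[abs_def] eq[symmetric] r_def by (rule DERIV_mult[OF DERIV_ident power_affine_deriv])
  have eq2: "(real p + 3) * - (real (Suc (Suc p)) * r ^ Suc p / d) - (real p + 2) * - (real (Suc p) * r ^ p / d) = bump2 p d t"
    unfolding bump2_def r_def[symmetric] by (simp add: diff_divide_distrib algebra_simps)
  show "(bump1 p d has_real_derivative bump2 p d t) (at t)"
    unfolding bump1_def[abs_def] eq2[symmetric] r_def
    by (intro DERIV_diff DERIV_cmult power_affine_deriv)
qed

lemma bump_ends [simp]:
  "bump p d 0 = 0" "d \<noteq> 0 \<Longrightarrow> bump p d d = 0" "bump1 p d 0 = 1" "d \<noteq> 0 \<Longrightarrow> bump1 p d d = 0"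
  by (simp_all add: bump_def bump1_def)

text \<open>Tested against \<open>bump2\<close>, an affine function yields minus its value at 0. The
  third integral is minus the energy of \<open>bump1\<close>, which equals d (p + 2) / ((2 p + 5) (2
  p + 3)) and tends to 0.\<close>

lemma bump_integrals:
  assumes d: "d > 0"
  shows "(bump2 p d has_integral - 1) {0..d}"
    and "((\<lambda>t. t * bump2 p d t) has_integral 0) {0..d}"
    and "\<exists>I. ((\<lambda>t. bump p d t * bump2 p d t) has_integral - I) {0..d} \<and> I \<le> d / (real p + 1)"
proof -
  have d0: "d \<noteq> 0" using d by simp
  note D = bump_deriv[OF d0, of p]
  have "(bump2 p d has_integral (bump1 p d d - bump1 p d 0)) {0..d}"
    using d D by (intro fundamental_theorem_of_calculus)
      (auto simp: has_real_derivative_iff_has_vector_derivative[symmetric] intro: has_field_derivative_at_within)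
  then show "(bump2 p d has_integral - 1) {0..d}" using d0 by simp
  have "((\<lambda>t. t * bump1 p d t - bump p d t) has_real_derivative t * bump2 p d t) (at t)" for t
    by (auto intro!: derivative_eq_intros D)
  then have "((\<lambda>t. t * bump2 p d t) has_integral ((d * bump1 p d d - bump p d d) - (0 * bump1 p d 0 - bump p d 0))) {0..d}"
    using d by (intro fundamental_theorem_of_calculus)
      (auto simp: has_real_derivative_iff_has_vector_derivative[symmetric] intro: has_field_derivative_at_within)
  then show "((\<lambda>t. t * bump2 p d t) has_integral 0) {0..d}" using d0 by simp
  \<comment> \<open>A primitive of the square of \<open>bump1\<close>, found by expanding the square
    in powers of \<open>1 - t / d\<close>.\<close>
  define R where "R t = - d * ((real p + 3)\<^sup>2 * (1 - t / d) ^ Suc (2 * p + 4) / (2 * real p + 5)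
      - (real p + 3) * (1 - t / d) ^ Suc (2 * p + 3) + (real p + 2)\<^sup>2 * (1 - t / d) ^ Suc (2 * p + 2) / (2 * real p + 3))" for t
  have R: "(R has_real_derivative (bump1 p d t)\<^sup>2) (at t)" for t
  proof -
    define r where "r = 1 - t / d"
    have "(R has_real_derivative (- d * ((real p + 3)\<^sup>2 * - (real (Suc (2 * p + 4)) * r ^ (2 * p + 4) / d) / (2 * real p + 5)
      - (real p + 3) * - (real (Suc (2 * p + 3)) * r ^ (2 * p + 3) / d)
      + (real p + 2)\<^sup>2 * - (real (Suc (2 * p + 2)) * r ^ (2 * p + 2) / d) / (2 * real p + 3)))) (at t)"
      unfolding R_def[abs_def] r_def
      by (intro DERIV_cmult DERIV_add DERIV_diff DERIV_cdivide power_affine_deriv)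
    also have "(- d * ((real p + 3)\<^sup>2 * - (real (Suc (2 * p + 4)) * r ^ (2 * p + 4) / d) / (2 * real p + 5)
      - (real p + 3) * - (real (Suc (2 * p + 3)) * r ^ (2 * p + 3) / d)
      + (real p + 2)\<^sup>2 * - (real (Suc (2 * p + 2)) * r ^ (2 * p + 2) / d) / (2 * real p + 3)))
      = (real p + 3)\<^sup>2 * r ^ (2 * p + 4) - (real p + 3) * (2 * real p + 4) * r ^ (2 * p + 3) + (real p + 2)\<^sup>2 * r ^ (2 * p + 2)"
    proof -
      have s: "real (Suc (2 * p + 4)) = 2 * real p + 5" "real (Suc (2 * p + 3)) = 2 * real p + 4" "real (Suc (2 * p + 2)) = 2 * real p + 3"
        by simp_all
      have nz: "2 * real p + 5 \<noteq> 0" "2 * real p + 3 \<noteq> 0" by linarith+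
      have a: "u * - (c * v / d) / c = - (u * v / d)" if "c \<noteq> 0" for u v c :: real
        using that by simp
      show ?thesis unfolding s a[OF nz(1)] a[OF nz(2)] using d0 by (simp add: algebra_simps add_divide_distrib diff_divide_distrib)
    qed
    also have "\<dots> = (bump1 p d t)\<^sup>2"
    proof -
      have q2: "r ^ (2 * p + 2) = (r ^ Suc p)\<^sup>2"
        by (simp add: power_mult[symmetric] mult.commute del: power_Suc)
      have "2 * p + 3 = Suc (2 * p + 2)" "2 * p + 4 = Suc (Suc (2 * p + 2))" by simp_all
      then have q: "r ^ (2 * p + 4) = r * (r * (r ^ Suc p)\<^sup>2)" "r ^ (2 * p + 3) = r * (r ^ Suc p)\<^sup>2"
        unfolding q2[symmetric] by (simp_all only: power_Suc)
      have b: "bump1 p d t = r ^ Suc p * ((real p + 3) * r - (real p + 2))"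
        unfolding bump1_def r_def[symmetric] by (simp add: algebra_simps)
      show ?thesis unfolding q q2 b power_mult_distrib by (simp add: power2_eq_square algebra_simps del: power_Suc)
    qed
    finally show ?thesis .
  qed
  define I where "I = R d - R 0"
  have "((\<lambda>t. bump p d t * bump1 p d t - R t) has_real_derivative bump p d t * bump2 p d t) (at t)" for t
    by (auto intro!: derivative_eq_intros D R simp: power2_eq_square)
  then have "((\<lambda>t. bump p d t * bump2 p d t) has_integral ((bump p d d * bump1 p d d - R d) - (bump p d 0 * bump1 p d 0 - R 0))) {0..d}"
    using d by (intro fundamental_theorem_of_calculus)
      (auto simp: has_real_derivative_iff_has_vector_derivative[symmetric] intro: has_field_derivative_at_within)
  then have "((\<lambda>t. bump p d t * bump2 p d t) has_integral - I) {0..d}"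
    using d0 by (simp add: I_def)
  moreover have "I \<le> d / (real p + 1)"
  proof -
    have "I = d * ((real p + 3)\<^sup>2 / (2 * real p + 5) - (real p + 3) + (real p + 2)\<^sup>2 / (2 * real p + 3))"
      using d0 by (simp add: I_def R_def power_0_left)
    also have "(real p + 3)\<^sup>2 / (2 * real p + 5) - (real p + 3) + (real p + 2)\<^sup>2 / (2 * real p + 3)
        = (real p + 2) / ((2 * real p + 5) * (2 * real p + 3))"
    proof -
      have nz: "2 * real p + 5 \<noteq> 0" "2 * real p + 3 \<noteq> 0" by linarith+
      show ?thesis using nz by (simp add: divide_simps) (simp add: power2_eq_square algebra_simps)
    qed
    also have "\<dots> \<le> 1 / (real p + 1)"
    proof -
      have Q: "0 < (2 * real p + 5) * (2 * real p + 3)" by simp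
      have "(real p + 2) * (real p + 1) \<le> (2 * real p + 5) * (2 * real p + 3)"
        by (intro mult_mono) auto
      then show ?thesis
        by (subst pos_divide_le_eq[OF Q], subst times_divide_eq_left, subst pos_le_divide_eq) (linarith, simp only: mult_1)
    qed
    finally show ?thesis using d by (simp add: mult_left_mono)
  qed
  ultimately show "\<exists>I. ((\<lambda>t. bump p d t * bump2 p d t) has_integral - I) {0..d} \<and> I \<le> d / (real p + 1)"
    by blast
qed

lemma has_integral_translate:
  fixes F :: "real \<Rightarrow> 'a::euclidean_space"
  assumes "(F has_integral i) {0..d}"
  shows "((\<lambda>t. F (t - a)) has_integral i) {a..a + d}"
proof -
  have "((\<lambda>t. F (1 *\<^sub>R t + - a)) has_integral (1 / \<bar>1\<bar> ^ DIM(real)) *\<^sub>R i)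
      ((\<lambda>t. (1 / 1) *\<^sub>R t + - ((1 / 1) *\<^sub>R - a)) ` cbox 0 d)"
    using assms by (intro has_integral_affinity) auto
  moreover have "(\<lambda>t. (1 / 1) *\<^sub>R t + - ((1 / 1) *\<^sub>R - a)) ` cbox 0 d = {a..a + d}"
    by (simp add: image_add_atLeastAtMost' add.commute)
  ultimately show ?thesis by (simp add: add.commute)
qed

section \<open>Trial functions with prescribed node values in the operator domain\<close>

context separated_points
begin

context
  fixes \<alpha> :: "nat \<Rightarrow> real" and p :: nat
begin

text \<open>Index 0 is the slope at \<open>x 1\<close> of the exponential that continues the
  function to the left; its rate 1 / (p + 1) keeps it square-integrable and makes its boundary
  contribution small.\<close>

definition slope :: "(nat \<Rightarrow> complex) \<Rightarrow> nat \<Rightarrow> complex" where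
  "slope \<xi> k = (if k = 0 then \<xi> 1 / of_real (real p + 1) else (\<xi> (Suc k) - \<xi> k) / of_real (gap x k))"

text \<open>The defect of the piecewise linear interpolant in the jump condition at
  \<open>x k\<close>. For k \<ge> 2 it is the k-th row of the Jacobi matrix applied to \<xi>, so its
  pairing with \<xi> produces the Jacobi form.\<close>

definition kink :: "(nat \<Rightarrow> complex) \<Rightarrow> nat \<Rightarrow> complex" where
  "kink \<xi> k = of_real (\<alpha> k) * \<xi> k + slope \<xi> (k - 1) - slope \<xi> k"

definition branch :: "(nat \<Rightarrow> complex) \<Rightarrow> nat \<Rightarrow> real \<Rightarrow> complex" where
  "branch \<xi> k t = (if k = 0 then \<xi> 1 * of_real (exp ((t - x 1) / (real p + 1)))
     else \<xi> k + slope \<xi> k * of_real (t - x k) + kink \<xi> k * of_real (bump p (gap x k) (t - x k)))"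

definition branch1 :: "(nat \<Rightarrow> complex) \<Rightarrow> nat \<Rightarrow> real \<Rightarrow> complex" where
  "branch1 \<xi> k t = (if k = 0 then \<xi> 1 * of_real (exp ((t - x 1) / (real p + 1)) / (real p + 1))
     else slope \<xi> k + kink \<xi> k * of_real (bump1 p (gap x k) (t - x k)))"

definition branch2 :: "(nat \<Rightarrow> complex) \<Rightarrow> nat \<Rightarrow> real \<Rightarrow> complex" where
  "branch2 \<xi> k t = (if k = 0 then \<xi> 1 * of_real (exp ((t - x 1) / (real p + 1)) / (real p + 1)\<^sup>2)
     else kink \<xi> k * of_real (bump2 p (gap x k) (t - x k)))"

text \<open>These pieces partition the line, so at each t at most one summand of
  \<open>trial\<close> is nonzero.\<close>

definition half_open_piece :: "nat \<Rightarrow> real set" where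
  "half_open_piece k = (if k = 0 then {..<x 1} else {x k..<x (Suc k)})"

text \<open>The sum goes one piece beyond the support of \<xi>: the kink at \<open>Suc n\<close> is
  the slope of piece n, which a final bump has to bring to 0.\<close>

definition trial :: "(nat \<Rightarrow> complex) \<Rightarrow> nat \<Rightarrow> real \<Rightarrow> complex" where
  "trial \<xi> n t = (\<Sum>k\<le>Suc n. indicator (half_open_piece k) t * branch \<xi> k t)"

definition trial2 :: "(nat \<Rightarrow> complex) \<Rightarrow> nat \<Rightarrow> real \<Rightarrow> complex" where
  "trial2 \<xi> n t = (\<Sum>k\<le>Suc n. indicator (half_open_piece k) t * branch2 \<xi> k t)"

lemma slope_sum: "slope (\<lambda>i. \<Sum>j\<in>I. c j * \<eta> j i) k = (\<Sum>j\<in>I. c j * slope (\<eta> j) k)"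
  by (simp add: slope_def sum_divide_distrib sum_subtractf right_diff_distrib diff_divide_distrib)

lemma kink_sum: "kink (\<lambda>i. \<Sum>j\<in>I. c j * \<eta> j i) k = (\<Sum>j\<in>I. c j * kink (\<eta> j) k)"
  by (simp add: kink_def slope_sum sum_distrib_left sum_subtractf sum.distrib distrib_left
      right_diff_distrib mult.left_commute)

lemma branch_sum: "branch (\<lambda>i. \<Sum>j\<in>I. c j * \<eta> j i) k t = (\<Sum>j\<in>I. c j * branch (\<eta> j) k t)"
  by (simp add: branch_def slope_sum kink_sum sum_distrib_right sum.distrib distrib_left mult.assoc)

text \<open>Linearity in the node values turns membership in the kernel of a spectral projection
  into linear equations for the coefficients.\<close>

lemma trial_sum: "trial (\<lambda>i. \<Sum>j\<in>I. c j * \<eta> j i) n t = (\<Sum>j\<in>I. c j * trial (\<eta> j) n t)"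
  unfolding trial_def branch_sum sum_distrib_left
  by (subst sum.swap) (simp add: mult.left_commute)

lemma branch_deriv:
  "(branch \<xi> k has_vector_derivative branch1 \<xi> k t) (at t)"
  "(branch1 \<xi> k has_vector_derivative branch2 \<xi> k t) (at t)"
proof -
  have e: "((\<lambda>t. exp ((t - x 1) / (real p + 1)) * c) has_real_derivative exp ((t - x 1) / (real p + 1)) / (real p + 1) * c) (at t)" for c
    by (auto intro!: derivative_eq_intros)
  have g: "gap x k \<noteq> 0" if "k \<noteq> 0" using gap_pos[of k] that by simp
  have sh: "((\<lambda>t. t - x k) has_real_derivative 1) (at t)" by (auto intro!: derivative_eq_intros)
  show "(branch \<xi> k has_vector_derivative branch1 \<xi> k t) (at t)"
  proof (cases "k = 0")
    case True
    have "((\<lambda>t. complex_of_real (exp ((t - x 1) / (real p + 1)))) has_vector_derivative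
      of_real (exp ((t - x 1) / (real p + 1)) / (real p + 1))) (at t)"
      using e[of 1] by (intro has_vector_derivative_of_real) simp
    then have "((\<lambda>t. \<xi> 1 * of_real (exp ((t - x 1) / (real p + 1)))) has_vector_derivative
      \<xi> 1 * of_real (exp ((t - x 1) / (real p + 1)) / (real p + 1))) (at t)"
      by (rule has_vector_derivative_mult_right)
    then show ?thesis using True by (simp add: branch_def[abs_def] branch1_def)
  next
    case False
    have b: "((\<lambda>t. bump p (gap x k) (t - x k)) has_real_derivative bump1 p (gap x k) (t - x k)) (at t)"
      using DERIV_chain2[OF bump_deriv(1)[OF g[OF False]] sh] by simp
    have "((\<lambda>t. \<xi> k + slope \<xi> k * of_real (t - x k) + kink \<xi> k * of_real (bump p (gap x k) (t - x k)))
      has_vector_derivative (0 + slope \<xi> k * of_real 1 + kink \<xi> k * of_real (bump1 p (gap x k) (t - x k)))) (at t)"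
      by (intro has_vector_derivative_add has_vector_derivative_const has_vector_derivative_mult_right
          has_vector_derivative_of_real sh b)
    then show ?thesis
      unfolding branch_def[abs_def] branch1_def using False by simp
  qed
  show "(branch1 \<xi> k has_vector_derivative branch2 \<xi> k t) (at t)"
  proof (cases "k = 0")
    case True
    have "((\<lambda>t. complex_of_real (exp ((t - x 1) / (real p + 1)) / (real p + 1))) has_vector_derivative
      of_real (exp ((t - x 1) / (real p + 1)) / (real p + 1)\<^sup>2)) (at t)"
      using e[of "1 / (real p + 1)"] by (intro has_vector_derivative_of_real) (simp add: power2_eq_square)
    then have "((\<lambda>t. \<xi> 1 * of_real (exp ((t - x 1) / (real p + 1)) / (real p + 1))) has_vector_derivative
      \<xi> 1 * of_real (exp ((t - x 1) / (real p + 1)) / (real p + 1)\<^sup>2)) (at t)"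
      by (rule has_vector_derivative_mult_right)
    then show ?thesis using True by (simp add: branch1_def[abs_def] branch2_def)
  next
    case False
    have b: "((\<lambda>t. bump1 p (gap x k) (t - x k)) has_real_derivative bump2 p (gap x k) (t - x k)) (at t)"
      using DERIV_chain2[OF bump_deriv(2)[OF g[OF False]] sh] by simp
    have "((\<lambda>t. slope \<xi> k + kink \<xi> k * of_real (bump1 p (gap x k) (t - x k)))
      has_vector_derivative (0 + kink \<xi> k * of_real (bump2 p (gap x k) (t - x k)))) (at t)"
      by (intro has_vector_derivative_add has_vector_derivative_const has_vector_derivative_mult_right
          has_vector_derivative_of_real b)
    then show ?thesis
      unfolding branch1_def[abs_def] branch2_def using False by simp
  qed
qed

lemma branch_continuous:
  "continuous_on S (branch \<xi> k)" "continuous_on S (branch1 \<xi> k)" "continuous_on S (branch2 \<xi> k)"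
proof -
  have c: "continuous_on S F" if "\<And>t. (F has_vector_derivative F' t) (at t)" for F F' :: "real \<Rightarrow> complex"
    using has_derivative_continuous[OF that[unfolded has_vector_derivative_def]]
    by (intro continuous_at_imp_continuous_on ballI)
  show "continuous_on S (branch \<xi> k)" "continuous_on S (branch1 \<xi> k)"
    by (rule c[OF branch_deriv(1)], rule c[OF branch_deriv(2)])
  have "continuous_on S (\<lambda>t. bump2 p (gap x k) (t - x k))" if "k \<noteq> 0"
    unfolding bump2_def using gap_pos[of k] that by (intro continuous_intros) auto
  moreover have "continuous_on S (\<lambda>t. exp ((t - x 1) / (real p + 1)) / (real p + 1)\<^sup>2)"
    by (intro continuous_intros) auto
  ultimately have "continuous_on S (\<lambda>t. if k = 0 then \<xi> 1 * of_real (exp ((t - x 1) / (real p + 1)) / (real p + 1)\<^sup>2)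
     else kink \<xi> k * of_real (bump2 p (gap x k) (t - x k)))"
    by (cases "k = 0") (simp_all only: if_True if_False simp_thms, (intro continuous_on_mult continuous_on_const continuous_on_of_real; simp)+)
  then show "continuous_on S (branch2 \<xi> k)"
    unfolding branch2_def[abs_def] .
qed

lemma half_open_piece_unique:
  assumes "t \<in> half_open_piece j" "t \<in> half_open_piece k"
  shows "j = k"
proof -
  have "t \<notin> half_open_piece k" if "t \<in> half_open_piece j" "j < k" for j k
  proof -
    have "t < x (Suc j)" using that(1) by (simp add: half_open_piece_def split: if_splits)
    also have "x (Suc j) \<le> x k" using that(2) by (intro x_mono) auto
    finally show ?thesis using that(2) by (simp add: half_open_piece_def)
  qed
  then show ?thesis using assms by (cases j k rule: linorder_cases) blast+
qed

lemma indicator_half_open_piece: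
  assumes "t \<in> half_open_piece k"
  shows "indicator (half_open_piece j) t = (if j = k then 1 else (0 :: 'a :: zero_neq_one))"
proof (cases "j = k")
  case False
  then have "t \<notin> half_open_piece j" using half_open_piece_unique[OF assms, of j] by blast
  with False show ?thesis by simp
qed (use assms in simp)

lemma sum_half_open_piece:
  assumes "t \<in> half_open_piece k" "k > n \<Longrightarrow> F k = (0 :: complex)"
  shows "(\<Sum>j\<le>n. indicator (half_open_piece j) t * F j) = F k"
proof -
  have "(\<Sum>j\<le>n. indicator (half_open_piece j) t * F j) = (\<Sum>j\<le>n. if j = k then F j else 0)"
    by (intro sum.cong) (simp_all add: indicator_half_open_piece[OF assms(1)])
  then show ?thesis using assms(2) by simp
qed

lemma open_piece_half_open: "open_piece k \<subseteq> half_open_piece k"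
  by (auto simp: open_piece_def half_open_piece_def)

context
  fixes \<xi> :: "nat \<Rightarrow> complex" and n :: nat
  assumes support: "\<And>k. k > n \<Longrightarrow> \<xi> k = 0"
begin

lemma branch_zero:
  assumes "k > Suc n"
  shows "kink \<xi> k = 0" "branch \<xi> k t = 0" "branch1 \<xi> k t = 0" "branch2 \<xi> k t = 0"
proof -
  obtain m where m: "k = Suc (Suc m)" "m \<ge> n"
    using assms by (cases k rule: nat.exhaust; cases "k - 1") auto
  have z: "\<xi> (Suc m) = 0" "\<xi> (Suc (Suc m)) = 0" "\<xi> (Suc (Suc (Suc m))) = 0"
    using m(2) by (simp_all add: support)
  have s: "slope \<xi> k = 0" "slope \<xi> (k - 1) = 0" by (simp_all add: slope_def z m)
  show q: "kink \<xi> k = 0" using s z by (simp add: kink_def m)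
  show "branch \<xi> k t = 0" "branch1 \<xi> k t = 0" "branch2 \<xi> k t = 0"
    using s z q by (simp_all add: branch_def branch1_def branch2_def m)
qed

lemma trial_eq: "t \<in> half_open_piece k \<Longrightarrow> trial \<xi> n t = branch \<xi> k t"
  and trial2_eq: "t \<in> half_open_piece k \<Longrightarrow> trial2 \<xi> n t = branch2 \<xi> k t"
  unfolding trial_def trial2_def by (rule sum_half_open_piece, simp, simp add: branch_zero)+

lemma trial_deriv:
  assumes t: "t \<in> open_piece k"
  shows "derivative (trial \<xi> n) t = branch1 \<xi> k t"
    and "derivative (derivative (trial \<xi> n)) t = trial2 \<xi> n t"
    and "(trial \<xi> n has_vector_derivative branch1 \<xi> k t) (at t)"
    and "(derivative (trial \<xi> n) has_vector_derivative branch2 \<xi> k t) (at t)"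
proof -
  have d: "(trial \<xi> n has_vector_derivative branch1 \<xi> k t) (at t)" if "t \<in> open_piece k" for t
    by (rule has_vector_derivative_transform_within_open[OF branch_deriv(1) open_open_piece that])
      (use trial_eq open_piece_half_open in \<open>metis subsetD\<close>)
  then have d': "derivative (trial \<xi> n) t = branch1 \<xi> k t" if "t \<in> open_piece k" for t
    using that by (auto intro: vector_derivative_at)
  show "derivative (trial \<xi> n) t = branch1 \<xi> k t" by (rule d'[OF t])
  show "(trial \<xi> n has_vector_derivative branch1 \<xi> k t) (at t)" by (rule d[OF t])
  show d2: "(derivative (trial \<xi> n) has_vector_derivative branch2 \<xi> k t) (at t)"
    by (rule has_vector_derivative_transform_within_open[OF branch_deriv(2) open_open_piece t]) (simp add: d')
  show "derivative (derivative (trial \<xi> n)) t = trial2 \<xi> n t"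
    using vector_derivative_at[OF d2] trial2_eq t open_piece_half_open by (metis subsetD)
qed

lemma piece_of_interval:
  assumes "{a..b} \<subseteq> - X" "a \<le> b"
  obtains k where "{a..b} \<subseteq> open_piece k"
proof -
  have "a \<notin> X" using assms by force
  then obtain k where k: "a \<in> open_piece k" using ex_open_piece by blast
  have "x (Suc k) \<in> X" by simp
  then have "x (Suc k) \<notin> {a..b}" using assms by blast
  then have "b < x (Suc k)" using k by (auto simp: open_piece_def split: if_splits)
  then have "b \<in> open_piece k" using k assms(2) by (auto simp: open_piece_def split: if_splits)
  then show thesis using that open_piece_interval[OF k] by blast
qed

lemma exp_tail_integrable:
  fixes a c :: real
  assumes "c > 0"
  shows "integrable lebesgue (\<lambda>t. indicator {..a} t * exp ((t - a) * c))"
proof -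
  have "(\<lambda>t. exp (- c * t)) integrable_on {0..}"
    by (rule integrable_on_exp_minus_to_infinity[OF assms])
  then have "(\<lambda>t. exp (- c * t)) absolutely_integrable_on {0..}"
    by (intro nonnegative_absolutely_integrable_1) auto
  then have "integrable lborel (\<lambda>t. indicator {0..} t * exp (- c * t))"
    unfolding set_integrable_def by (subst (asm) integrable_completion) auto
  then have "integrable lborel (\<lambda>t. indicator {0..} (a + (- 1) * t) * exp (- c * (a + (- 1) * t)))"
    by (rule lborel_integrable_real_affine) simp
  moreover have "(\<lambda>t. indicator {0..} (a + (- 1) * t) * exp (- c * (a + (- 1) * t))) = (\<lambda>t. indicator {..a} t * exp ((t - a) * c))"
    by (auto simp: fun_eq_iff indicator_def algebra_simps)
  ultimately show ?thesis by (subst integrable_completion) auto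
qed

lemma square_integrable_pieces:
  assumes F: "\<And>k. continuous_on UNIV (F k)" and F0: "\<And>t. F 0 t = c * of_real (exp ((t - x 1) / (real p + 1)))"
  shows "square_integrable (\<lambda>t. \<Sum>k\<le>N. indicator (half_open_piece k) t * F k t)"
proof -
  have "square_integrable (\<lambda>t. indicator (half_open_piece k) t * F k t)" for k
  proof -
    have m: "(\<lambda>t. indicator (half_open_piece k) t * F k t) \<in> borel_measurable lebesgue"
    proof -
      have "F k \<in> borel_measurable lborel" using F[of k] by (simp add: borel_measurable_continuous_onI)
      then have "(\<lambda>t. indicator (half_open_piece k) t * F k t) \<in> borel_measurable lborel"
        by (intro borel_measurable_times borel_measurable_indicator) (auto simp: half_open_piece_def)
      then show ?thesis by (rule measurable_completion)
    qed
    show ?thesis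
    proof (cases "k = 0")
      case True
      have "integrable lebesgue (\<lambda>t. (cmod c)\<^sup>2 * (indicator {..x 1} t * exp ((t - x 1) * (2 / (real p + 1)))))"
        by (intro integrable_mult_right exp_tail_integrable) simp
      then have "integrable lebesgue (\<lambda>t. (cmod (indicator (half_open_piece k) t * F k t))\<^sup>2)"
      proof (rule Bochner_Integration.integrable_bound)
        show "(\<lambda>t. (cmod (indicator (half_open_piece k) t * F k t))\<^sup>2) \<in> borel_measurable lebesgue"
          using m by measurable
        have "(exp ((t - x 1) / (real p + 1)))\<^sup>2 = exp ((t - x 1) * (2 / (real p + 1)))" for t
          by (simp add: power2_eq_square exp_add[symmetric])
        then show "AE t in lebesgue. norm ((cmod (indicator (half_open_piece k) t * F k t))\<^sup>2)
          \<le> norm ((cmod c)\<^sup>2 * (indicator {..x 1} t * exp ((t - x 1) * (2 / (real p + 1)))))"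
          using True by (intro AE_I2) (auto simp: F0 indicator_def half_open_piece_def norm_mult power_mult_distrib)
      qed
      with m show ?thesis by (simp add: square_integrable_def)
    next
      case False
      have "bounded (F k ` {x k..x (Suc k)})"
        using continuous_on_subset[OF F[of k]] by (intro compact_imp_bounded compact_continuous_image) auto
      then obtain C where C: "C > 0" "\<And>t. t \<in> {x k..x (Suc k)} \<Longrightarrow> cmod (F k t) \<le> C"
        by (auto simp: bounded_pos)
      show ?thesis
        by (rule square_integrable_bounded_support[OF m, of "x k" "x (Suc k)" C])
          (use False C in \<open>auto simp: half_open_piece_def indicator_def\<close>)
    qed
  qed
  then show ?thesis
    using abs_L2_sum(1)[of "{..N}" "\<lambda>k t. indicator (half_open_piece k) t * F k t" "\<lambda>_. 1"] by simp
qed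

lemma square_integrable_trial: "square_integrable (trial \<xi> n)" "square_integrable (trial2 \<xi> n)"
proof -
  show "square_integrable (trial \<xi> n)"
    unfolding trial_def[abs_def] by (rule square_integrable_pieces[OF branch_continuous(1)]) (simp add: branch_def)
  show "square_integrable (trial2 \<xi> n)"
    unfolding trial2_def[abs_def]
    by (rule square_integrable_pieces[OF branch_continuous(3), where c = "\<xi> 1 / of_real ((real p + 1)\<^sup>2)"]) (simp add: branch2_def)
qed

lemma trial_in_domain: "(abs_L2 (trial \<xi> n), abs_L2 (\<lambda>t. - trial2 \<xi> n t)) \<in> delta_operator x \<alpha>"
proof -
  have der2: "derivative (derivative (trial \<xi> n)) t = trial2 \<xi> n t" if "t \<notin> X" for t
    using ex_open_piece[OF that] trial_deriv(2) by blast
  have "L2_eq (trial2 \<xi> n) (derivative (derivative (trial \<xi> n)))"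
    by (rule L2_eq_countable_difference[OF square_integrable_trial(2), of X]) (simp_all add: der2)
  then have sq2: "square_integrable (derivative (derivative (trial \<xi> n)))" by (simp add: L2_eq_def)
  have "trial \<xi> n \<in> sobolev22 X"
    unfolding sobolev22_def AC_loc_def
  proof (intro CollectI conjI allI impI)
    fix a b assume ab: "{a..b} \<subseteq> - X"
    show "absolutely_continuous_interval a b (trial \<xi> n)"
    proof (cases "a \<le> b")
      case True
      obtain k where k: "{a..b} \<subseteq> open_piece k" by (rule piece_of_interval[OF ab True])
      show ?thesis
        by (rule absolutely_continuous_of_derivative[OF trial_deriv(3) branch_continuous(2)]) (use k in auto)
    qed (auto intro: absolutely_continuous_of_derivative[where f' = "\<lambda>_. 0"])
    show "absolutely_continuous_interval a b (derivative (trial \<xi> n))"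
    proof (cases "a \<le> b")
      case True
      obtain k where k: "{a..b} \<subseteq> open_piece k" by (rule piece_of_interval[OF ab True])
      show ?thesis
        by (rule absolutely_continuous_of_derivative[OF trial_deriv(4) branch_continuous(3)]) (use k in auto)
    qed (auto intro: absolutely_continuous_of_derivative[where f' = "\<lambda>_. 0"])
  qed (fact square_integrable_trial(1) sq2)+
  moreover have "interface_conditions x \<alpha> (trial \<xi> n)"
    unfolding interface_conditions_def
  proof (intro allI impI)
    fix k :: nat assume k: "k \<ge> 1"
    have g: "gap x (k - 1) \<noteq> 0" if "k - 1 \<noteq> 0"
    proof -
      have "k - 1 \<ge> 1" using that by simp
      from gap_pos[OF this] show ?thesis by simp
    qed
    \<comment> \<open>A bump has slope 1 at the left end and 0 at the right end of its piece. It
      therefore corrects the slope after \<open>x k\<close> and leaves the slope before the next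
      node alone.\<close>
    have ends: "branch \<xi> k (x k) = \<xi> k" "branch \<xi> (k - 1) (x k) = \<xi> k"
      "branch1 \<xi> k (x k) = slope \<xi> k + kink \<xi> k" "branch1 \<xi> (k - 1) (x k) = slope \<xi> (k - 1)"
    proof -
      show "branch \<xi> k (x k) = \<xi> k" "branch1 \<xi> k (x k) = slope \<xi> k + kink \<xi> k"
        using k by (simp_all add: branch_def branch1_def)
      have e: "x k - x (k - 1) = gap x (k - 1)" using k by (simp add: gap_def)
      show "branch \<xi> (k - 1) (x k) = \<xi> k" "branch1 \<xi> (k - 1) (x k) = slope \<xi> (k - 1)"
        using k g unfolding branch_def branch1_def e
        by (auto simp: slope_def)
    qed
    have lim: "(F \<longlongrightarrow> F (x k)) (at (x k) within S)" if "continuous_on UNIV F" for F :: "real \<Rightarrow> complex" and S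
      using that by (auto simp: continuous_on_def intro: tendsto_within_subset)
    show "\<exists>v p m. (trial \<xi> n \<longlongrightarrow> v) (at_right (x k)) \<and> (trial \<xi> n \<longlongrightarrow> v) (at_left (x k)) \<and>
        (derivative (trial \<xi> n) \<longlongrightarrow> p) (at_right (x k)) \<and> (derivative (trial \<xi> n) \<longlongrightarrow> m) (at_left (x k)) \<and>
        p - m = complex_of_real (\<alpha> k) * v"
    proof (intro exI conjI)
      show "(trial \<xi> n \<longlongrightarrow> \<xi> k) (at_right (x k))"
        by (rule Lim_transform_eventually[OF lim[OF branch_continuous(1), of \<xi> k, unfolded ends]])
          (use eventually_open_piece(1)[OF k] trial_eq[symmetric] open_piece_half_open in \<open>auto elim!: eventually_mono\<close>)
      show "(trial \<xi> n \<longlongrightarrow> \<xi> k) (at_left (x k))"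
        by (rule Lim_transform_eventually[OF lim[OF branch_continuous(1), of \<xi> "k - 1", unfolded ends]])
          (use eventually_open_piece(2)[OF k] trial_eq[symmetric] open_piece_half_open in \<open>auto elim!: eventually_mono\<close>)
      show "(derivative (trial \<xi> n) \<longlongrightarrow> slope \<xi> k + kink \<xi> k) (at_right (x k))"
        by (rule Lim_transform_eventually[OF lim[OF branch_continuous(2), of \<xi> k, unfolded ends]])
          (use eventually_open_piece(1)[OF k] trial_deriv(1)[symmetric] in \<open>auto elim!: eventually_mono\<close>)
      show "(derivative (trial \<xi> n) \<longlongrightarrow> slope \<xi> (k - 1)) (at_left (x k))"
        by (rule Lim_transform_eventually[OF lim[OF branch_continuous(2), of \<xi> "k - 1", unfolded ends]])
          (use eventually_open_piece(2)[OF k] trial_deriv(1)[symmetric] in \<open>auto elim!: eventually_mono\<close>)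
      show "slope \<xi> k + kink \<xi> k - slope \<xi> (k - 1) = complex_of_real (\<alpha> k) * \<xi> k"
        by (simp add: kink_def)
    qed
  qed
  ultimately have "(abs_L2 (trial \<xi> n), abs_L2 (\<lambda>t. - derivative (derivative (trial \<xi> n)) t)) \<in> delta_operator x \<alpha>"
    by (auto simp: delta_operator_def)
  moreover have "L2_eq (\<lambda>t. - trial2 \<xi> n t) (\<lambda>t. - derivative (derivative (trial \<xi> n)) t)"
    using square_integrable_scale[OF square_integrable_trial(2), of "- 1"] der2
    by (intro L2_eq_countable_difference[of _ X]) auto
  then have "abs_L2 (\<lambda>t. - derivative (derivative (trial \<xi> n)) t) = abs_L2 (\<lambda>t. - trial2 \<xi> n t)"
    by (simp add: L2_eq_def abs_L2_eq_iff AE_symmetric)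
  ultimately show ?thesis by simp
qed

end

end

text \<open>The second derivative is the kink times \<open>bump2\<close>. Its pairing with the
  constant part of the branch gives the main term, with the linear part nothing, and with the bump
  the error of order 1 / p.\<close>

lemma branch_energy:
  assumes k: "k \<ge> 1"
  obtains i where "((\<lambda>t. Re (- branch2 \<alpha> p \<xi> k t * cnj (branch \<alpha> p \<xi> k t))) has_integral i) {x k..x (Suc k)}"
    "i \<le> Re (kink \<alpha> p \<xi> k * cnj (\<xi> k)) + (cmod (kink \<alpha> p \<xi> k))\<^sup>2 * (gap x k / (real p + 1))"
proof -
  define d where "d = gap x k"
  have d: "d > 0" using gap_pos[OF k] by (simp add: d_def)
  define C where "C = kink \<alpha> p \<xi> k"
  define S where "S = slope p \<xi> k"
  obtain I where I: "((\<lambda>t. bump p d t * bump2 p d t) has_integral - I) {0..d}" "I \<le> d / (real p + 1)"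
    using bump_integrals(3)[OF d] by blast
  define A B where "A = Re (C * cnj (\<xi> k))" and "B = Re (C * cnj S)"
  have "((\<lambda>t. - A * bump2 p d t + - B * (t * bump2 p d t) + - (cmod C)\<^sup>2 * (bump p d t * bump2 p d t))
      has_integral (- A * - 1 + - B * 0 + - (cmod C)\<^sup>2 * - I)) {0..d}"
    by (intro has_integral_add has_integral_mult_right bump_integrals(1,2)[OF d] I(1))
  then have "((\<lambda>t. - A * bump2 p d (t - x k) + - B * ((t - x k) * bump2 p d (t - x k)) + - (cmod C)\<^sup>2 * (bump p d (t - x k) * bump2 p d (t - x k)))
      has_integral (- A * - 1 + - B * 0 + - (cmod C)\<^sup>2 * - I)) {x k..x k + d}"
    by (rule has_integral_translate)
  moreover have "x k + d = x (Suc k)" by (simp add: d_def gap_def)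
  moreover have "- A * bump2 p d (t - x k) + - B * ((t - x k) * bump2 p d (t - x k)) + - (cmod C)\<^sup>2 * (bump p d (t - x k) * bump2 p d (t - x k))
      = Re (- branch2 \<alpha> p \<xi> k t * cnj (branch \<alpha> p \<xi> k t))" for t
  proof -
    define b b2 \<tau> where "b = bump p d (t - x k)" and "b2 = bump2 p d (t - x k)" and "\<tau> = t - x k"
    have e: "branch \<alpha> p \<xi> k t = \<xi> k + S * of_real \<tau> + C * of_real b" "branch2 \<alpha> p \<xi> k t = C * of_real b2"
      using k by (simp_all add: branch_def branch2_def S_def C_def b_def b2_def \<tau>_def d_def)
    show ?thesis
      unfolding e A_def B_def cmod_power2 b_def b2_def \<tau>_def
      by (simp add: algebra_simps power2_eq_square)
  qed
  ultimately have "((\<lambda>t. Re (- branch2 \<alpha> p \<xi> k t * cnj (branch \<alpha> p \<xi> k t))) has_integral (A + (cmod C)\<^sup>2 * I)) {x k..x (Suc k)}"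
    by (simp only:) simp
  moreover have "(cmod C)\<^sup>2 * I \<le> (cmod C)\<^sup>2 * (d / (real p + 1))"
    using I(2) by (rule mult_left_mono) simp
  ultimately show thesis
    by (intro that[of "A + (cmod C)\<^sup>2 * I"]) (simp_all add: A_def C_def d_def)
qed

lemma ex_half_open_piece: "\<exists>k. t \<in> half_open_piece k"
proof (cases "t \<in> X")
  case True
  then obtain k where "k \<ge> 1" "t = x k" by auto
  then show ?thesis using gap_pos[of k] by (intro exI[of _ k]) (auto simp: half_open_piece_def gap_def)
next
  case False
  then show ?thesis using ex_open_piece[OF False] open_piece_half_open by blast
qed

text \<open>Only an upper bound is needed: the convex exponential tail contributes a negative amount.\<close>

lemma trial_energy:
  assumes support: "\<And>k. k > n \<Longrightarrow> \<xi> k = 0"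
  shows "Re (cinner (abs_L2 (\<lambda>t. - trial2 \<alpha> p \<xi> n t)) (abs_L2 (trial \<alpha> p \<xi> n)))
    \<le> (\<Sum>k=1..Suc n. Re (kink \<alpha> p \<xi> k * cnj (\<xi> k)) + (cmod (kink \<alpha> p \<xi> k))\<^sup>2 * (gap x k / (real p + 1)))"
proof -
  define \<rho> where "\<rho> k t = Re (- branch2 \<alpha> p \<xi> k t * cnj (branch \<alpha> p \<xi> k t))" for k t
  define \<phi> where "\<phi> t = - trial2 \<alpha> p \<xi> n t * cnj (trial \<alpha> p \<xi> n t)" for t
  have sq: "square_integrable (trial \<alpha> p \<xi> n)" "square_integrable (\<lambda>t. - trial2 \<alpha> p \<xi> n t)"
    using square_integrable_trial[OF support, where \<alpha> = \<alpha> and p = p]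
      square_integrable_scale[OF square_integrable_trial(2)[OF support, where \<alpha> = \<alpha> and p = p], where c = "- 1"]
    by simp_all
  have "\<exists>i. (\<rho> k has_integral i) {x k..x (Suc k)} \<and>
      i \<le> Re (kink \<alpha> p \<xi> k * cnj (\<xi> k)) + (cmod (kink \<alpha> p \<xi> k))\<^sup>2 * (gap x k / (real p + 1))" if "k \<ge> 1" for k
    unfolding \<rho>_def[abs_def] by (rule branch_energy[OF that]) (intro exI conjI)
  then have "\<forall>k. \<exists>i. k \<ge> 1 \<longrightarrow> (\<rho> k has_integral i) {x k..x (Suc k)} \<and>
      i \<le> Re (kink \<alpha> p \<xi> k * cnj (\<xi> k)) + (cmod (kink \<alpha> p \<xi> k))\<^sup>2 * (gap x k / (real p + 1))"
    by blast
  from choice[OF this] obtain i where i: "\<And>k. k \<ge> 1 \<Longrightarrow> (\<rho> k has_integral i k) {x k..x (Suc k)}"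
    "\<And>k. k \<ge> 1 \<Longrightarrow> i k \<le> Re (kink \<alpha> p \<xi> k * cnj (\<xi> k)) + (cmod (kink \<alpha> p \<xi> k))\<^sup>2 * (gap x k / (real p + 1))"
    by blast
  have int: "integrable lebesgue \<phi>"
    unfolding \<phi>_def[abs_def] by (rule integrable_mult_cnj[OF sq(2,1)])
  have piece: "((\<lambda>t. indicator (half_open_piece k) t * \<rho> k t) has_integral i k) UNIV" if k: "k \<ge> 1" for k
  proof -
    have "((\<lambda>t. if t \<in> {x k..x (Suc k)} then \<rho> k t else 0) has_integral i k) UNIV"
      using i(1)[OF k] by (simp only: has_integral_restrict_UNIV)
    then show ?thesis
      by (rule has_integral_spike_finite[of "{x (Suc k)}", rotated 2])
        (use k in \<open>auto simp: half_open_piece_def indicator_def\<close>)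
  qed
  have right: "((\<lambda>t. \<Sum>k=1..Suc n. indicator (half_open_piece k) t * \<rho> k t) has_integral (\<Sum>k=1..Suc n. i k)) UNIV"
    using piece by (intro has_integral_sum) auto
  have "(\<phi> has_integral (LINT t|lebesgue. \<phi> t)) UNIV"
    using int by (rule has_integral_integral_lebesgue)
  then have left: "((\<lambda>t. Re (\<phi> t)) has_integral Re (LINT t|lebesgue. \<phi> t)) UNIV"
    by (rule has_integral_Re)
  have "Re (\<phi> t) \<le> (\<Sum>k=1..Suc n. indicator (half_open_piece k) t * \<rho> k t)" for t
  proof -
    obtain j where j: "t \<in> half_open_piece j" using ex_half_open_piece by blast
    have ind: "indicator (half_open_piece k) t = (if k = j then 1 else (0 :: real))" for k
      by (rule indicator_half_open_piece[OF j])
    have \<phi>: "\<phi> t = - branch2 \<alpha> p \<xi> j t * cnj (branch \<alpha> p \<xi> j t)"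
      by (simp only: \<phi>_def trial_eq[OF support j] trial2_eq[OF support j])
    have "(\<Sum>k=1..Suc n. indicator (half_open_piece k) t * \<rho> k t) = (\<Sum>k=1..Suc n. if k = j then \<rho> k t else 0)"
      by (intro sum.cong) (simp_all add: ind)
    also have "\<dots> = (if j \<in> {1..Suc n} then \<rho> j t else 0)" by simp
    finally have r: "(\<Sum>k=1..Suc n. indicator (half_open_piece k) t * \<rho> k t) = (if j \<in> {1..Suc n} then \<rho> j t else 0)" .
    consider "j \<in> {1..Suc n}" | "j > Suc n" | "j = 0"
      by (cases "j = 0"; cases "j > Suc n") auto
    then show ?thesis
    proof cases
      case 1
      then show ?thesis unfolding r by (simp only: \<phi> \<rho>_def if_True order_refl)
    next
      case 2
      then have "\<phi> t = 0" unfolding \<phi> by (simp add: branch_zero[OF support])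
      then show ?thesis unfolding r using 2 by simp
    next
      case 3
      define e where "e = exp ((t - x 1) / (real p + 1))"
      have "\<phi> t = - (of_real (e / (real p + 1)\<^sup>2 * e) * (\<xi> 1 * cnj (\<xi> 1)))"
        unfolding \<phi> 3 by (simp add: branch_def branch2_def e_def)
      also have "\<dots> = of_real (- (e / (real p + 1)\<^sup>2 * e * (cmod (\<xi> 1))\<^sup>2))"
        by (simp only: complex_norm_square[symmetric] of_real_mult[symmetric] of_real_minus[symmetric])
      finally have "Re (\<phi> t) = - (e / (real p + 1)\<^sup>2 * e * (cmod (\<xi> 1))\<^sup>2)"
        by (simp only: Re_complex_of_real)
      also have "\<dots> \<le> 0" by (simp add: e_def)
      finally show ?thesis unfolding r using 3 by simp
    qed
  qed
  then have "Re (LINT t|lebesgue. \<phi> t) \<le> (\<Sum>k=1..Suc n. i k)"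
    by (intro has_integral_le[OF left right])
  also have "\<dots> \<le> (\<Sum>k=1..Suc n. Re (kink \<alpha> p \<xi> k * cnj (\<xi> k)) + (cmod (kink \<alpha> p \<xi> k))\<^sup>2 * (gap x k / (real p + 1)))"
    by (intro sum_mono i(2)) auto
  finally show ?thesis
    unfolding cinner_abs_L2[OF sq(2,1)] \<phi>_def .
qed

text \<open>Summation by parts; the slope after the last node remains as a boundary term.\<close>

lemma sum_kink:
  assumes n: "n \<ge> 1"
  shows "(\<Sum>k=1..n. Re (kink \<alpha> p \<xi> k * cnj (\<xi> k))) = (\<Sum>k=1..n. \<alpha> k * (cmod (\<xi> k))\<^sup>2)
    + (\<Sum>k=1..<n. (cmod (\<xi> (Suc k) - \<xi> k))\<^sup>2 / gap x k) + (cmod (\<xi> 1))\<^sup>2 / (real p + 1)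
    - Re (slope p \<xi> n * cnj (\<xi> n))"
  using n
proof (induction n rule: dec_induct)
  case base
  have "slope p \<xi> 0 * cnj (\<xi> 1) = of_real ((cmod (\<xi> 1))\<^sup>2 / (real p + 1))"
    unfolding slope_def of_real_divide complex_norm_square by simp
  then have "kink \<alpha> p \<xi> 1 * cnj (\<xi> 1) = of_real (\<alpha> 1 * (cmod (\<xi> 1))\<^sup>2) + of_real ((cmod (\<xi> 1))\<^sup>2 / (real p + 1)) - slope p \<xi> 1 * cnj (\<xi> 1)"
    unfolding kink_def of_real_mult complex_norm_square by (simp add: algebra_simps)
  then have "Re (kink \<alpha> p \<xi> 1 * cnj (\<xi> 1)) = \<alpha> 1 * (cmod (\<xi> 1))\<^sup>2 + (cmod (\<xi> 1))\<^sup>2 / (real p + 1) - Re (slope p \<xi> 1 * cnj (\<xi> 1))"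
    by (simp only: plus_complex.sel minus_complex.sel Re_complex_of_real)
  then show ?case by simp
next
  case (step n)
  have "kink \<alpha> p \<xi> (Suc n) * cnj (\<xi> (Suc n)) = of_real (\<alpha> (Suc n) * (cmod (\<xi> (Suc n)))\<^sup>2)
      + slope p \<xi> n * cnj (\<xi> (Suc n)) - slope p \<xi> (Suc n) * cnj (\<xi> (Suc n))"
    unfolding kink_def of_real_mult complex_norm_square by (simp add: algebra_simps)
  moreover have "slope p \<xi> n * cnj (\<xi> (Suc n)) = slope p \<xi> n * cnj (\<xi> n) + of_real ((cmod (\<xi> (Suc n) - \<xi> n))\<^sup>2 / gap x n)"
    unfolding of_real_divide complex_norm_square using step.hyps by (simp add: slope_def diff_divide_distrib add_divide_distrib algebra_simps)
  ultimately have "Re (kink \<alpha> p \<xi> (Suc n) * cnj (\<xi> (Suc n))) = \<alpha> (Suc n) * (cmod (\<xi> (Suc n)))\<^sup>2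
      + (Re (slope p \<xi> n * cnj (\<xi> n)) + (cmod (\<xi> (Suc n) - \<xi> n))\<^sup>2 / gap x n) - Re (slope p \<xi> (Suc n) * cnj (\<xi> (Suc n)))"
    by (simp only: plus_complex.sel minus_complex.sel Re_complex_of_real)
  then show ?case
    using step by (simp del: times_complex.sel)
qed

text \<open>Coercivity bounds all nodes, slopes and kinks by a multiple of the square root of K J,
  with J minus the Jacobi form. The errors are then at most a multiple of J / (p + 1), so the
  condition on p involves only K and the data up to \<open>Suc n\<close>, not \<xi>.\<close>

lemma trial_negative:
  assumes n: "n \<ge> 1" and support: "\<And>k. k > n \<Longrightarrow> \<xi> k = 0"
    and K: "K \<ge> 0" "\<And>k. k \<in> {1..n} \<Longrightarrow> (cmod (\<xi> k))\<^sup>2 \<le> K * - jacobi_form x \<alpha> n \<xi>"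
    and p: "K * (1 + (\<Sum>k=1..Suc n. (\<bar>\<alpha> k\<bar> + 2 * (2 / d + 1))\<^sup>2 * gap x k)) < real p + 1"
    and J: "jacobi_form x \<alpha> n \<xi> < 0"
  shows "Re (cinner (abs_L2 (\<lambda>t. - trial2 \<alpha> p \<xi> n t)) (abs_L2 (trial \<alpha> p \<xi> n))) < 0"
proof -
  define J where "J = - jacobi_form x \<alpha> n \<xi>"
  have J0: "J > 0" using J by (simp add: J_def)
  define s where "s = sqrt (K * J)"
  have s: "s \<ge> 0" "s\<^sup>2 = K * J" using K(1) J0 by (auto simp: s_def)
  have \<xi>: "cmod (\<xi> k) \<le> s" if "k \<ge> 1" for k
  proof (cases "k \<le> n")
    case True
    then show ?thesis unfolding s_def using K(2)[of k] that by (auto simp: J_def intro!: real_le_rsqrt)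
  next
    case False
    then show ?thesis using support[of k] s by simp
  qed
  \<comment> \<open>The constant covers both kinds of pieces: 2 / d for a difference quotient of two
    nodes, and 1 for the exponential on the left.\<close>
  have slope: "cmod (slope p \<xi> k) \<le> (2 / d + 1) * s" for k
  proof (cases "k = 0")
    case True
    have "cmod (slope p \<xi> 0) = cmod (\<xi> 1) / (real p + 1)"
      by (simp add: slope_def norm_divide) (metis abs_of_nat norm_of_nat of_nat_Suc add.commute)
    also have "\<dots> \<le> cmod (\<xi> 1)" by (simp add: divide_le_eq mult_le_cancel_left1 distrib_left)
    also have "\<dots> \<le> s" by (rule \<xi>) simp
    also have "\<dots> \<le> (2 / d + 1) * s" using s d_pos by (simp add: distrib_right)
    finally show ?thesis using True by simp
  next
    case False
    then have g: "gap x k \<ge> d" using gap_ge[of k] by simp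
    have "cmod (slope p \<xi> k) = cmod (\<xi> (Suc k) - \<xi> k) / gap x k"
      using False g d_pos by (simp add: slope_def norm_divide)
    also have "\<dots> \<le> (s + s) / d"
      using \<xi>[of k] \<xi>[of "Suc k"] norm_triangle_ineq4[of "\<xi> (Suc k)" "\<xi> k"] False g d_pos s
      by (intro frac_le) auto
    also have "\<dots> \<le> (2 / d + 1) * s" using s by (simp add: distrib_right)
    finally show ?thesis .
  qed
  have kink_le: "(cmod (kink \<alpha> p \<xi> k))\<^sup>2 \<le> (\<bar>\<alpha> k\<bar> + 2 * (2 / d + 1))\<^sup>2 * (K * J)" if "k \<ge> 1" for k
  proof -
    have "cmod (kink \<alpha> p \<xi> k) \<le> cmod (of_real (\<alpha> k) * \<xi> k) + cmod (slope p \<xi> (k - 1)) + cmod (slope p \<xi> k)"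
      unfolding kink_def by (intro norm_triangle_le_diff norm_triangle_le add_mono order_refl)
    also have "\<dots> \<le> \<bar>\<alpha> k\<bar> * s + (2 / d + 1) * s + (2 / d + 1) * s"
      using \<xi>[OF that] by (intro add_mono slope) (simp add: norm_mult mult_left_mono)
    also have "\<dots> = (\<bar>\<alpha> k\<bar> + 2 * (2 / d + 1)) * s" by (simp add: algebra_simps)
    finally have "(cmod (kink \<alpha> p \<xi> k))\<^sup>2 \<le> ((\<bar>\<alpha> k\<bar> + 2 * (2 / d + 1)) * s)\<^sup>2"
      by (rule power_mono) simp
    then show ?thesis by (simp add: power_mult_distrib s)
  qed
  define M where "M = (\<Sum>k=1..Suc n. (\<bar>\<alpha> k\<bar> + 2 * (2 / d + 1))\<^sup>2 * gap x k)"
  \<comment> \<open>As \<xi> vanishes at \<open>Suc n\<close>, the boundary term of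
    \<open>sum_kink\<close> becomes exactly the boundary summand of
    \<open>jacobi_form\<close>.\<close>
  have last: "\<xi> (Suc n) = 0" by (simp add: support)
  have "slope p \<xi> n * cnj (\<xi> n) = of_real (- ((cmod (\<xi> n))\<^sup>2 / gap x n))"
    unfolding of_real_minus of_real_divide complex_norm_square using n last by (simp add: slope_def)
  then have "Re (slope p \<xi> n * cnj (\<xi> n)) = - ((cmod (\<xi> n))\<^sup>2 / gap x n)"
    by (simp only: Re_complex_of_real)
  then have 1: "(\<Sum>k=1..n. Re (kink \<alpha> p \<xi> k * cnj (\<xi> k))) = - J + (cmod (\<xi> 1))\<^sup>2 / (real p + 1)"
    unfolding sum_kink[OF n] J_def jacobi_form_def by simp
  have "(cmod (\<xi> 1))\<^sup>2 \<le> K * J" using K(2)[of 1] n by (simp add: J_def)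
  then have 2: "(cmod (\<xi> 1))\<^sup>2 / (real p + 1) \<le> K * J / (real p + 1)"
    by (intro divide_right_mono) auto
  have "(\<Sum>k=1..Suc n. (cmod (kink \<alpha> p \<xi> k))\<^sup>2 * (gap x k / (real p + 1)))
      \<le> (\<Sum>k=1..Suc n. (\<bar>\<alpha> k\<bar> + 2 * (2 / d + 1))\<^sup>2 * (K * J) * (gap x k / (real p + 1)))"
    using gap_pos by (intro sum_mono mult_right_mono kink_le) (auto intro: less_imp_le)
  also have "\<dots> = K * J / (real p + 1) * M"
    unfolding M_def sum_distrib_left by (intro sum.cong) auto
  finally have 3: "(\<Sum>k=1..Suc n. (cmod (kink \<alpha> p \<xi> k))\<^sup>2 * (gap x k / (real p + 1))) \<le> K * J / (real p + 1) * M" .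
  have "K * (1 + M) / (real p + 1) < 1"
    using p unfolding M_def[symmetric] by (simp add: pos_divide_less_eq)
  then have "J * (K * (1 + M) / (real p + 1)) < J * 1" using J0 by (intro mult_strict_left_mono)
  then have 4: "K * J / (real p + 1) + K * J / (real p + 1) * M < J"
    by (simp add: algebra_simps add_divide_distrib)
  have "Re (cinner (abs_L2 (\<lambda>t. - trial2 \<alpha> p \<xi> n t)) (abs_L2 (trial \<alpha> p \<xi> n)))
      \<le> (\<Sum>k=1..Suc n. Re (kink \<alpha> p \<xi> k * cnj (\<xi> k)) + (cmod (kink \<alpha> p \<xi> k))\<^sup>2 * (gap x k / (real p + 1)))"
    by (rule trial_energy[OF support])
  also have "\<dots> = (\<Sum>k=1..n. Re (kink \<alpha> p \<xi> k * cnj (\<xi> k))) + (\<Sum>k=1..Suc n. (cmod (kink \<alpha> p \<xi> k))\<^sup>2 * (gap x k / (real p + 1)))"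
    unfolding sum.distrib using last by simp
  finally show ?thesis using 1 2 3 4 by linarith
qed

section \<open>Counting negative squares\<close>

text \<open>If the spectral subspace had dimension less than the number of negative pivots, the kernel of its
  projection would meet the constrained finite sequences, on which the trial functions make the form
  negative.\<close>

lemma negative_squares_ge:
  assumes E: "is_spectral_measure E (delta_operator x \<alpha>)" and n: "n \<in> negative_pivots x \<alpha>"
  shows "enat (card (negative_pivots x \<alpha> \<inter> {1..n})) \<le> negative_squares E"
proof (rule ccontr)
  assume "\<not> ?thesis"
  then have "ecdim (range (E {..<0})) < enat (card (negative_pivots x \<alpha> \<inter> {1..n}))"
    by (simp add: negative_squares_def)
  then obtain B where B: "finite B" "cspan B = range (E {..<0})" "card B < card (negative_pivots x \<alpha> \<inter> {1..n})"
    by (rule ecdim_less_basis)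
  note pvm = is_spectral_measureD(1)[OF E]
  have n1: "n \<ge> 1" using n by (simp add: negative_pivots_def)
  obtain K where K: "K \<ge> 0" "\<And>\<xi> k. (\<forall>j>n. \<xi> j = 0) \<Longrightarrow>
      (\<forall>j\<in>constrained_pivots x \<alpha> n. pivot_constraint x \<alpha> \<xi> j = 0) \<Longrightarrow>
      k \<in> {1..n} \<Longrightarrow> (cmod (\<xi> k))\<^sup>2 \<le> K * - jacobi_form x \<alpha> n \<xi>"
    using jacobi_form_coercive[OF gap_pos n] by metis
  obtain p :: nat where p: "K * (1 + (\<Sum>k=1..Suc n. (\<bar>\<alpha> k\<bar> + 2 * (2 / d + 1))\<^sup>2 * gap x k)) < real p"
    using reals_Archimedean2 by blast
  define \<delta> :: "nat \<Rightarrow> nat \<Rightarrow> complex" where "\<delta> j i = (if i = j then 1 else 0)" for j i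
  define u where "u j = abs_L2 (trial \<alpha> p (\<delta> j) n)" for j
  have "\<forall>j. \<exists>a. E {..<0} (u j) = (\<Sum>b\<in>B. a b *\<^sub>C b)"
  proof
    fix j
    have "E {..<0} (u j) \<in> cspan B" using B(2) by blast
    then show "\<exists>a. E {..<0} (u j) = (\<Sum>b\<in>B. a b *\<^sub>C b)"
      unfolding complex_vector.span_finite[OF B(1)] by auto
  qed
  then obtain a where a: "\<And>j. E {..<0} (u j) = (\<Sum>b\<in>B. a j b *\<^sub>C b)" by metis
  \<comment> \<open>Two families of equations for the coefficients: \<open>Inl\<close> makes each
    coordinate of the spectral projection vanish, \<open>Inr\<close> imposes the pivot
    constraints.\<close>
  define A where "A e j = (case e of Inl b \<Rightarrow> a j b | Inr k \<Rightarrow> pivot_constraint x \<alpha> (\<delta> j) k)" for e :: "L2 + nat" and j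
  let ?C = "constrained_pivots x \<alpha> n"
  have fC: "finite ?C" by (simp add: constrained_pivots_def)
  \<comment> \<open>Here the count closes: fewer spectral coordinates than negative pivots, and the
    constraints leave at least that many free dimensions.\<close>
  have "card (B <+> ?C) < card {1..n}"
    using card_constrained_pivots[of x \<alpha> n] B(3) by (simp add: card_Plus[OF B(1) fC])
  then obtain c where c: "\<exists>j\<in>{1..n}. c j \<noteq> 0" "\<And>e. e \<in> B <+> ?C \<Longrightarrow> (\<Sum>j\<in>{1..n}. A e j * c j) = 0"
    using homogeneous_system_nontrivial[of "{1..n}" "B <+> ?C" A] B(1) fC by auto
  define \<xi> where "\<xi> i = (\<Sum>j\<in>{1..n}. c j * \<delta> j i)" for i
  have \<xi>_eq: "\<xi> i = (if i \<in> {1..n} then c i else 0)" for i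
    unfolding \<xi>_def \<delta>_def by (simp add: if_distrib[of "\<lambda>z. c _ * z"] cong: if_cong)
  have support: "\<xi> k = 0" if "k > n" for k using that by (simp add: \<xi>_eq)
  have constr: "pivot_constraint x \<alpha> \<xi> k = 0" if "k \<in> ?C" for k
    using c(2)[OF InrI[OF that]] unfolding \<xi>_def[abs_def] pivot_constraint_sum
    by (simp add: A_def mult.commute)
  have bound: "(cmod (\<xi> k))\<^sup>2 \<le> K * - jacobi_form x \<alpha> n \<xi>" if "k \<in> {1..n}" for k
    using K(2)[of \<xi> k] support constr that by blast
  obtain j where j: "j \<in> {1..n}" "c j \<noteq> 0" using c(1) by blast
  have "0 < (cmod (\<xi> j))\<^sup>2" using j by (simp add: \<xi>_eq)
  then have "0 < K * - jacobi_form x \<alpha> n \<xi>" using bound[OF j(1)] by linarith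
  then have neg: "jacobi_form x \<alpha> n \<xi> < 0" using K(1) by (simp add: zero_less_mult_iff mult_less_0_iff)
  let ?u = "abs_L2 (trial \<alpha> p \<xi> n)" and ?v = "abs_L2 (\<lambda>t. - trial2 \<alpha> p \<xi> n t)"
  have mem: "(?u, ?v) \<in> delta_operator x \<alpha>" by (rule trial_in_domain[OF support])
  have "trial \<alpha> p \<xi> n = (\<lambda>t. \<Sum>j\<in>{1..n}. c j * trial \<alpha> p (\<delta> j) n t)"
    unfolding \<xi>_def[abs_def] trial_sum ..
  moreover have "square_integrable (trial \<alpha> p (\<delta> j) n)" if "j \<in> {1..n}" for j
    using that by (intro square_integrable_trial) (simp add: \<delta>_def)
  ultimately have u: "?u = (\<Sum>j\<in>{1..n}. c j *\<^sub>C u j)"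
    unfolding u_def by (simp only:) (rule abs_L2_sum(2), auto)
  have "E {..<0} ?u = (\<Sum>j\<in>{1..n}. c j *\<^sub>C (\<Sum>b\<in>B. a j b *\<^sub>C b))"
    unfolding u by (subst spectral_sum[OF pvm]) (simp_all add: a)
  also have "\<dots> = (\<Sum>j\<in>{1..n}. \<Sum>b\<in>B. (a j b * c j) *\<^sub>C b)"
    by (simp add: complex_vector.scale_sum_right scaleC_scaleC mult.commute)
  also have "\<dots> = (\<Sum>b\<in>B. (\<Sum>j\<in>{1..n}. a j b * c j) *\<^sub>C b)"
    by (subst sum.swap) (simp add: complex_vector.scale_sum_left)
  also have "\<dots> = 0"
    using c(2)[OF InlI] by (intro sum.neutral) (auto simp: A_def)
  finally have "0 \<le> Re (cinner ?v ?u)" by (rule spectral_nonneg[OF E mem])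
  moreover have "Re (cinner ?v ?u) < 0"
    by (rule trial_negative[OF n1 support K(1) bound _ neg]) (use p in auto)
  ultimately show False by simp
qed

text \<open>Too many independent vectors in a window would admit a nonzero combination on which all
  pivot functionals at negative pivots vanish. Its energy is nonnegative by the Jacobi bound and
  negative by the spectral measure.\<close>

lemma negative_squares_le_card:
  assumes E: "is_spectral_measure E (delta_operator x \<alpha>)" and fin: "finite (negative_pivots x \<alpha>)"
  shows "negative_squares E \<le> enat (card (negative_pivots x \<alpha>))"
proof (rule negative_squares_le[OF E], rule ccontr)
  fix n B
  assume B: "finite B" "B \<subseteq> range (E {- real n..<0})" "complex_vector.independent B"
    and "\<not> card B \<le> card (negative_pivots x \<alpha>)"
  then have card: "card (negative_pivots x \<alpha>) < card B" by simp
  note pvm = is_spectral_measureD(1)[OF E]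
  \<comment> \<open>Continuous representatives are fixed first, so that node values depend linearly
    on the combination.\<close>
  have "\<exists>f. square_integrable f \<and> continuous_on UNIV f \<and> b = abs_L2 f" if "b \<in> B" for b
  proof -
    have "b \<in> Domain (delta_operator x \<alpha>)"
      using B(2) that by (intro bounded_spectral_Domain[OF E]) blast
    then obtain v where v: "(b, v) \<in> delta_operator x \<alpha>" by (rule DomainE)
    obtain f g D where "b = abs_L2 f" "regular_function x d \<alpha> f g D"
      by (rule delta_operator_structure[OF spectral_symmetric[OF E v] v])
    then show ?thesis using regular_function.f_sq regular_function.f_cont by blast
  qed
  then obtain F where F: "\<And>b. b \<in> B \<Longrightarrow> square_integrable (F b)" "\<And>b. b \<in> B \<Longrightarrow> continuous_on UNIV (F b)"
    "\<And>b. b \<in> B \<Longrightarrow> b = abs_L2 (F b)"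
    by metis
  obtain c where c: "\<exists>b\<in>B. c b \<noteq> 0"
    "\<And>k. k \<in> negative_pivots x \<alpha> \<Longrightarrow> (\<Sum>b\<in>B. pivot_functional x \<alpha> (\<lambda>i. F b (x i)) k * c b) = 0"
    using homogeneous_system_nontrivial[OF B(1) fin card, of "\<lambda>k b. pivot_functional x \<alpha> (\<lambda>i. F b (x i)) k"] by metis
  define u where "u = (\<Sum>b\<in>B. c b *\<^sub>C b)"
  have "u \<noteq> 0"
    using complex_vector.independentD[OF B(3,1) order_refl, where u = c] c(1) by (auto simp: u_def)
  have u: "u \<in> range (E {- real n..<0})"
    unfolding u_def using B(2)
    by (intro complex_vector.subspace_sum complex_vector.subspace_scale subspace_range_spectral[OF pvm]) auto
  then obtain v where uv: "(u, v) \<in> delta_operator x \<alpha>"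
    using bounded_spectral_Domain[OF E u] by (rule_tac DomainE)
  obtain f g D where fg: "u = abs_L2 f" "v = abs_L2 g" "regular_function x d \<alpha> f g D"
    by (rule delta_operator_structure[OF spectral_symmetric[OF E uv] uv])
  interpret regular_function x d \<alpha> f g D by (rule fg(3))
  have sq: "square_integrable (\<lambda>t. \<Sum>b\<in>B. c b * F b t)"
    and eq: "abs_L2 (\<lambda>t. \<Sum>b\<in>B. c b * F b t) = (\<Sum>b\<in>B. c b *\<^sub>C abs_L2 (F b))"
    using abs_L2_sum[OF B(1) F(1), where c = c] by auto
  have "abs_L2 (\<lambda>t. \<Sum>b\<in>B. c b * F b t) = u"
    unfolding eq u_def using F(3) by (intro sum.cong) auto
  then have "AE t in lebesgue. f t = (\<Sum>b\<in>B. c b * F b t)"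
    using abs_L2_eq_iff[OF f_sq sq] fg(1) by simp
  moreover have "continuous_on UNIV (\<lambda>t. \<Sum>b\<in>B. c b * F b t)"
    using F(2) by (intro continuous_on_sum continuous_on_mult continuous_on_const)
  \<comment> \<open>The representative of the combination and the combination of the representatives
    are both continuous, so they agree at the nodes and not only almost everywhere.\<close>
  ultimately have f: "f = (\<lambda>t. \<Sum>b\<in>B. c b * F b t)"
    by (intro continuous_AE_eq f_cont)
  have zero: "pivot_functional x \<alpha> (\<lambda>i. f (x i)) k = 0" if "k \<in> negative_pivots x \<alpha>" for k
    unfolding f pivot_functional_sum using c(2)[OF that] by (simp add: mult.commute)
  \<comment> \<open>Beyond the last negative pivot every truncation index is admissible in
    \<open>jacobi_form_nonneg\<close>.\<close>
  obtain N where N: "\<And>k. k \<in> negative_pivots x \<alpha> \<Longrightarrow> k \<le> N"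
    using fin by (meson finite_nat_set_iff_bounded_le)
  have "eventually (\<lambda>m. 0 \<le> jacobi_form x \<alpha> m (\<lambda>k. f (x k))) sequentially"
  proof (rule eventually_sequentiallyI[of "Suc N"])
    fix m assume m: "Suc N \<le> m"
    show "0 \<le> jacobi_form x \<alpha> m (\<lambda>k. f (x k))"
      by (rule jacobi_form_nonneg[OF gap_pos zero]) (use N[of m] m in auto)
  qed
  then have "0 \<le> Re (LINT t|lebesgue. g t * cnj (f t))" by (rule energy_nonneg)
  then have "0 \<le> Re (cinner v u)" by (simp only: fg(1,2) cinner_abs_L2[OF g_sq f_sq])
  moreover have "Re (cinner v u) < 0"
    using bounded_spectral_negative[OF E u uv] \<open>u \<noteq> 0\<close> by blast
  ultimately show False by simp
qed

lemma negative_squares_eq: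
  assumes E: "is_spectral_measure E (delta_operator x \<alpha>)"
  shows "negative_squares E = ecount (negative_pivots x \<alpha>)"
proof (cases "finite (negative_pivots x \<alpha>)")
  case True
  have "enat (card (negative_pivots x \<alpha>)) \<le> negative_squares E"
  proof (cases "negative_pivots x \<alpha> = {}")
    case True
    then show ?thesis by (simp add: zero_enat_def[symmetric])
  next
    case False
    \<comment> \<open>The truncation index must itself be a negative pivot for the lower bound, so
      the largest one is taken.\<close>
    let ?n = "Max (negative_pivots x \<alpha>)"
    have "negative_pivots x \<alpha> \<inter> {1..?n} = negative_pivots x \<alpha>"
      using True by (auto simp: negative_pivots_def)
    then show ?thesis
      using negative_squares_ge[OF E Max_in[OF True False]] by simp
  qed
  then show ?thesis
    using negative_squares_le_card[OF E True] True by (simp add: ecount_def)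
next
  case False
  have "enat m \<le> negative_squares E" for m
  proof -
    \<comment> \<open>One element more than required, so that S is nonempty and \<open>Max S\<close>
      is a negative pivot.\<close>
    obtain S where S: "S \<subseteq> negative_pivots x \<alpha>" "finite S" "card S = Suc m"
      using infinite_arbitrarily_large[OF False] by blast
    then have ne: "S \<noteq> {}" by auto
    have "Suc m \<le> card (negative_pivots x \<alpha> \<inter> {1..Max S})"
      unfolding S(3)[symmetric] using S by (intro card_mono) (auto simp: negative_pivots_def)
    then have "enat m \<le> enat (card (negative_pivots x \<alpha> \<inter> {1..Max S}))" by simp
    also have "\<dots> \<le> negative_squares E"
      using S Max_in[OF S(2) ne] by (intro negative_squares_ge[OF E]) auto
    finally show ?thesis .
  qed
  then have "negative_squares E = \<infinity>"
    by (metis enat_ord_simps(1) not_less_eq_eq order_refl enat.exhaust)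
  then show ?thesis using False by (simp add: ecount_def)
qed

end

theorem theorem3p5:
  fixes x \<alpha> :: "nat \<Rightarrow> real"
    and E :: "real set \<Rightarrow> L2 \<Rightarrow> L2"
  assumes "strict_mono_on {1..} x"
    and "0 < (INF k\<in>{1..}. gap x k)"
    and "bdd_above (gap x ` {1..})"
    and "is_spectral_measure E (delta_operator x \<alpha>)"
  shows "negative_squares E =
    num_negative (gamma_seq x \<alpha>) + num_infinite (gamma_seq x \<alpha>)"
proof -
  have pos: "0 < gap x k" if "k \<ge> 1" for k
    using strict_mono_onD[OF assms(1), of k "Suc k"] that by (simp add: gap_def)
  then have "bdd_below (gap x ` {1..})"
    by (intro bdd_belowI[of _ 0]) (auto intro: less_imp_le)
  then have "(INF k\<in>{1..}. gap x k) \<le> gap x k" if "k \<ge> 1" for k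
    using that by (intro cINF_lower) auto
  \<comment> \<open>The infimum of the gaps serves as the constant d.\<close>
  then interpret separated_points x "INF k\<in>{1..}. gap x k"
    by unfold_locales (use assms(2) in auto)
  show ?thesis
    unfolding ecount_negative_pivots by (rule negative_squares_eq[OF assms(4)])
qed

end
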